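(* Let $N\ge 2$ and let $p,q\in\mathbb R$ satisfy $p+q<\dfrac{N+3}{N-1}$. Then the equation $-\Delta u=u^p|\nabla u|^q$ possesses no nontrivial positive solution in $\mathbb R^N$.
   Context: A (weak) solution of $-\Delta u=u^p|\nabla u|^q$ in $\mathbb R^N$ is a function $u\in C^1(\mathbb R^N)$ such that $u^p|\nabla u|^q\in L^1_{loc}(\mathbb R^N)$ and $\int_{\mathbb R^N}\langle\nabla u,\nabla\psi\rangle=\int_{\mathbb R^N}u^p|\nabla u|^q\psi$ for all $\psi\in C_0^\infty(\mathbb R^N)$. The exponents $p,q$ are real and may be negative; for $q<0$ the term $u^p|\nabla u|^q$ is singular (equal to $+\infty$) where $\nabla u=0$; for $q=0$ the equation is $-\Delta u=u^p$. A positive solution is called nontrivial if it is not constant. *)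

theory Defs
  imports "HOL-Analysis.Analysis"
begin

definition gradient :: "('a::real_inner \<Rightarrow> real) \<Rightarrow> 'a \<Rightarrow> 'a" where
  "gradient f x = (THE D. GDERIV f x :> D)"

lemma gradient_eqI:
  assumes "GDERIV f x :> D"
  shows "gradient f x = D"
  unfolding gradient_def
proof (rule the_equality)
  fix E assume "GDERIV f x :> E"
  then have "(\<lambda>h. h \<bullet> E) = (\<lambda>h. h \<bullet> D)"
    using assms unfolding gderiv_def by (rule has_derivative_unique)
  then have "h \<bullet> E = h \<bullet> D" for h
    by (rule fun_cong)
  then show "E = D"
    using vector_eq_ldot[of E D] by (simp only: simp_thms)
qed (rule assms)

text \<open>\<open>C_class k f\<close>: f has continuous partial derivatives up to order k on the whole space;
  the partial derivatives are the components of the gradient in the standard basis.\<close>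

primrec C_class :: "nat \<Rightarrow> ('a::euclidean_space \<Rightarrow> real) \<Rightarrow> bool" where
  "C_class 0 f \<longleftrightarrow> continuous_on UNIV f"
| "C_class (Suc k) f \<longleftrightarrow>
     (\<forall>x. f differentiable (at x)) \<and> (\<forall>b\<in>Basis. C_class k (\<lambda>x. gradient f x \<bullet> b))"

definition test_function :: "('a::euclidean_space \<Rightarrow> real) \<Rightarrow> bool" where
  "test_function \<psi> \<longleftrightarrow> (\<forall>k. C_class k \<psi>) \<and> compact (closure (support_on UNIV \<psi>))"

text \<open>The q-th power of \<open>t \<ge> 0\<close>, with value \<open>\<infinity>\<close> at \<open>t = 0\<close> when \<open>q < 0\<close>, and identically 1 for
  \<open>q = 0\<close> (so that the equation then has no gradient term); \<open>(powr)\<close> alone would give 0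
  at \<open>t = 0\<close> in both cases.\<close>

definition sing_powr :: "real \<Rightarrow> real \<Rightarrow> ennreal" where
  "sing_powr t q = (if q = 0 then 1 else if t = 0 \<and> q < 0 then \<infinity> else ennreal (t powr q))"

definition reaction :: "real \<Rightarrow> real \<Rightarrow> ('a::euclidean_space \<Rightarrow> real) \<Rightarrow> 'a \<Rightarrow> ennreal" where
  "reaction p q u x = ennreal (u x powr p) * sing_powr (norm (gradient u x)) q"

text \<open>Local integrability makes the reaction term finite almost everywhere, so that
  \<open>enn2real\<close> changes it only on a null set.\<close>

definition positive_solution :: "real \<Rightarrow> real \<Rightarrow> ('a::euclidean_space \<Rightarrow> real) \<Rightarrow> bool" where
  "positive_solution p q u \<longleftrightarrow>
     C_class 1 u \<and> (\<forall>x. 0 < u x) \<and>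
     (\<forall>K. compact K \<longrightarrow> (\<integral>\<^sup>+x\<in>K. reaction p q u x \<partial>lborel) < \<infinity>) \<and>
     (\<forall>\<psi>. test_function \<psi> \<longrightarrow>
        (\<integral>x. gradient u x \<bullet> gradient \<psi> x \<partial>lborel) =
        (\<integral>x. enn2real (reaction p q u x) * \<psi> x \<partial>lborel))"

end

theory Submission
  imports Defs
begin

text \<open>
  Put \<open>v = ln u\<close>, \<open>h = |\<nabla>v|\<^sup>2\<close>, \<open>s = p + q - 1\<close> and \<open>F = e\<^sup>s\<^sup>v h\<^sup>q\<^sup>/\<^sup>2\<close>, so that \<open>\<Delta>v = -(F + h)\<close> where \<open>\<nabla>u \<noteq> 0\<close>.
  Bochner's formula gives \<open>\<Delta>h/2 \<ge> (F + h)\<^sup>2/(N - 1) - s F h\<close> up to terms containing \<open>\<nabla>h\<close>, and the right-hand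
  side is bounded below by a positive multiple of \<open>(F + h)\<^sup>2\<close> precisely when \<open>s < 4/(N - 1)\<close>. At a maximum point
  of \<open>\<zeta>\<^sup>2 h\<close> with \<open>\<zeta> = 1 - |x|\<^sup>2/R\<^sup>2\<close> the gradient terms are controlled by \<open>\<zeta>\<close>, whence \<open>\<zeta> |\<nabla>v| \<le> C/R\<close> on the ball of
  radius \<open>R\<close>; let \<open>R \<rightarrow> \<infinity>\<close>. A maximum point has \<open>h > 0\<close>, so the singular set \<open>{\<nabla>u = 0}\<close> plays no role.

  The argument needs \<open>u\<close> of class \<open>C\<^sup>3\<close> on \<open>{\<nabla>u \<noteq> 0}\<close>. There the right-hand side is continuous, and a bootstrap
  applies: a continuous right-hand side gives \<open>\<nabla>u\<close> locally Hoelder-\<open>1/2\<close>, and a locally Hoelder-\<open>1/2\<close> right-hand side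
  gives \<open>u \<in> C\<^sup>2\<close>; both steps are used for \<open>u\<close> and then for its partial derivatives. They follow from
  the scale derivative of the means of \<open>u\<close> against a radial bump, which is a mean of the right-hand side.
\<close>

section \<open>Functions of class \<open>C\<^sup>k\<close>\<close>

text \<open>With v = ln u the equation becomes homogeneous: u^p |\<nabla>u|^q / u = u^(p+q-1)
  |\<nabla>v|^q, so the exponent of e^v contains only p + q. The bad term s F h competes with (F +
  h)^2/(N - 1), and 4 F h \<le> (F + h)^2 is sharp at F = h; since (N + 3)/(N - 1) - 1 = 4/(N - 1),
  this is where the bound on p + q comes from. The obstacle is that u is only C^1 while Bochner's
  formula differentiates the equation for \<Delta>v. The kernels are radial because z times the
  derivative of the profile is then a gradient: differentiating a mean in its scale brings down z,
  and the weak equation tested with a bump appears. The resulting pointwise formula is linear in u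
  and the right-hand side and can itself be differentiated, so no weak equation for the partial
  derivatives of u has to be derived. The scale is a fourth power so that each space derivative
  lowers an integer weight by 4 and the square root from Hoelder-1/2 continuity is again an integer
  power.\<close>

lemma has_derivative_gradient:
  fixes f :: "'a::euclidean_space \<Rightarrow> real"
  assumes "f differentiable (at x)"
  shows "(f has_derivative (\<lambda>h. h \<bullet> gradient f x)) (at x)"
proof -
  obtain f' where f': "(f has_derivative f') (at x)"
    using assms unfolding differentiable_def by blast
  interpret bounded_linear f' using f' by (rule has_derivative_bounded_linear)
  \<comment> \<open>The values on \<open>Basis\<close> give the representing vector, so the definite
    description in \<open>gradient\<close> has a witness.\<close>
  have "f' h = h \<bullet> (\<Sum>b\<in>Basis. f' b *\<^sub>R b)" for h
  proof -
    have "f' h = f' (\<Sum>b\<in>Basis. (h \<bullet> b) *\<^sub>R b)" by (simp add: euclidean_representation)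
    also have "\<dots> = (\<Sum>b\<in>Basis. (h \<bullet> b) * f' b)" by (simp add: sum scale)
    finally show ?thesis by (simp add: inner_sum_right mult.commute)
  qed
  then have "(f has_derivative (\<lambda>h. h \<bullet> (\<Sum>b\<in>Basis. f' b *\<^sub>R b))) (at x)"
    using f' by (metis (no_types, lifting) ext)
  then show ?thesis
    using gradient_eqI[of f x] unfolding gderiv_def by metis
qed

lemma has_derivative_gradientD:
  assumes "(f has_derivative (\<lambda>h. h \<bullet> D)) (at x)"
  shows "f differentiable (at x)" "gradient f x = D"
  using assms gradient_eqI[of f x D] unfolding gderiv_def differentiable_def by auto

lemma has_derivative_gradient_within_open:
  fixes f :: "'a::euclidean_space \<Rightarrow> real"
  assumes "(f has_derivative (\<lambda>h. h \<bullet> D)) (at x)" "open S" "x \<in> S" "\<And>y. y \<in> S \<Longrightarrow> f y = g y"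
  shows "(g has_derivative (\<lambda>h. h \<bullet> D)) (at x)"
  using has_derivative_transform_within_open[OF assms(1-3)] assms(4) by auto

lemma gradient_cong_open:
  fixes f :: "'a::euclidean_space \<Rightarrow> real"
  assumes "open S" "x \<in> S" "\<And>y. y \<in> S \<Longrightarrow> f y = g y"
  shows "gradient f x = gradient g x"
proof -
  have "GDERIV f x :> D = GDERIV g x :> D" for D
    unfolding gderiv_def
    using has_derivative_gradient_within_open[OF _ assms(1,2), of f D g]
      has_derivative_gradient_within_open[OF _ assms(1,2), of g D f] assms(3) by auto
  then have "gderiv f x = gderiv g x" by blast
  then show ?thesis unfolding gradient_def by simp
qed

lemma differentiable_cong_open:
  fixes f :: "'a::euclidean_space \<Rightarrow> real"
  assumes "open S" "x \<in> S" "\<And>y. y \<in> S \<Longrightarrow> f y = g y" "f differentiable (at x)"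
  shows "g differentiable (at x)"
  using assms has_derivative_transform_within_open unfolding differentiable_def by blast

text \<open>Local form of \<open>C_class\<close>, needed because u is regular only off its critical
  set. Derivatives are taken at points of the whole space, not within \<open>S\<close>; for open
  \<open>S\<close> this is the usual class.\<close>

primrec Ck_on :: "nat \<Rightarrow> 'a::euclidean_space set \<Rightarrow> ('a \<Rightarrow> real) \<Rightarrow> bool" where
  "Ck_on 0 S f \<longleftrightarrow> continuous_on S f"
| "Ck_on (Suc k) S f \<longleftrightarrow>
     (\<forall>x\<in>S. f differentiable (at x)) \<and> (\<forall>b\<in>Basis. Ck_on k S (\<lambda>x. gradient f x \<bullet> b))"

lemma C_class_iff_Ck_on: "C_class k f \<longleftrightarrow> Ck_on k UNIV f"
  by (induction k arbitrary: f) auto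

lemma Ck_on_continuous: "Ck_on k S f \<Longrightarrow> continuous_on S f"
  by (cases k) (auto intro!: continuous_at_imp_continuous_on differentiable_imp_continuous_within)

lemma Ck_on_SucD: "Ck_on (Suc k) S f \<Longrightarrow> Ck_on k S f"
proof (induction k arbitrary: f)
  case 0 then show ?case using Ck_on_continuous[of "Suc 0" S f] by simp
next
  case (Suc k) then show ?case by (metis Ck_on.simps(2))
qed

lemma Ck_on_mono: "Ck_on k S f \<Longrightarrow> j \<le> k \<Longrightarrow> Ck_on j S f"
proof (induction k)
  case (Suc k)
  then show ?case using Ck_on_SucD[of k S f] by (cases "j = Suc k") auto
qed simp

lemma Ck_on_subset: "Ck_on k S f \<Longrightarrow> T \<subseteq> S \<Longrightarrow> Ck_on k T f"
  by (induction k arbitrary: f) (auto intro: continuous_on_subset)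

lemma Ck_on_cong:
  assumes "open S" "\<And>x. x \<in> S \<Longrightarrow> f x = g x" "Ck_on k S f"
  shows "Ck_on k S g"
  using assms(2,3)
proof (induction k arbitrary: f g)
  case 0 then show ?case using continuous_on_cong by force
next
  case (Suc k)
  have "Ck_on k S (\<lambda>x. gradient g x \<bullet> b)" if "b \<in> Basis" for b
  proof (rule Suc.IH)
    show "Ck_on k S (\<lambda>x. gradient f x \<bullet> b)" using Suc.prems that by simp
  qed (use gradient_cong_open[OF \<open>open S\<close>, of _ f g] Suc.prems in simp)
  moreover have "g differentiable (at x)" if "x \<in> S" for x
    using differentiable_cong_open[OF \<open>open S\<close> that, of f g] Suc.prems that by simp
  ultimately show ?case by simp
qed

lemma Ck_on_SucI:
  assumes "open S" "\<And>x. x \<in> S \<Longrightarrow> (f has_derivative (\<lambda>h. h \<bullet> D x)) (at x)"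
    "\<And>b. b \<in> Basis \<Longrightarrow> Ck_on k S (\<lambda>x. D x \<bullet> b)"
  shows "Ck_on (Suc k) S f"
proof -
  have "Ck_on k S (\<lambda>x. gradient f x \<bullet> b)" if "b \<in> Basis" for b
    using assms(3)[OF that]
    by (rule Ck_on_cong[OF assms(1), rotated]) (simp add: has_derivative_gradientD(2)[OF assms(2)])
  then show ?thesis
    using has_derivative_gradientD(1)[OF assms(2)] by simp
qed

lemma Ck_on_SucD':
  assumes "Ck_on (Suc k) S f" "x \<in> S"
  shows "(f has_derivative (\<lambda>h. h \<bullet> gradient f x)) (at x)"
  using assms has_derivative_gradient by auto

lemma Ck_on_const: "open S \<Longrightarrow> Ck_on k S (\<lambda>x. c)"
proof (induction k arbitrary: c)
  case (Suc k)
  then show ?case by (intro Ck_on_SucI[of _ _ "\<lambda>x. 0"]) auto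
qed auto

lemma Ck_on_add:
  assumes "open S" "Ck_on k S f" "Ck_on k S g"
  shows "Ck_on k S (\<lambda>x. f x + g x)"
  using assms(2,3)
proof (induction k arbitrary: f g)
  case 0 then show ?case by (auto intro: continuous_intros)
next
  case (Suc k)
  show ?case
    using has_derivative_add[OF Ck_on_SucD'[OF Suc.prems(1)] Ck_on_SucD'[OF Suc.prems(2)]]
      Suc.prems Suc.IH
    by (intro Ck_on_SucI[OF \<open>open S\<close>, of _ "\<lambda>x. gradient f x + gradient g x"])
      (simp_all add: inner_add_right inner_add_left)
qed

lemma Ck_on_mult:
  assumes "open S" "Ck_on k S f" "Ck_on k S g"
  shows "Ck_on k S (\<lambda>x. f x * g x)"
  using assms(2,3)
proof (induction k arbitrary: f g)
  case 0 then show ?case by (auto intro: continuous_intros)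
next
  case (Suc k)
  have "((\<lambda>x. f x * g x) has_derivative (\<lambda>h. h \<bullet> (f x *\<^sub>R gradient g x + g x *\<^sub>R gradient f x))) (at x)"
    if "x \<in> S" for x
    using has_derivative_mult[OF Ck_on_SucD'[OF Suc.prems(1) that] Ck_on_SucD'[OF Suc.prems(2) that]]
    by (simp add: inner_add_right mult.commute)
  then show ?case
    using Suc.prems Suc.IH Ck_on_SucD[OF Suc.prems(1)] Ck_on_SucD[OF Suc.prems(2)]
    by (intro Ck_on_SucI[OF \<open>open S\<close>, of _ "\<lambda>x. f x *\<^sub>R gradient g x + g x *\<^sub>R gradient f x"])
      (simp_all add: inner_add_left Ck_on_add[OF \<open>open S\<close>])
qed

lemma Ck_on_cmult: "open S \<Longrightarrow> Ck_on k S f \<Longrightarrow> Ck_on k S (\<lambda>x. c * f x)"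
  by (intro Ck_on_mult Ck_on_const)

lemma Ck_on_sum:
  assumes "open S" "\<And>i. i \<in> I \<Longrightarrow> Ck_on k S (f i)"
  shows "Ck_on k S (\<lambda>x. \<Sum>i\<in>I. f i x)"
  using assms(2)
  by (induction I rule: infinite_finite_induct) (simp_all add: Ck_on_const Ck_on_add assms(1))

lemma Ck_on_inner_const: "open S \<Longrightarrow> Ck_on k S (\<lambda>x. x \<bullet> c)"
proof (cases k)
  case (Suc j)
  assume "open S"
  then show ?thesis unfolding Suc
    by (intro Ck_on_SucI[of _ _ "\<lambda>x. c"]) (auto intro!: Ck_on_const derivative_eq_intros)
qed (auto intro: continuous_intros)

lemma has_derivative_compose_gradient:
  fixes f :: "'a::euclidean_space \<Rightarrow> real"
  assumes "(f has_derivative (\<lambda>h. h \<bullet> D)) (at x)" "(g has_real_derivative d) (at (f x))"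
  shows "((\<lambda>x. g (f x)) has_derivative (\<lambda>h. h \<bullet> (d *\<^sub>R D))) (at x)"
  using has_derivative_compose[OF assms(1) assms(2)[unfolded has_field_derivative_def]]
  by (simp add: mult.commute)

text \<open>The outer function is given together with all its derivatives, \<open>G (Suc n)\<close>
  being the derivative of \<open>G n\<close>. With \<open>n\<close> arbitrary the induction on
  \<open>k\<close> closes, since the chain rule turns \<open>G n\<close> into
  \<open>G (Suc n)\<close>.\<close>

lemma Ck_on_compose:
  fixes G :: "nat \<Rightarrow> real \<Rightarrow> real"
  assumes "open S" "\<And>n t. t \<in> T \<Longrightarrow> (G n has_real_derivative G (Suc n) t) (at t)"
    "\<And>x. x \<in> S \<Longrightarrow> f x \<in> T" "Ck_on k S f"
  shows "Ck_on k S (\<lambda>x. G n (f x))"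
  using assms(4)
proof (induction k arbitrary: n)
  case 0
  have "continuous_on (f ` S) (G n)"
    using assms(2,3) by (intro continuous_at_imp_continuous_on) (auto intro!: DERIV_isCont)
  then show ?case using 0 continuous_on_compose[of S f "G n"] by (auto simp: o_def)
next
  case (Suc k)
  show ?case
    using Suc.prems Suc.IH Ck_on_SucD[OF Suc.prems]
    by (intro Ck_on_SucI[OF \<open>open S\<close>, of _ "\<lambda>x. G (Suc n) (f x) *\<^sub>R gradient f x"]
        has_derivative_compose_gradient Ck_on_SucD'[OF Suc.prems] assms(2,3))
      (simp_all add: Ck_on_mult[OF \<open>open S\<close>])
qed

lemma Ck_on_powr:
  assumes "open S" "Ck_on k S f" "\<And>x. x \<in> S \<Longrightarrow> f x > 0"
  shows "Ck_on k S (\<lambda>x. f x powr a)"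
proof -
  \<comment> \<open>The n-th derivative of t^a: a falling factorial times t^(a-n).\<close>
  define G where "G n t = (\<Prod>i<n. a - real i) * t powr (a - real n)" for n :: nat and t :: real
  have "(G n has_real_derivative G (Suc n) t) (at t)" if "t \<in> {0<..}" for n t
    unfolding G_def using that
    by (auto intro!: derivative_eq_intros simp: algebra_simps)
  from Ck_on_compose[of S "{0<..}" G f k 0, OF assms(1) this] assms(2,3)
  show ?thesis by (simp add: G_def)
qed

lemma Ck_on_locally:
  assumes "\<And>x. x \<in> S \<Longrightarrow> \<exists>U. open U \<and> x \<in> U \<and> Ck_on k U f"
  shows "Ck_on k S f"
  using assms
proof (induction k arbitrary: f)
  case 0
  have "isCont f x" if "x \<in> S" for x
    using 0[OF that] continuous_on_eq_continuous_at by auto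
  then show ?case by (simp add: continuous_at_imp_continuous_on)
next
  case (Suc k)
  have "Ck_on k S (\<lambda>x. gradient f x \<bullet> b)" if "b \<in> Basis" for b
    by (rule Suc.IH) (use Suc.prems that in force)
  moreover have "f differentiable (at x)" if "x \<in> S" for x
    using Suc.prems[OF that] by auto
  ultimately show ?case by simp
qed

section \<open>Symmetry of second derivatives and the second-derivative test at a maximum\<close>

lemma has_derivative_line:
  fixes f :: "'a::euclidean_space \<Rightarrow> real"
  assumes "(f has_derivative (\<lambda>h. h \<bullet> D)) (at (y + t *\<^sub>R a))"
  shows "((\<lambda>t. f (y + t *\<^sub>R a)) has_real_derivative (a \<bullet> D)) (at t)"
proof -
  have "((\<lambda>t. y + t *\<^sub>R a) has_derivative (\<lambda>h. h *\<^sub>R a)) (at t)"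
    by (auto intro!: derivative_eq_intros)
  from has_derivative_compose[OF this assms] show ?thesis
    unfolding has_field_derivative_def by (simp add: mult_commute_abs)
qed

text \<open>The second difference of f over a square of side s does not depend on the order of the
  two directions. Two applications of the mean value theorem write it as s^2 times a mixed
  derivative near x, in either order; continuity then leaves no gap between the two values at
  x.\<close>

lemma second_derivatives_symmetric:
  fixes f :: "'a::euclidean_space \<Rightarrow> real"
  assumes "open S" "Ck_on 2 S f" "x \<in> S" "a \<in> Basis" "b \<in> Basis"
  shows "gradient (\<lambda>x. gradient f x \<bullet> a) x \<bullet> b = gradient (\<lambda>x. gradient f x \<bullet> b) x \<bullet> a"
proof (rule ccontr)
  assume ne: "\<not> ?thesis"
  define F where "F a b y = gradient (\<lambda>x. gradient f x \<bullet> a) y \<bullet> b" for a b y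
  define e where "e = \<bar>F a b x - F b a x\<bar> / 2"
  have "e > 0" using ne by (simp add: e_def F_def)
  have C1: "Ck_on 1 S f" using Ck_on_mono[OF assms(2), of 1] by simp
  have d1: "(f has_derivative (\<lambda>h. h \<bullet> gradient f y)) (at y)" if "y \<in> S" for y
    using Ck_on_SucD'[of 0 S f y] C1 that by simp
  have d2: "((\<lambda>x. gradient f x \<bullet> a) has_derivative (\<lambda>h. h \<bullet> gradient (\<lambda>x. gradient f x \<bullet> a) y)) (at y)"
    if "y \<in> S" "a \<in> Basis" for y a
    using assms(2) that by (intro Ck_on_SucD'[of 0 S]) (auto simp: numeral_2_eq_2)
  have cont: "continuous_on S (F a b)" if "a \<in> Basis" "b \<in> Basis" for a b
    using assms(2) that unfolding F_def by (auto simp: numeral_2_eq_2)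
  have key: "\<exists>d>0. \<forall>s. 0 < s \<and> s < d \<longrightarrow> (\<exists>y. \<bar>F a b y - F a b x\<bar> < e \<and>
      f (x + s *\<^sub>R a + s *\<^sub>R b) - f (x + s *\<^sub>R a) - f (x + s *\<^sub>R b) + f x = s * s * F a b y)"
    if ab: "a \<in> Basis" "b \<in> Basis" for a b
  proof -
    obtain d1' where d1': "d1' > 0" "ball x d1' \<subseteq> S"
      using assms(1,3) openE by blast
    have "isCont (F a b) x"
      using cont[OF ab] assms(1,3) continuous_on_eq_continuous_at by blast
    then obtain d2' where d2': "d2' > 0" "\<And>y. dist y x < d2' \<Longrightarrow> dist (F a b y) (F a b x) < e"
      using \<open>e > 0\<close> unfolding continuous_at_eps_delta by blast
    \<comment> \<open>Points of the square of side s lie within 2 s of x, so a third of the radius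
      leaves room.\<close>
    define d where "d = min d1' d2' / 3"
    have "d > 0" using d1' d2' by (simp add: d_def)
    moreover have "\<exists>y. \<bar>F a b y - F a b x\<bar> < e \<and>
      f (x + s *\<^sub>R a + s *\<^sub>R b) - f (x + s *\<^sub>R a) - f (x + s *\<^sub>R b) + f x = s * s * F a b y"
      if s: "0 < s" "s < d" for s
    proof -
      have near: "dist (x + r *\<^sub>R a + t *\<^sub>R b) x < min d1' d2'" if "0 \<le> r" "r \<le> s" "0 \<le> t" "t \<le> s" for r t
      proof -
        have "norm (r *\<^sub>R a + t *\<^sub>R b) \<le> r * 1 + t * 1"
          using that ab by (intro norm_triangle_mono) simp_all
        also have "\<dots> < min d1' d2'"
          using that s d1'(1) d2'(1) by (auto simp: d_def)
        finally show ?thesis by (simp add: dist_norm add.assoc)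
      qed
      have inS: "x + r *\<^sub>R a + t *\<^sub>R b \<in> S" if "0 \<le> r" "r \<le> s" "0 \<le> t" "t \<le> s" for r t
        using near[OF that] d1'(2) by (intro subsetD[OF d1'(2)]) (simp add: dist_commute)
      define \<phi> where "\<phi> r = f (x + s *\<^sub>R b + r *\<^sub>R a) - f (x + r *\<^sub>R a)" for r
      have "(\<phi> has_real_derivative (a \<bullet> gradient f (x + s *\<^sub>R b + r *\<^sub>R a) - a \<bullet> gradient f (x + r *\<^sub>R a))) (at r)"
        if "0 \<le> r" "r \<le> s" for r
        unfolding \<phi>_def using inS[OF that, of s] inS[OF that, of 0] s
        by (intro DERIV_diff has_derivative_line d1) (auto simp: algebra_simps)
      from MVT2[OF s(1) this] obtain r where r: "0 < r" "r < s"
        "\<phi> s - \<phi> 0 = s * (a \<bullet> gradient f (x + s *\<^sub>R b + r *\<^sub>R a) - a \<bullet> gradient f (x + r *\<^sub>R a))"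
        by auto
      define \<psi> where "\<psi> t = gradient f (x + r *\<^sub>R a + t *\<^sub>R b) \<bullet> a" for t
      have "(\<psi> has_real_derivative (b \<bullet> gradient (\<lambda>x. gradient f x \<bullet> a) (x + r *\<^sub>R a + t *\<^sub>R b))) (at t)"
        if "0 \<le> t" "t \<le> s" for t
        unfolding \<psi>_def using inS[OF _ _ that, of r] r ab
        by (intro has_derivative_line[where f="\<lambda>x. gradient f x \<bullet> a"] d2) auto
      from MVT2[OF s(1) this] obtain t where t: "0 < t" "t < s"
        "\<psi> s - \<psi> 0 = s * (b \<bullet> gradient (\<lambda>x. gradient f x \<bullet> a) (x + r *\<^sub>R a + t *\<^sub>R b))"
        by auto
      have "f (x + s *\<^sub>R a + s *\<^sub>R b) - f (x + s *\<^sub>R a) - f (x + s *\<^sub>R b) + f x = \<phi> s - \<phi> 0"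
        by (simp add: \<phi>_def algebra_simps)
      also have "\<dots> = s * (\<psi> s - \<psi> 0)"
        using r(3) by (simp add: \<psi>_def inner_commute algebra_simps)
      also have "\<dots> = s * s * F a b (x + r *\<^sub>R a + t *\<^sub>R b)"
        using t(3) by (simp add: F_def inner_commute)
      finally show ?thesis
        using d2'(2)[of "x + r *\<^sub>R a + t *\<^sub>R b"] near[of r t] r t by (auto simp: dist_real_def)
    qed
    ultimately show ?thesis by blast
  qed
  obtain d where d: "d > 0" "\<And>s. 0 < s \<Longrightarrow> s < d \<Longrightarrow> (\<exists>y. \<bar>F a b y - F a b x\<bar> < e \<and>
      f (x + s *\<^sub>R a + s *\<^sub>R b) - f (x + s *\<^sub>R a) - f (x + s *\<^sub>R b) + f x = s * s * F a b y)"
    using key[OF assms(4,5)] by blast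
  obtain d' where d': "d' > 0" "\<And>s. 0 < s \<Longrightarrow> s < d' \<Longrightarrow> (\<exists>y. \<bar>F b a y - F b a x\<bar> < e \<and>
      f (x + s *\<^sub>R b + s *\<^sub>R a) - f (x + s *\<^sub>R b) - f (x + s *\<^sub>R a) + f x = s * s * F b a y)"
    using key[OF assms(5,4)] by blast
  define s where "s = min d d' / 2"
  have s: "0 < s" "s < d" "s < d'" using d(1) d'(1) by (auto simp: s_def)
  obtain y z where "\<bar>F a b y - F a b x\<bar> < e" "\<bar>F b a z - F b a x\<bar> < e" "s * s * F a b y = s * s * F b a z"
    using d(2)[OF s(1,2)] d'(2)[OF s(1,3)] by (smt (verit) add.commute add.left_commute)
  then have "\<bar>F a b y - F a b x\<bar> < e" "\<bar>F b a z - F b a x\<bar> < e" "F a b y = F b a z"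
    using s(1) by simp_all
  then show False unfolding e_def by argo
qed

text \<open>If the second derivative along b were positive, the first one, which vanishes at x,
  would be positive just after x on the line in direction b, and f would exceed its maximum
  there.\<close>

lemma second_derivative_nonpos_at_max:
  fixes f :: "'a::euclidean_space \<Rightarrow> real"
  assumes "open S" "Ck_on 2 S f" "x \<in> S" "\<And>y. y \<in> S \<Longrightarrow> f y \<le> f x" "b \<in> Basis"
  shows "gradient f x = 0" "gradient (\<lambda>x. gradient f x \<bullet> b) x \<bullet> b \<le> 0"
proof -
  have C1: "Ck_on (Suc 0) S f" using Ck_on_mono[OF assms(2), of 1] by simp
  have d1: "(f has_derivative (\<lambda>h. h \<bullet> gradient f y)) (at y)" if "y \<in> S" for y
    using Ck_on_SucD'[OF C1 that] .
  have d2: "((\<lambda>x. gradient f x \<bullet> b) has_derivative (\<lambda>h. h \<bullet> gradient (\<lambda>x. gradient f x \<bullet> b) x)) (at x)"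
    using assms(2,3,5) by (intro Ck_on_SucD'[of 0 S]) (auto simp: numeral_2_eq_2)
  have "(\<lambda>h. h \<bullet> gradient f x) = (\<lambda>v. 0)"
    using differential_zero_maxmin[OF assms(3,1) d1[OF assms(3)]] assms(4) by blast
  then have "gradient f x \<bullet> gradient f x = 0" by (rule fun_cong)
  then show g0: "gradient f x = 0" by simp
  show "gradient (\<lambda>x. gradient f x \<bullet> b) x \<bullet> b \<le> 0"
  proof (rule ccontr)
    assume "\<not> ?thesis"
    then have pos: "b \<bullet> gradient (\<lambda>x. gradient f x \<bullet> b) x > 0" by (simp add: inner_commute)
    have "((\<lambda>t. gradient f (x + t *\<^sub>R b) \<bullet> b) has_real_derivative b \<bullet> gradient (\<lambda>x. gradient f x \<bullet> b) x) (at 0)"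
      using has_derivative_line[of "\<lambda>x. gradient f x \<bullet> b" _ x 0 b] d2 by simp
    from DERIV_pos_inc_right[OF this pos] obtain d where d: "d > 0"
      "\<And>h. 0 < h \<Longrightarrow> h < d \<Longrightarrow> 0 < gradient f (x + h *\<^sub>R b) \<bullet> b"
      by (auto simp: g0)
    obtain e where e: "e > 0" "ball x e \<subseteq> S" using assms(1,3) openE by blast
    define s where "s = min d e / 2"
    have s: "0 < s" "s < d" "s < e" using d(1) e(1) by (auto simp: s_def)
    have inS: "x + t *\<^sub>R b \<in> S" if "0 \<le> t" "t \<le> s" for t
      using that s assms(5) by (intro subsetD[OF e(2)]) (simp add: dist_norm)
    have "((\<lambda>t. f (x + t *\<^sub>R b)) has_real_derivative b \<bullet> gradient f (x + t *\<^sub>R b)) (at t)"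
      if "0 \<le> t" "t \<le> s" for t
      using inS[OF that] by (intro has_derivative_line d1)
    from MVT2[OF s(1) this] obtain t where t: "0 < t" "t < s"
      "f (x + s *\<^sub>R b) - f x = s * (b \<bullet> gradient f (x + t *\<^sub>R b))" by auto
    have "f (x + s *\<^sub>R b) - f x > 0"
      using t d(2)[of t] s by (simp add: inner_commute)
    then show False using assms(4)[OF inS[of s]] s by simp
  qed
qed

section \<open>Means against a radial bump\<close>

text \<open>The polynomials P with P(1/t) exp(-1/t) as n-th derivative of exp(-1/t). In the variable
  y = 1/t the derivative in t is -y^2 d/dy, whence the recursion y^2 (P - P').\<close>

fun flat_poly :: "nat \<Rightarrow> real poly" where
  "flat_poly 0 = 1"
| "flat_poly (Suc n) = [:0, 0, 1:] * (flat_poly n - pderiv (flat_poly n))"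

definition flat :: "nat \<Rightarrow> real \<Rightarrow> real" where
  "flat n t = (if t \<le> 0 then 0 else poly (flat_poly n) (1 / t) * exp (- (1 / t)))"

lemma poly_exp_tendsto_0: "((\<lambda>x. poly p x * exp (- x)) \<longlongrightarrow> (0::real)) at_top"
proof -
  have "((\<lambda>x. \<Sum>i\<le>degree p. coeff p i * (x ^ i / exp x)) \<longlongrightarrow> (\<Sum>i\<le>degree p. coeff p i * 0)) at_top"
    by (intro tendsto_intros tendsto_power_div_exp_0)
  then show ?thesis
    by (simp add: poly_altdef sum_distrib_right exp_minus divide_inverse mult.assoc)
qed

lemma has_real_derivative_flat: "(flat n has_real_derivative flat (Suc n) t) (at t)"
proof -
  consider "t < 0" | "t > 0" | "t = 0" by linarith
  then show ?thesis
  proof cases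
    case 1
    have "((\<lambda>_. 0) has_real_derivative 0) (at t)" by simp
    then have "(flat n has_real_derivative 0) (at t)"
      by (rule has_field_derivative_transform_within_open[of _ _ t "{..<0}"])
        (use 1 in \<open>simp_all add: flat_def\<close>)
    then show ?thesis using 1 by (simp add: flat_def)
  next
    case 2
    have "((\<lambda>t. poly (flat_poly n) (1 / t) * exp (- (1 / t))) has_real_derivative flat (Suc n) t) (at t)"
    proof -
      have i: "((\<lambda>t::real. 1 / t) has_real_derivative (- ((1 / t) ^ 2))) (at t)"
        using 2 by (auto intro!: derivative_eq_intros simp: power2_eq_square)
      have "((\<lambda>t. exp (- (1 / t))) has_real_derivative (exp (- (1 / t)) * - (- ((1 / t) ^ 2)))) (at t)"
        by (rule DERIV_fun_exp[OF DERIV_minus[OF i]])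
      from DERIV_mult[OF DERIV_chain2[OF poly_DERIV i] this]
      have "((\<lambda>t. poly (flat_poly n) (1 / t) * exp (- (1 / t))) has_real_derivative
        (poly (pderiv (flat_poly n)) (1 / t) * (- ((1 / t) ^ 2)) * exp (- (1 / t)) +
        exp (- (1 / t)) * - (- ((1 / t) ^ 2)) * poly (flat_poly n) (1 / t))) (at t)" .
      then show ?thesis
        by (rule DERIV_cong) (use 2 in \<open>simp add: flat_def power2_eq_square algebra_simps\<close>)
    qed
    then show ?thesis
      by (rule has_field_derivative_transform_within_open[of _ _ t "{0<..}"])
        (use 2 in \<open>simp_all add: flat_def\<close>)
  next
    case 3
    \<comment> \<open>The right difference quotient at 0 is y P(y) exp(-y) with y = 1/h;
      \<open>pCons 0\<close> is multiplication by y.\<close>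
    have "((\<lambda>x. poly (pCons 0 (flat_poly n)) x * exp (- x)) \<longlongrightarrow> 0) at_top"
      by (rule poly_exp_tendsto_0)
    then have "((\<lambda>h. poly (pCons 0 (flat_poly n)) (inverse h) * exp (- inverse h)) \<longlongrightarrow> 0) (at_right 0)"
      by (rule filterlim_compose) (rule filterlim_inverse_at_top_right)
    moreover have "eventually (\<lambda>h. poly (pCons 0 (flat_poly n)) (inverse h) * exp (- inverse h)
        = (flat n h - flat n 0) / (h - 0)) (at_right 0)"
      using eventually_at_right_less[of 0]
      by eventually_elim (simp add: flat_def divide_inverse)
    ultimately have r: "((\<lambda>h. (flat n h - flat n 0) / (h - 0)) \<longlongrightarrow> 0) (at_right 0)"
      by (rule Lim_transform_eventually)
    have "eventually (\<lambda>h. 0 = (flat n h - flat n 0) / (h - 0)) (at_left 0)"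
      by (rule eventually_at_leftI[of "-1"]) (simp_all add: flat_def)
    then have l: "((\<lambda>h. (flat n h - flat n 0) / (h - 0)) \<longlongrightarrow> 0) (at_left 0)"
      by (rule Lim_transform_eventually[OF tendsto_const])
    show ?thesis
      using filterlim_split_at[OF l r] 3 unfolding has_field_derivative_iff by (simp add: flat_def)
  qed
qed

lemma flat_0_nonneg: "flat 0 t \<ge> 0"
  and flat_0_pos: "t > 0 \<Longrightarrow> flat 0 t > 0"
  and flat_1_nonneg: "flat 1 t \<ge> 0"
  and flat_1_pos: "t > 0 \<Longrightarrow> flat 1 t > 0"
  and flat_nonpos: "t \<le> 0 \<Longrightarrow> flat n t = 0"
  by (auto simp: flat_def)

section \<open>Smooth kernels supported in the unit ball\<close>

text \<open>Common domain of integration of all means: a box, as the rules for parametric integrals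
  over \<open>cbox\<close> require. Kernels live in the unit ball; the half side 2 leaves room for a
  kernel shifted by a vector of norm at most 1.\<close>

definition kcube :: "'a::euclidean_space set" where
  "kcube = cbox (- (2 *\<^sub>R One)) (2 *\<^sub>R One)"

lemma norm_le_2_kcube: "norm z \<le> 2 \<Longrightarrow> z \<in> kcube"
  unfolding kcube_def mem_box using Basis_le_norm[of _ z] by (force simp: abs_le_iff)

lemma norm_kcube:
  assumes "z \<in> kcube" shows "norm (z::'a::euclidean_space) \<le> 2 * DIM('a)"
proof -
  have "norm z \<le> (\<Sum>b\<in>Basis. \<bar>z \<bullet> b\<bar>)" by (rule norm_le_l1)
  also have "\<dots> \<le> (\<Sum>b\<in>(Basis::'a set). 2)"
    using assms by (intro sum_mono) (auto simp: kcube_def mem_box abs_le_iff minus_le_iff)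
  finally show ?thesis by simp
qed

lemma compact_kcube: "compact kcube" by (simp add: kcube_def)

text \<open>Neither a sign nor a normalisation is imposed, so that the class is closed under partial
  derivatives.\<close>

definition mollifier :: "('a::euclidean_space \<Rightarrow> real) \<Rightarrow> bool" where
  "mollifier K \<longleftrightarrow> (\<forall>k. Ck_on k UNIV K) \<and> (\<forall>z. norm z > 1 \<longrightarrow> K z = 0)"

lemma mollifier_outside: "mollifier K \<Longrightarrow> norm z > 1 \<Longrightarrow> K z = 0"
  unfolding mollifier_def by simp

lemma mollifier_Ck: "mollifier K \<Longrightarrow> Ck_on k S K"
  unfolding mollifier_def using Ck_on_subset by blast

lemma mollifier_has_derivative: "mollifier K \<Longrightarrow> (K has_derivative (\<lambda>h. h \<bullet> gradient K z)) (at z)"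
  by (rule Ck_on_SucD'[OF mollifier_Ck[of K "Suc 0" UNIV]]) simp_all

lemma mollifier_partial:
  assumes "mollifier K" "b \<in> Basis"
  shows "mollifier (\<lambda>z. gradient K z \<bullet> b)"
  unfolding mollifier_def
proof (intro conjI allI impI)
  fix k show "Ck_on k UNIV (\<lambda>z. gradient K z \<bullet> b)"
    using mollifier_Ck[OF assms(1), of "Suc k" UNIV] assms(2) by simp
next
  fix z :: 'a assume "norm z > 1"
  have "gradient K z = gradient (\<lambda>_. 0) z"
    using \<open>norm z > 1\<close> assms(1)
    by (intro gradient_cong_open[of "- cball 0 1"]) (auto simp: mollifier_def)
  also have "\<dots> = 0" by (rule has_derivative_gradientD(2)) simp
  finally show "gradient K z \<bullet> b = 0" by simp
qed

lemma Ck_on_continuous_gradient: "Ck_on (Suc k) S f \<Longrightarrow> continuous_on S (gradient f)"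
  using Ck_on_continuous[of k S] by (simp add: continuous_on_componentwise[of S "gradient f"])

lemma mollifier_continuous: "mollifier K \<Longrightarrow> continuous_on S K"
  and mollifier_continuous_gradient: "mollifier K \<Longrightarrow> continuous_on S (gradient K)"
  using mollifier_Ck[of K 0 S] Ck_on_continuous_gradient[of 0 S K] mollifier_Ck[of K "Suc 0" S] by auto

lemma Ck_on_radial_flat: "Ck_on k UNIV (\<lambda>z::'a::euclidean_space. flat n (1 - z \<bullet> z))"
proof -
  have "Ck_on k (UNIV::'a set) (\<lambda>z. 1 + (-1) * (\<Sum>b\<in>Basis. (z \<bullet> b) * (z \<bullet> b)))"
    by (intro Ck_on_add Ck_on_cmult Ck_on_const Ck_on_sum Ck_on_mult Ck_on_inner_const open_UNIV)
  then have "Ck_on k (UNIV::'a set) (\<lambda>z. 1 - z \<bullet> z)" by (subst euclidean_inner) simp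
  from Ck_on_compose[of UNIV UNIV flat _ k n, OF _ has_real_derivative_flat _ this]
  show ?thesis by simp
qed

text \<open>\<open>bump'\<close> uses the derivative \<open>flat 1\<close> of the profile
  \<open>flat 0\<close>; it is a scalar kernel, not the gradient of \<open>bump\<close>.\<close>

definition bump :: "'a::euclidean_space \<Rightarrow> real" where "bump z = flat 0 (1 - z \<bullet> z)"
definition bump' :: "'a::euclidean_space \<Rightarrow> real" where "bump' z = flat 1 (1 - z \<bullet> z)"

lemma inner_self_ge_1:
  assumes "norm z > 1" shows "1 - z \<bullet> z \<le> 0"
proof -
  have "1 \<le> (norm z)\<^sup>2" using assms by (intro one_le_power) simp
  then show ?thesis by (simp add: power2_norm_eq_inner)
qed

lemma mollifier_radial_flat: "mollifier (\<lambda>z. flat n (1 - z \<bullet> z))"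
  unfolding mollifier_def using Ck_on_radial_flat inner_self_ge_1 flat_nonpos by blast

lemma mollifier_bump: "mollifier bump" and mollifier_bump': "mollifier bump'"
  unfolding bump_def[abs_def] bump'_def[abs_def] by (rule mollifier_radial_flat)+

text \<open>The link between scale derivatives and the weak equation: d/d\<epsilon> of u(x -
  \<epsilon> z) brings down the vector z, and z \<open>bump' z\<close> is, up to a factor, the
  gradient of a bump that can serve as test function.\<close>

lemma gradient_bump: "gradient bump z = (- 2 * bump' z) *\<^sub>R z"
proof (rule has_derivative_gradientD(2))
  have "((\<lambda>z. 1 - z \<bullet> z) has_derivative (\<lambda>h. h \<bullet> (- 2 *\<^sub>R z))) (at z)"
    by (auto intro!: derivative_eq_intros simp: inner_commute)
  from has_derivative_compose_gradient[OF this has_real_derivative_flat[of 0]]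
  show "(bump has_derivative (\<lambda>h. h \<bullet> ((- 2 * bump' z) *\<^sub>R z))) (at z)"
    by (simp add: bump_def[abs_def] bump'_def mult.commute)
qed

lemma integral_kcube_pos:
  fixes K :: "'a::euclidean_space \<Rightarrow> real"
  assumes "continuous_on kcube K" "\<And>z. K z \<ge> 0" "K 0 > 0"
  shows "integral kcube K > 0"
proof -
  have "integral kcube K \<ge> 0" 
    using assms by (intro integral_nonneg) (simp_all add: kcube_def integrable_continuous)
  moreover have "integral kcube K \<noteq> 0"
  proof
    assume "integral kcube K = 0"
    then have "K 0 = 0"
      using integral_cbox_eq_0_iff[of "- (2 *\<^sub>R One)" "2 *\<^sub>R One" K] assms
      norm_le_2_kcube[of "0::'a"] unfolding kcube_def by (auto simp: box_eq_empty)
    then show False using assms(3) by simp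
  qed
  ultimately show ?thesis by linarith
qed

lemma integral_bump_pos: "integral kcube (bump :: 'a::euclidean_space \<Rightarrow> real) > 0"
  and integral_bump'_pos: "integral kcube (bump' :: 'a \<Rightarrow> real) > 0"
  by (intro integral_kcube_pos mollifier_continuous mollifier_bump mollifier_bump';
      simp add: bump_def bump'_def flat_0_nonneg flat_0_pos flat_1_nonneg[simplified] flat_1_pos[simplified])+

section \<open>Differentiation under the integral and change of variables\<close>

lemma leibniz_gradient:
  fixes F :: "'a::euclidean_space \<Rightarrow> 'c::euclidean_space \<Rightarrow> real"
  assumes "convex U" "open U" "x \<in> U"
    "\<And>x t. x \<in> U \<Longrightarrow> t \<in> cbox a b \<Longrightarrow> ((\<lambda>x. F x t) has_derivative (\<lambda>h. h \<bullet> G x t)) (at x)"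
    "\<And>x. x \<in> U \<Longrightarrow> F x integrable_on cbox a b"
    "continuous_on (U \<times> cbox a b) (\<lambda>(x, t). G x t)"
  shows "((\<lambda>x. integral (cbox a b) (F x)) has_derivative (\<lambda>h. h \<bullet> integral (cbox a b) (G x))) (at x)"
proof -
  \<comment> \<open>\<open>blinfun_inner_left\<close> encodes gradient vectors as the bounded linear
    maps of the Leibniz rule; being bounded linear itself, it commutes with the integral.\<close>
  define fx where "fx x t = blinfun_inner_left (G x t)" for x t
  have "continuous_on (U \<times> cbox a b) (\<lambda>z. blinfun_inner_left (case z of (x, t) \<Rightarrow> G x t))"
    by (rule bounded_linear.continuous_on[OF bounded_linear_blinfun_inner_left assms(6)])
  then have "continuous_on (U \<times> cbox a b) (\<lambda>(x, t). fx x t)"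
    by (simp add: fx_def case_prod_unfold)
  moreover have "((\<lambda>x. F x t) has_derivative blinfun_apply (fx x t)) (at x within U)"
    if "x \<in> U" "t \<in> cbox a b" for x t
    using assms(4)[OF that] has_derivative_at_withinI unfolding fx_def by simp
  ultimately have *: "((\<lambda>x. integral (cbox a b) (F x)) has_derivative integral (cbox a b) (fx x)) (at x within U)"
    by (intro leibniz_rule[of U a b F fx x] assms)
  have "continuous_on (cbox a b) (G x)"
    using continuous_on_compose2[OF assms(6) continuous_on_Pair[OF continuous_on_const continuous_on_id],
        of x "cbox a b"] assms(3)
    by (simp add: image_subset_iff)
  then have "integral (cbox a b) (blinfun_inner_left \<circ> G x) = blinfun_inner_left (integral (cbox a b) (G x))"
    by (intro integral_linear integrable_continuous bounded_linear_blinfun_inner_left)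
  then have "blinfun_apply (integral (cbox a b) (fx x)) = (\<lambda>h. h \<bullet> integral (cbox a b) (G x))"
    by (auto simp: fx_def[abs_def] o_def)
  with * show ?thesis using at_within_open[OF assms(3,2)] by simp
qed

lemma has_derivative_minus_const:
  assumes "(f has_derivative f') (at (x - c))"
  shows "((\<lambda>y. f (y - c)) has_derivative f') (at x)"
proof -
  have "((\<lambda>y. y - c) has_derivative (\<lambda>h. h)) (at x)" by (auto intro!: derivative_eq_intros)
  from has_derivative_compose[OF this assms] show ?thesis .
qed

text \<open>Bridge between the Lebesgue integral of the weak formulation, which has the affine
  change of variables, and the gauge integral, which has the Leibniz rule.\<close>

lemma lborel_integral_compact_support:
  fixes \<phi> :: "'a::euclidean_space \<Rightarrow> real"
  assumes "compact T" "continuous_on T \<phi>" "\<And>y. y \<notin> T \<Longrightarrow> \<phi> y = 0"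
  shows "(LINT y|lborel. \<phi> y) = integral T \<phi>" "\<phi> \<in> borel_measurable borel"
proof -
  have eq: "(\<lambda>y. indicator T y *\<^sub>R \<phi> y) = \<phi>"
  proof
    fix y show "indicator T y *\<^sub>R \<phi> y = \<phi> y" using assms(3)[of y] by (cases "y \<in> T") simp_all
  qed
  have int: "integrable lborel (\<lambda>y. indicator T y *\<^sub>R \<phi> y)"
    by (rule borel_integrable_compact[OF assms(1,2)])
  then show "\<phi> \<in> borel_measurable borel"
    unfolding eq by auto
  have "set_integrable lborel T \<phi>" using int by (simp add: set_integrable_def)
  from set_borel_integral_eq_integral(2)[OF this] show "(LINT y|lborel. \<phi> y) = integral T \<phi>"
    by (simp add: set_lebesgue_integral_def eq[unfolded real_scaleR_def])
qed

lemma lborel_integral_affine: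
  fixes \<phi> :: "'a::euclidean_space \<Rightarrow> real"
  assumes "c \<noteq> 0" "\<phi> \<in> borel_measurable borel"
  shows "(LINT y|lborel. \<phi> y) = \<bar>c\<bar> ^ DIM('a) * (LINT z|lborel. \<phi> (t + c *\<^sub>R z))"
proof -
  have "(LINT y|lborel. \<phi> y) =
      (LINT y|density (distr lborel borel (\<lambda>x. t + c *\<^sub>R x)) (\<lambda>_. \<bar>c\<bar> ^ DIM('a)). \<phi> y)"
    using lborel_affine[OF assms(1), of t] by simp
  also have "\<dots> = (LINT y|distr lborel borel (\<lambda>x. t + c *\<^sub>R x). \<bar>c\<bar> ^ DIM('a) * \<phi> y)"
    using assms(2) by (subst integral_density) auto
  also have "\<dots> = (LINT z|lborel. \<bar>c\<bar> ^ DIM('a) * \<phi> (t + c *\<^sub>R z))"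
    using assms(2) by (subst integral_distr) auto
  finally show ?thesis by simp
qed

section \<open>Means of a function at a given scale\<close>

text \<open>Convolution of g with the kernel K rescaled to size \<epsilon>, written after the
  substitution y = x - \<epsilon> z. In this form it makes sense and stays continuous down to
  \<epsilon> = 0, where it is g(x) times the integral of K. Vector kernels are allowed in order to
  include \<open>gradient K\<close>.\<close>

definition avg :: "('a::euclidean_space \<Rightarrow> 'b::euclidean_space) \<Rightarrow> ('a \<Rightarrow> real) \<Rightarrow> 'a \<Rightarrow> real \<Rightarrow> 'b" where
  "avg K g x \<epsilon> = integral kcube (\<lambda>z. g (x - \<epsilon> *\<^sub>R z) *\<^sub>R K z)"

text \<open>\<open>B\<close> holds the centres, \<open>W\<close> the region where the averaged
  function is controlled, and \<open>e\<close> is the largest scale.\<close>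

definition cube_translates_in :: "'a::euclidean_space set \<Rightarrow> 'a set \<Rightarrow> real \<Rightarrow> bool" where
  "cube_translates_in B W e \<longleftrightarrow> open B \<and> open W \<and> (\<forall>x\<in>B. \<forall>\<epsilon>\<in>{0..e}. \<forall>z\<in>kcube. x - \<epsilon> *\<^sub>R z \<in> W)"

lemma cube_translates_inD: "cube_translates_in B W e \<Longrightarrow> x \<in> B \<Longrightarrow> 0 \<le> \<epsilon> \<Longrightarrow> \<epsilon> \<le> e \<Longrightarrow> z \<in> kcube \<Longrightarrow> x - \<epsilon> *\<^sub>R z \<in> W"
  by (auto simp: cube_translates_in_def)

lemma avg_integrand_continuous:
  fixes K :: "'a::euclidean_space \<Rightarrow> 'b::euclidean_space"
  assumes "cube_translates_in B W e" "continuous_on W g" "continuous_on kcube K"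
  shows "continuous_on ((B \<times> {0..e}) \<times> kcube) (\<lambda>((x, \<epsilon>), z). g (x - \<epsilon> *\<^sub>R z) *\<^sub>R K z)"
  unfolding case_prod_unfold using cube_translates_inD[OF assms(1)]
  by (intro continuous_intros continuous_on_compose2[OF assms(2)] continuous_on_compose2[OF assms(3)]) auto

lemma avg_continuous:
  assumes "cube_translates_in B W e" "continuous_on W g" "continuous_on kcube K"
  shows "continuous_on (B \<times> {0..e}) (\<lambda>(x, \<epsilon>). avg K g x \<epsilon>)"
  unfolding avg_def case_prod_unfold kcube_def
  by (rule integral_continuous_on_param)
    (use avg_integrand_continuous[OF assms] in \<open>simp add: case_prod_unfold kcube_def\<close>)

lemma avg_integrable:
  fixes K :: "'a::euclidean_space \<Rightarrow> 'b::euclidean_space"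
  assumes "cube_translates_in B W e" "continuous_on W g" "continuous_on kcube K" "x \<in> B" "0 \<le> \<epsilon>" "\<epsilon> \<le> e"
  shows "(\<lambda>z. g (x - \<epsilon> *\<^sub>R z) *\<^sub>R K z) integrable_on kcube"
proof -
  have "continuous_on kcube (\<lambda>z. g (x - \<epsilon> *\<^sub>R z) *\<^sub>R K z)"
    using cube_translates_inD[OF assms(1,4,5,6)]
    by (intro continuous_intros continuous_on_compose2[OF assms(2)] assms(3)) auto
  then show ?thesis unfolding kcube_def by (rule integrable_continuous)
qed

lemma avg_inner:
  assumes "cube_translates_in B W e" "continuous_on W g" "continuous_on kcube K" "x \<in> B" "0 \<le> \<epsilon>" "\<epsilon> \<le> e"
  shows "avg K g x \<epsilon> \<bullet> b = avg (\<lambda>z. K z \<bullet> b) g x \<epsilon>"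
proof -
  have "integral kcube (\<lambda>z. (g (x - \<epsilon> *\<^sub>R z) *\<^sub>R K z) \<bullet> b) = avg K g x \<epsilon> \<bullet> b"
    unfolding avg_def by (rule integral_component_eq[OF avg_integrable[OF assms]])
  then show ?thesis by (simp add: avg_def)
qed

lemma avg_has_derivative_C1:
  fixes g :: "'a::euclidean_space \<Rightarrow> real"
  assumes "cube_translates_in B W e" "Ck_on 1 W g" "continuous_on kcube K" "x \<in> B" "0 \<le> \<epsilon>" "\<epsilon> \<le> e"
  shows "((\<lambda>x. avg K g x \<epsilon>) has_derivative
     (\<lambda>h. h \<bullet> integral kcube (\<lambda>z. K z *\<^sub>R gradient g (x - \<epsilon> *\<^sub>R z)))) (at x)"
proof -
  have op: "open B" using assms(1) by (simp add: cube_translates_in_def)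
  obtain d where d: "d > 0" "ball x d \<subseteq> B" using op assms(4) openE by blast
  have cg: "continuous_on W (gradient g)" using Ck_on_continuous_gradient[of 0 W g] assms(2) by simp
  have W: "y - \<epsilon> *\<^sub>R z \<in> W" if "y \<in> ball x d" "z \<in> kcube" for y z
    using cube_translates_inD[OF assms(1) _ assms(5,6) that(2)] d(2) that(1) by auto
  have "((\<lambda>x. integral kcube (\<lambda>z. g (x - \<epsilon> *\<^sub>R z) *\<^sub>R K z)) has_derivative
     (\<lambda>h. h \<bullet> integral kcube (\<lambda>z. K z *\<^sub>R gradient g (x - \<epsilon> *\<^sub>R z)))) (at x)"
    unfolding kcube_def
  proof (rule leibniz_gradient[of "ball x d"])
    show "x \<in> ball x d" using d by simp
    show "((\<lambda>x. g (x - \<epsilon> *\<^sub>R z) *\<^sub>R K z) has_derivative (\<lambda>h. h \<bullet> K z *\<^sub>R gradient g (y - \<epsilon> *\<^sub>R z))) (at y)"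
      if "y \<in> ball x d" "z \<in> cbox (- (2 *\<^sub>R One)) (2 *\<^sub>R One)" for y z
    proof -
      have "(g has_derivative (\<lambda>h. h \<bullet> gradient g (y - \<epsilon> *\<^sub>R z))) (at (y - \<epsilon> *\<^sub>R z))"
        using assms(2) W[of y z] that by (intro Ck_on_SucD'[of 0 W]) (auto simp: kcube_def)
      from has_derivative_minus_const[OF this]
      have "((\<lambda>x. g (x - \<epsilon> *\<^sub>R z)) has_derivative (\<lambda>h. h \<bullet> gradient g (y - \<epsilon> *\<^sub>R z))) (at y)" .
      from has_derivative_mult_right[OF this, of "K z"] show ?thesis
        by (simp add: mult.commute)
    qed
    show "(\<lambda>z. g (y - \<epsilon> *\<^sub>R z) *\<^sub>R K z) integrable_on cbox (- (2 *\<^sub>R One)) (2 *\<^sub>R One)"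
      if "y \<in> ball x d" for y
      using avg_integrable[OF assms(1) Ck_on_continuous[OF assms(2)] assms(3) _ assms(5,6), of y] that d(2)
      by (auto simp: kcube_def)
    show "continuous_on (ball x d \<times> cbox (- (2 *\<^sub>R One)) (2 *\<^sub>R One)) (\<lambda>(x, z). K z *\<^sub>R gradient g (x - \<epsilon> *\<^sub>R z))"
      unfolding case_prod_unfold using W
      by (intro continuous_intros continuous_on_compose2[OF cg] continuous_on_compose2[OF assms(3)])
        (auto simp: kcube_def)
  qed simp_all
  then show ?thesis by (simp add: avg_def)
qed

text \<open>A translation of the centre is moved from g to the kernel. The bound
  \<open>norm h \<le> \<epsilon>\<close> shifts the kernel by at most 1, so its support stays inside
  \<open>kcube\<close>.\<close>

lemma avg_shift:
  fixes g :: "'a::euclidean_space \<Rightarrow> real"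
  assumes "cube_translates_in B W e" "continuous_on W g" "mollifier K" "x \<in> B" "x + h \<in> B" "0 < \<epsilon>" "\<epsilon> \<le> e" "norm h \<le> \<epsilon>"
  shows "avg K g (x + h) \<epsilon> = integral kcube (\<lambda>z. g (x - \<epsilon> *\<^sub>R z) * K (z + (1 / \<epsilon>) *\<^sub>R h))"
proof -
  define \<phi> where "\<phi> z = g (x - \<epsilon> *\<^sub>R z) * K (z + (1 / \<epsilon>) *\<^sub>R h)" for z
  have [continuous_intros]: "continuous_on S K" for S by (rule mollifier_continuous[OF assms(3)])
  have "continuous_on kcube \<phi>"
    unfolding \<phi>_def using cube_translates_inD[OF assms(1,4) _ assms(7)] assms(6)
    by (intro continuous_intros continuous_on_compose2[OF assms(2)]
        continuous_on_compose2[OF mollifier_continuous[OF assms(3), of UNIV]]) auto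
  moreover have "\<phi> z = 0" if "z \<notin> kcube" for z
  proof -
    have "norm z > 2" using that norm_le_2_kcube[of z] by linarith
    moreover have "norm ((1 / \<epsilon>) *\<^sub>R h) \<le> 1" using assms(6,8) by simp
    ultimately have "norm (z + (1 / \<epsilon>) *\<^sub>R h) > 1"
      using norm_diff_ineq[of z "(1 / \<epsilon>) *\<^sub>R h"] by linarith
    then show ?thesis using assms(3) by (simp add: \<phi>_def mollifier_def)
  qed
  ultimately have 1: "(LINT y|lborel. \<phi> y) = integral kcube \<phi>" "\<phi> \<in> borel_measurable borel"
    using lborel_integral_compact_support[OF compact_kcube] by blast+
  define \<psi> where "\<psi> z = g (x + h - \<epsilon> *\<^sub>R z) * K z" for z
  have \<psi>: "\<psi> z = \<phi> (- ((1 / \<epsilon>) *\<^sub>R h) + 1 *\<^sub>R z)" for z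
    using assms(6) by (simp add: \<psi>_def \<phi>_def algebra_simps)
  have "continuous_on kcube \<psi>"
    unfolding \<psi>_def using cube_translates_inD[OF assms(1,5) _ assms(7)] assms(6)
    by (intro continuous_intros continuous_on_compose2[OF assms(2)]
        continuous_on_compose2[OF mollifier_continuous[OF assms(3), of UNIV]]) auto
  moreover have "\<psi> z = 0" if "z \<notin> kcube" for z
    using norm_le_2_kcube[of z] that assms(3) by (force simp: \<psi>_def mollifier_def)
  ultimately have 2: "(LINT y|lborel. \<psi> y) = integral kcube \<psi>"
    using lborel_integral_compact_support[OF compact_kcube] by blast
  have "(LINT y|lborel. \<phi> y) = (LINT y|lborel. \<psi> y)"
    unfolding \<psi> using lborel_integral_affine[OF _ 1(2), of 1 "- ((1 / \<epsilon>) *\<^sub>R h)"] by simp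
  then have "integral kcube \<psi> = integral kcube \<phi>" using 1(1) 2 by simp
  then show ?thesis by (simp add: avg_def \<psi>_def[abs_def] \<phi>_def[abs_def])
qed

text \<open>By \<open>avg_shift\<close> the increment of the centre appears only in the smooth
  kernel, so g may be merely continuous; the price is the factor 1/\<epsilon>. When g is C^1,
  \<open>avg_has_derivative_C1\<close> differentiates g instead, without that factor.\<close>

lemma avg_has_derivative_mollifier:
  fixes g :: "'a::euclidean_space \<Rightarrow> real"
  assumes "cube_translates_in B W e" "continuous_on W g" "mollifier K" "x \<in> B" "0 < \<epsilon>" "\<epsilon> \<le> e"
  shows "((\<lambda>x. avg K g x \<epsilon>) has_derivative (\<lambda>h. h \<bullet> ((1 / \<epsilon>) *\<^sub>R avg (gradient K) g x \<epsilon>))) (at x)"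
proof -
  have op: "open B" using assms(1) by (simp add: cube_translates_in_def)
  obtain d0 where d0: "d0 > 0" "ball x d0 \<subseteq> B" using op assms(4) openE by blast
  \<comment> \<open>\<open>avg_shift\<close> covers only increments of norm at most
    \<epsilon>.\<close>
  define d where "d = min d0 \<epsilon>"
  have d: "d > 0" "ball x d \<subseteq> B" "d \<le> \<epsilon>" using d0 assms(5) by (auto simp: d_def)
  have W: "x - \<epsilon> *\<^sub>R z \<in> W" if "z \<in> kcube" for z
    using cube_translates_inD[OF assms(1,4) _ assms(6) that] assms(5) by simp
  have "((\<lambda>h. integral kcube (\<lambda>z. g (x - \<epsilon> *\<^sub>R z) * K (z + (1 / \<epsilon>) *\<^sub>R h))) has_derivative
     (\<lambda>h. h \<bullet> integral kcube (\<lambda>z. (g (x - \<epsilon> *\<^sub>R z) / \<epsilon>) *\<^sub>R gradient K (z + (1 / \<epsilon>) *\<^sub>R 0)))) (at 0)"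
    unfolding kcube_def
  proof (rule leibniz_gradient[of "ball 0 d"])
    show "0 \<in> ball 0 d" using d by simp
    show "((\<lambda>h. g (x - \<epsilon> *\<^sub>R z) * K (z + (1 / \<epsilon>) *\<^sub>R h)) has_derivative
        (\<lambda>k. k \<bullet> (g (x - \<epsilon> *\<^sub>R z) / \<epsilon>) *\<^sub>R gradient K (z + (1 / \<epsilon>) *\<^sub>R h))) (at h)" for h z
    proof -
      have "((\<lambda>h. z + (1 / \<epsilon>) *\<^sub>R h) has_derivative (\<lambda>k. (1 / \<epsilon>) *\<^sub>R k)) (at h)"
        by (auto intro!: derivative_eq_intros)
      from has_derivative_compose[OF this mollifier_has_derivative[OF assms(3)]]
      have "((\<lambda>h. K (z + (1 / \<epsilon>) *\<^sub>R h)) has_derivative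
         (\<lambda>k. (1 / \<epsilon>) *\<^sub>R k \<bullet> gradient K (z + (1 / \<epsilon>) *\<^sub>R h))) (at h)" .
      from has_derivative_mult_right[OF this, of "g (x - \<epsilon> *\<^sub>R z)"] show ?thesis
        by (simp add: mult.commute)
    qed
    show "(\<lambda>z. g (x - \<epsilon> *\<^sub>R z) * K (z + (1 / \<epsilon>) *\<^sub>R h)) integrable_on cbox (- (2 *\<^sub>R One)) (2 *\<^sub>R One)" for h
      using W by (intro integrable_continuous continuous_intros continuous_on_compose2[OF assms(2)]
          continuous_on_compose2[OF mollifier_continuous[OF assms(3), of UNIV]]) (auto simp: kcube_def)
    show "continuous_on (ball 0 d \<times> cbox (- (2 *\<^sub>R One)) (2 *\<^sub>R One))
        (\<lambda>(h, z). (g (x - \<epsilon> *\<^sub>R z) / \<epsilon>) *\<^sub>R gradient K (z + (1 / \<epsilon>) *\<^sub>R h))"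
      unfolding case_prod_unfold using W assms(5)
      by (intro continuous_intros continuous_on_compose2[OF assms(2)]
          continuous_on_compose2[OF mollifier_continuous_gradient[OF assms(3), of UNIV]]) (auto simp: kcube_def)
  qed simp_all
  also have "integral kcube (\<lambda>z. (g (x - \<epsilon> *\<^sub>R z) / \<epsilon>) *\<^sub>R gradient K (z + (1 / \<epsilon>) *\<^sub>R 0)) =
      (1 / \<epsilon>) *\<^sub>R avg (gradient K) g x \<epsilon>"
    unfolding avg_def by (subst integral_cmul[symmetric]) simp
  finally have "((\<lambda>h. integral kcube (\<lambda>z. g (x - \<epsilon> *\<^sub>R z) * K (z + (1 / \<epsilon>) *\<^sub>R h))) has_derivative
     (\<lambda>h. h \<bullet> ((1 / \<epsilon>) *\<^sub>R avg (gradient K) g x \<epsilon>))) (at (x - x))" by simp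
  from has_derivative_minus_const[OF this]
  have "((\<lambda>y. integral kcube (\<lambda>z. g (x - \<epsilon> *\<^sub>R z) * K (z + (1 / \<epsilon>) *\<^sub>R (y - x)))) has_derivative
     (\<lambda>h. h \<bullet> ((1 / \<epsilon>) *\<^sub>R avg (gradient K) g x \<epsilon>))) (at x)" .
  then show ?thesis
  proof (rule has_derivative_gradient_within_open[of _ _ _ "ball x d"])
    fix y assume "y \<in> ball x d"
    then have "avg K g (x + (y - x)) \<epsilon> = integral kcube (\<lambda>z. g (x - \<epsilon> *\<^sub>R z) * K (z + (1 / \<epsilon>) *\<^sub>R (y - x)))"
      using d by (intro avg_shift[OF assms(1-4) _ assms(5,6)]) (auto simp: dist_norm norm_minus_commute)
    then show "integral kcube (\<lambda>z. g (x - \<epsilon> *\<^sub>R z) * K (z + (1 / \<epsilon>) *\<^sub>R (y - x))) = avg K g y \<epsilon>"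
      by simp
  qed (use d in auto)
qed

lemma avg_Ck_on:
  fixes g :: "'a::euclidean_space \<Rightarrow> real"
  assumes "cube_translates_in B W e" "continuous_on W g" "0 < \<epsilon>" "\<epsilon> \<le> e"
  shows "mollifier K \<Longrightarrow> Ck_on k B (\<lambda>x. avg K g x \<epsilon>)"
proof (induction k arbitrary: K)
  case 0
  have "continuous_on B (\<lambda>x. (\<lambda>(x, \<epsilon>). avg K g x \<epsilon>) (x, \<epsilon>))"
    using assms(3,4)
    by (intro continuous_on_compose2[OF avg_continuous[OF assms(1,2) mollifier_continuous[OF 0]]])
      (auto intro!: continuous_intros)
  then show ?case by simp
next
  case (Suc k)
  have op: "open B" using assms(1) by (simp add: cube_translates_in_def)
  show ?case
  proof (rule Ck_on_SucI[OF op, of _ "\<lambda>x. (1 / \<epsilon>) *\<^sub>R avg (gradient K) g x \<epsilon>"])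
    fix b :: 'a assume b: "b \<in> Basis"
    have "Ck_on k B (\<lambda>x. (1 / \<epsilon>) * avg (\<lambda>z. gradient K z \<bullet> b) g x \<epsilon>)"
      by (intro Ck_on_cmult op Suc.IH mollifier_partial Suc.prems b)
    then show "Ck_on k B (\<lambda>x. (1 / \<epsilon>) *\<^sub>R avg (gradient K) g x \<epsilon> \<bullet> b)"
      by (rule Ck_on_cong[OF op, rotated])
        (use avg_inner[OF assms(1,2) mollifier_continuous_gradient[OF Suc.prems]] assms(3,4) in simp)
  qed (use avg_has_derivative_mollifier[OF assms(1,2) Suc.prems _ assms(3,4)] in blast)
qed

text \<open>The mean of the constant function 1 does not depend on the centre, and its gradient at
  scale 1 is the integral of \<open>gradient K\<close>.\<close>

lemma integral_gradient_mollifier: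
  assumes "mollifier K" shows "integral kcube (gradient K) = (0::'a::euclidean_space)"
proof -
  have "cube_translates_in (UNIV::'a set) UNIV 1" by (simp add: cube_translates_in_def)
  from avg_has_derivative_mollifier[OF this _ assms, of "\<lambda>_. 1" 0 1]
  have "((\<lambda>x. integral kcube K) has_derivative (\<lambda>h. h \<bullet> integral kcube (gradient K))) (at (0::'a))"
    by (simp add: avg_def)
  from has_derivative_unique[OF this has_derivative_const]
  have "(\<lambda>h. h \<bullet> integral kcube (gradient K)) = (\<lambda>h. 0)" .
  then have "integral kcube (gradient K) \<bullet> integral kcube (gradient K) = 0" by (rule fun_cong)
  then show ?thesis by simp
qed

section \<open>Local Hoelder continuity\<close>

text \<open>Hoelder continuity with the fixed exponent 1/2, for which interpolating two bounds is
  taking their geometric mean. The estimate concerns two arbitrary points of a full ball, not only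
  the centre and one point.\<close>

definition locally_holder :: "'a::real_normed_vector set \<Rightarrow> ('a \<Rightarrow> real) \<Rightarrow> bool" where
  "locally_holder S f \<longleftrightarrow> (\<forall>x\<in>S. \<exists>d>0. \<exists>C\<ge>0. \<forall>y\<in>ball x d. \<forall>z\<in>ball x d.
     \<bar>f y - f z\<bar> \<le> C * sqrt (norm (y - z)))"

lemma locally_holderI:
  assumes "\<And>x. x \<in> S \<Longrightarrow> \<exists>d>0. \<exists>C. \<forall>y\<in>ball x d. \<forall>z\<in>ball x d. \<bar>f y - f z\<bar> \<le> C * sqrt (norm (y - z))"
  shows "locally_holder S f"
  unfolding locally_holder_def
proof
  fix x assume "x \<in> S"
  from assms[OF this] obtain d C where "d > 0"
    and C: "\<And>y z. y \<in> ball x d \<Longrightarrow> z \<in> ball x d \<Longrightarrow> \<bar>f y - f z\<bar> \<le> C * sqrt (norm (y - z))" by blast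
  have "\<bar>f y - f z\<bar> \<le> \<bar>C\<bar> * sqrt (norm (y - z))" if "y \<in> ball x d" "z \<in> ball x d" for y z
    using C[OF that] by (rule order_trans) (simp add: mult_right_mono)
  with \<open>d > 0\<close> show "\<exists>d>0. \<exists>C\<ge>0. \<forall>y\<in>ball x d. \<forall>z\<in>ball x d. \<bar>f y - f z\<bar> \<le> C * sqrt (norm (y - z))"
    by (intro exI[of _ d] conjI exI[of _ "\<bar>C\<bar>"]) auto
qed

lemma locally_holderE:
  assumes "locally_holder S f" "x \<in> S"
  obtains d C where "d > 0" "C \<ge> 0"
    "\<And>y z. y \<in> ball x d \<Longrightarrow> z \<in> ball x d \<Longrightarrow> \<bar>f y - f z\<bar> \<le> C * sqrt (norm (y - z))"
  using assms unfolding locally_holder_def by blast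

lemma locally_holder_cong:
  assumes "open S" "\<And>x. x \<in> S \<Longrightarrow> f x = g x" "locally_holder S f"
  shows "locally_holder S g"
proof (rule locally_holderI)
  fix x assume "x \<in> S"
  obtain e where e: "e > 0" "ball x e \<subseteq> S" using assms(1) \<open>x \<in> S\<close> openE by blast
  obtain d C where d: "d > 0" "\<And>y z. y \<in> ball x d \<Longrightarrow> z \<in> ball x d \<Longrightarrow> \<bar>f y - f z\<bar> \<le> C * sqrt (norm (y - z))"
    using locally_holderE[OF assms(3) \<open>x \<in> S\<close>] by metis
  have "\<bar>g y - g z\<bar> \<le> C * sqrt (norm (y - z))" if "y \<in> ball x (min d e)" "z \<in> ball x (min d e)" for y z
    using d(2)[of y z] assms(2)[of y] assms(2)[of z] that e(2) by (auto simp: subset_eq)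
  then show "\<exists>d>0. \<exists>C. \<forall>y\<in>ball x d. \<forall>z\<in>ball x d. \<bar>g y - g z\<bar> \<le> C * sqrt (norm (y - z))"
    using d(1) e(1) by (intro exI[of _ "min d e"] conjI exI[of _ C]) auto
qed

lemma locally_holder_locally:
  assumes "\<And>x. x \<in> S \<Longrightarrow> \<exists>U. x \<in> U \<and> locally_holder U f"
  shows "locally_holder S f"
  using assms unfolding locally_holder_def by meson

lemma locally_holder_bound:
  assumes "locally_holder S f" "x \<in> S"
  obtains d M where "d > 0" "M \<ge> 0" "\<And>y. y \<in> ball x d \<Longrightarrow> \<bar>f y - f x\<bar> \<le> M"
proof -
  obtain d C where d: "d > 0" "C \<ge> 0" "\<And>y z. y \<in> ball x d \<Longrightarrow> z \<in> ball x d \<Longrightarrow> \<bar>f y - f z\<bar> \<le> C * sqrt (norm (y - z))"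
    using locally_holderE[OF assms] by metis
  have "\<bar>f y - f x\<bar> \<le> C * sqrt d" if "y \<in> ball x d" for y
  proof -
    have "\<bar>f y - f x\<bar> \<le> C * sqrt (norm (y - x))" using d(1,3) that by simp
    also have "\<dots> \<le> C * sqrt d" using d(2) that by (intro mult_left_mono) (auto simp: dist_norm norm_minus_commute)
    finally show ?thesis .
  qed
  then show thesis using that[of d "C * sqrt d"] d(1,2) by simp
qed

lemma locally_holder_isCont:
  assumes "locally_holder S f" "x \<in> S" shows "isCont f x"
proof -
  obtain d C where d: "d > 0" "C \<ge> 0" "\<And>y z. y \<in> ball x d \<Longrightarrow> z \<in> ball x d \<Longrightarrow> \<bar>f y - f z\<bar> \<le> C * sqrt (norm (y - z))"
    using locally_holderE[OF assms] by metis
  have "((\<lambda>y. C * sqrt (norm (y - x))) \<longlongrightarrow> C * sqrt (norm (x - x))) (at x)"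
    by (intro tendsto_intros)
  moreover have "eventually (\<lambda>y. norm (f y - f x) \<le> C * sqrt (norm (y - x))) (at x)"
    unfolding eventually_at
  proof (intro exI[of _ d] conjI ballI impI)
    fix y assume "y \<noteq> x \<and> dist y x < d"
    then show "norm (f y - f x) \<le> C * sqrt (norm (y - x))"
      using d(1) d(3)[of y x] by (simp add: dist_commute)
  qed (rule d(1))
  ultimately have "((\<lambda>y. f y - f x) \<longlongrightarrow> 0) (at x)"
    by (rule_tac Lim_null_comparison[where g="\<lambda>y. C * sqrt (norm (y - x))"]) simp_all
  then show ?thesis unfolding isCont_def by (rule LIM_zero_cancel)
qed

lemma locally_holder_add:
  assumes "locally_holder S f" "locally_holder S g"
  shows "locally_holder S (\<lambda>x. f x + g x)"
proof (rule locally_holderI)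
  fix x assume "x \<in> S"
  obtain d C where d: "d > 0" "\<And>y z. y \<in> ball x d \<Longrightarrow> z \<in> ball x d \<Longrightarrow> \<bar>f y - f z\<bar> \<le> C * sqrt (norm (y - z))"
    using locally_holderE[OF assms(1) \<open>x \<in> S\<close>] by metis
  obtain d' C' where d': "d' > 0" "\<And>y z. y \<in> ball x d' \<Longrightarrow> z \<in> ball x d' \<Longrightarrow> \<bar>g y - g z\<bar> \<le> C' * sqrt (norm (y - z))"
    using locally_holderE[OF assms(2) \<open>x \<in> S\<close>] by metis
  have "\<bar>(f y + g y) - (f z + g z)\<bar> \<le> (C + C') * sqrt (norm (y - z))"
    if "y \<in> ball x (min d d')" "z \<in> ball x (min d d')" for y z
  proof -
    have "\<bar>(f y + g y) - (f z + g z)\<bar> \<le> \<bar>f y - f z\<bar> + \<bar>g y - g z\<bar>" by linarith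
    also have "\<dots> \<le> C * sqrt (norm (y - z)) + C' * sqrt (norm (y - z))"
      using d(2)[of y z] d'(2)[of y z] that by (intro add_mono) simp_all
    finally show ?thesis by (simp add: distrib_right)
  qed
  then show "\<exists>d>0. \<exists>C. \<forall>y\<in>ball x d. \<forall>z\<in>ball x d. \<bar>f y + g y - (f z + g z)\<bar> \<le> C * sqrt (norm (y - z))"
    using d(1) d'(1) by (intro exI[of _ "min d d'"] conjI exI[of _ "C + C'"]) auto
qed

lemma locally_holder_mult:
  assumes "locally_holder S f" "locally_holder S g"
  shows "locally_holder S (\<lambda>x. f x * g x)"
proof (rule locally_holderI)
  fix x assume "x \<in> S"
  obtain d C where d: "d > 0" "C \<ge> 0" "\<And>y z. y \<in> ball x d \<Longrightarrow> z \<in> ball x d \<Longrightarrow> \<bar>f y - f z\<bar> \<le> C * sqrt (norm (y - z))"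
    using locally_holderE[OF assms(1) \<open>x \<in> S\<close>] by metis
  obtain d' C' where d': "d' > 0" "C' \<ge> 0" "\<And>y z. y \<in> ball x d' \<Longrightarrow> z \<in> ball x d' \<Longrightarrow> \<bar>g y - g z\<bar> \<le> C' * sqrt (norm (y - z))"
    using locally_holderE[OF assms(2) \<open>x \<in> S\<close>] by metis
  obtain e M where e: "e > 0" "M \<ge> 0" "\<And>y. y \<in> ball x e \<Longrightarrow> \<bar>f y - f x\<bar> \<le> M"
    using locally_holder_bound[OF assms(1) \<open>x \<in> S\<close>] by metis
  obtain e' M' where e': "e' > 0" "M' \<ge> 0" "\<And>y. y \<in> ball x e' \<Longrightarrow> \<bar>g y - g x\<bar> \<le> M'"
    using locally_holder_bound[OF assms(2) \<open>x \<in> S\<close>] by metis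
  define D where "D = min (min d d') (min e e')"
  define A where "A = M + \<bar>f x\<bar>" define A' where "A' = M' + \<bar>g x\<bar>"
  have "\<bar>f y * g y - f z * g z\<bar> \<le> (A' * C + A * C') * sqrt (norm (y - z))"
    if "y \<in> ball x D" "z \<in> ball x D" for y z
  proof -
    have b: "\<bar>f z\<bar> \<le> A" "\<bar>g y\<bar> \<le> A'"
      using e(3)[of z] e'(3)[of y] that by (auto simp: A_def A'_def D_def)
    have "f y * g y - f z * g z = g y * (f y - f z) + f z * (g y - g z)" by (simp add: algebra_simps)
    then have "\<bar>f y * g y - f z * g z\<bar> \<le> \<bar>g y\<bar> * \<bar>f y - f z\<bar> + \<bar>f z\<bar> * \<bar>g y - g z\<bar>"
      by (metis abs_mult abs_triangle_ineq)
    also have "\<dots> \<le> A' * (C * sqrt (norm (y - z))) + A * (C' * sqrt (norm (y - z)))"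
      using d(3)[of y z] d'(3)[of y z] that b
      by (intro add_mono mult_mono) (auto simp: D_def intro: order_trans[OF abs_ge_zero])
    finally show ?thesis by (simp add: algebra_simps)
  qed
  then show "\<exists>d>0. \<exists>C. \<forall>y\<in>ball x d. \<forall>z\<in>ball x d. \<bar>f y * g y - f z * g z\<bar> \<le> C * sqrt (norm (y - z))"
    using d(1) d'(1) e(1) e'(1) by (intro exI[of _ D] conjI exI[of _ "A' * C + A * C'"]) (auto simp: D_def)
qed

lemma locally_holder_const: "locally_holder S (\<lambda>x. c)"
  by (rule locally_holderI, intro exI[of _ 1] conjI exI[of _ 0]) simp_all

lemma locally_holder_sum:
  "(\<And>i. i \<in> I \<Longrightarrow> locally_holder S (f i)) \<Longrightarrow> locally_holder S (\<lambda>x. \<Sum>i\<in>I. f i x)"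
  by (induction I rule: infinite_finite_induct) (simp_all add: locally_holder_const locally_holder_add)

lemma onorm_inner_const_le:
  fixes D :: "'a::euclidean_space"
  assumes "norm D \<le> M" shows "onorm (\<lambda>h. h \<bullet> D) \<le> M"
proof (rule onorm_bound)
  show "0 \<le> M" using norm_ge_zero[of D] assms by linarith
  fix h
  have "norm (h \<bullet> D) \<le> norm h * norm D" using Cauchy_Schwarz_ineq2[of h D] by simp
  also have "\<dots> \<le> norm h * M" using assms by (rule mult_left_mono) simp
  finally show "norm (h \<bullet> D) \<le> M * norm h" by (simp add: mult.commute)
qed

lemma locally_holder_C1:
  fixes f :: "'a::euclidean_space \<Rightarrow> real"
  assumes "open S" "Ck_on 1 S f"
  shows "locally_holder S f"
proof (rule locally_holderI)
  fix x assume "x \<in> S"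
  obtain d where d: "d > 0" "cball x d \<subseteq> S" using assms(1) \<open>x \<in> S\<close> open_contains_cball by blast
  have C1: "Ck_on (Suc 0) S f" using assms(2) by simp
  have "compact (gradient f ` cball x d)"
    by (intro compact_continuous_image continuous_on_subset[OF Ck_on_continuous_gradient[OF C1] d(2)]) simp
  then obtain M where M: "\<And>y. y \<in> cball x d \<Longrightarrow> norm (gradient f y) \<le> M" "M > 0"
    using bounded_pos[of "gradient f ` cball x d"] compact_imp_bounded by blast
  have "\<bar>f y - f z\<bar> \<le> (M * sqrt (2 * d)) * sqrt (norm (y - z))" if "y \<in> ball x d" "z \<in> ball x d" for y z
  proof -
    have "norm (f y - f z) \<le> M * norm (y - z)"
    proof (rule differentiable_bound[of "ball x d"])
      fix w assume "w \<in> ball x d"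
      then have "w \<in> cball x d" "w \<in> S" using d(2) by auto
      then show "(f has_derivative (\<lambda>h. h \<bullet> gradient f w)) (at w within ball x d)"
        using Ck_on_SucD'[OF C1] has_derivative_at_withinI by blast
      show "onorm (\<lambda>h. h \<bullet> gradient f w) \<le> M"
        by (rule onorm_inner_const_le[OF M(1)[OF \<open>w \<in> cball x d\<close>]])
    qed (use that in auto)
    also have "\<dots> = M * (sqrt (norm (y - z)) * sqrt (norm (y - z)))" by simp
    \<comment> \<open>A Lipschitz bound becomes a Hoelder bound: one of the two square roots is
      estimated by the diameter of the ball.\<close>
    also have "\<dots> \<le> M * (sqrt (2 * d) * sqrt (norm (y - z)))"
    proof -
      have "norm (y - z) \<le> 2 * d"
        using that dist_triangle2[of y z x] by (simp add: dist_norm norm_minus_commute)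
      then show ?thesis using M(2) by (intro mult_left_mono mult_right_mono) auto
    qed
    finally show ?thesis by simp
  qed
  then show "\<exists>d>0. \<exists>C. \<forall>y\<in>ball x d. \<forall>z\<in>ball x d. \<bar>f y - f z\<bar> \<le> C * sqrt (norm (y - z))"
    using d(1) by blast
qed

lemma locally_holder_powr:
  assumes "locally_holder S f" "\<And>x. x \<in> S \<Longrightarrow> f x > 0"
  shows "locally_holder S (\<lambda>x. f x powr a)"
proof (rule locally_holderI)
  fix x assume "x \<in> S"
  have "Ck_on 1 {0<..} (\<lambda>t::real. t)" using Ck_on_inner_const[of "{0<..}" 1 "1::real"] by simp
  then have "Ck_on 1 {0<..} (\<lambda>t::real. t powr a)" by (intro Ck_on_powr) auto
  then have "locally_holder {0<..} (\<lambda>t::real. t powr a)"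
    by (intro locally_holder_C1) auto
  have C1: "Ck_on (Suc 0) {0<..} (\<lambda>t::real. t powr a)" using \<open>Ck_on 1 {0<..} (\<lambda>t::real. t powr a)\<close> by simp
  \<comment> \<open>Half the value at x keeps the closed ball of values inside the positive axis,
    where the power is C^1 with bounded derivative.\<close>
  define r where "r = f x / 2"
  have r: "0 < r" using assms(2)[OF \<open>x \<in> S\<close>] by (simp add: r_def)
  obtain e where e: "e > 0" "\<And>y. dist y x < e \<Longrightarrow> dist (f y) (f x) < r"
    using locally_holder_isCont[OF assms(1) \<open>x \<in> S\<close>] r unfolding continuous_at_eps_delta by blast
  have sub: "cball (f x) r \<subseteq> {0<..}"
  proof
    fix t assume "t \<in> cball (f x) r"
    then have "\<bar>f x - t\<bar> \<le> r" by (simp add: dist_real_def)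
    then show "t \<in> {0<..}" using r unfolding r_def greaterThan_iff by linarith
  qed
  have "compact (gradient (\<lambda>t::real. t powr a) ` cball (f x) r)"
    by (intro compact_continuous_image continuous_on_subset[OF Ck_on_continuous_gradient[OF C1] sub]) simp
  then obtain M where M: "\<And>y. y \<in> cball (f x) r \<Longrightarrow> norm (gradient (\<lambda>t::real. t powr a) y) \<le> M" "M > 0"
    using bounded_pos[of "gradient (\<lambda>t::real. t powr a) ` cball (f x) r"] compact_imp_bounded by blast
  obtain d C where d: "d > 0" "C \<ge> 0" "\<And>y z. y \<in> ball x d \<Longrightarrow> z \<in> ball x d \<Longrightarrow> \<bar>f y - f z\<bar> \<le> C * sqrt (norm (y - z))"
    using locally_holderE[OF assms(1) \<open>x \<in> S\<close>] by metis
  have "\<bar>f y powr a - f z powr a\<bar> \<le> (M * C) * sqrt (norm (y - z))"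
    if "y \<in> ball x (min d e)" "z \<in> ball x (min d e)" for y z
  proof -
    have m: "f y \<in> cball (f x) r" "f z \<in> cball (f x) r"
      using e(2)[of y] e(2)[of z] that by (auto simp: dist_commute)
    have "norm (f y powr a - f z powr a) \<le> M * norm (f y - f z)"
    proof (rule differentiable_bound[of "cball (f x) r" _ "\<lambda>w h. h \<bullet> gradient (\<lambda>t::real. t powr a) w"])
      fix w assume w: "w \<in> cball (f x) r"
      then show "((\<lambda>t. t powr a) has_derivative (\<lambda>h. h \<bullet> gradient (\<lambda>t::real. t powr a) w)) (at w within cball (f x) r)"
        using Ck_on_SucD'[OF C1, of w] sub has_derivative_at_withinI by blast
      show "onorm (\<lambda>h. h \<bullet> gradient (\<lambda>t::real. t powr a) w) \<le> M"
        by (rule onorm_inner_const_le[OF M(1)[OF w]])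
    qed (use m in auto)
    also have "\<dots> \<le> M * (C * sqrt (norm (y - z)))"
      using d(3)[of y z] that M(2) by (intro mult_left_mono) auto
    finally show ?thesis by simp
  qed
  then show "\<exists>d>0. \<exists>C. \<forall>y\<in>ball x d. \<forall>z\<in>ball x d. \<bar>f y powr a - f z powr a\<bar> \<le> C * sqrt (norm (y - z))"
    using d(1) e(1) by (intro exI[of _ "min d e"] conjI exI[of _ "M * C"]) auto
qed

section \<open>Potentials\<close>

text \<open>For \<open>k = 7\<close> this is the integral of (\<epsilon>/2)
  \<open>avg K f x \<epsilon>\<close> over \<epsilon> from 0 to \<sigma>^4 in the variable
  \<epsilon> = s^4, as (s^4/2) (4 s^3) = 2 s^7. A derivative in x costs 1/\<epsilon>, hence the
  weights s^7, s^3 and s^(-1) for the function and its first and second derivatives.\<close>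

definition potential :: "nat \<Rightarrow> real \<Rightarrow> ('a::euclidean_space \<Rightarrow> 'b::euclidean_space) \<Rightarrow> ('a \<Rightarrow> real) \<Rightarrow> 'a \<Rightarrow> 'b" where
  "potential k \<sigma> K f x = integral {0..\<sigma>} (\<lambda>s. (2 * s ^ k) *\<^sub>R avg K f x (s ^ 4))"

lemma avg_pow4_continuous:
  assumes "cube_translates_in B W (\<sigma> ^ 4)" "continuous_on W f" "continuous_on kcube K" "0 < \<sigma>"
  shows "continuous_on (B \<times> {0..\<sigma>}) (\<lambda>(x, s). avg K f x (s ^ 4))"
proof -
  have "continuous_on (B \<times> {0..\<sigma>}) (\<lambda>p. (\<lambda>(x, \<epsilon>). avg K f x \<epsilon>) (fst p, snd p ^ 4))"
    by (rule continuous_on_compose2[OF avg_continuous[OF assms(1-3)]])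
      (auto intro!: continuous_intros power_mono)
  then show ?thesis by (simp add: case_prod_unfold)
qed

lemma potential_integrand_continuous:
  assumes "cube_translates_in B W (\<sigma> ^ 4)" "continuous_on W f" "continuous_on kcube K" "0 < \<sigma>"
  shows "continuous_on (B \<times> {0..\<sigma>}) (\<lambda>(x, s). (2 * s ^ k) *\<^sub>R avg K f x (s ^ 4))"
  using avg_pow4_continuous[OF assms] unfolding case_prod_unfold by (intro continuous_intros)

lemma continuous_on_section:
  assumes "continuous_on (B \<times> T) (\<lambda>(x, s). g x s)" "x \<in> B"
  shows "continuous_on T (g x)"
  using continuous_on_compose2[OF assms(1) continuous_on_Pair[OF continuous_on_const continuous_on_id], of x T] assms(2)
  by (simp add: image_subset_iff)

lemma potential_integrable:
  assumes "cube_translates_in B W (\<sigma> ^ 4)" "continuous_on W f" "continuous_on kcube K" "0 < \<sigma>" "x \<in> B"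
  shows "(\<lambda>s. (2 * s ^ k) *\<^sub>R avg K f x (s ^ 4)) integrable_on {0..\<sigma>}"
  using continuous_on_section[OF potential_integrand_continuous[OF assms(1-4)] assms(5)]
  by (rule integrable_continuous_real)

lemma potential_inner:
  assumes "cube_translates_in B W (\<sigma> ^ 4)" "continuous_on W f" "continuous_on kcube K" "0 < \<sigma>" "x \<in> B"
  shows "potential k \<sigma> K f x \<bullet> b = potential k \<sigma> (\<lambda>z. K z \<bullet> b) f x"
proof -
  have "integral {0..\<sigma>} (\<lambda>s. ((2 * s ^ k) *\<^sub>R avg K f x (s ^ 4)) \<bullet> b) = potential k \<sigma> K f x \<bullet> b"
    unfolding potential_def by (rule integral_component_eq[OF potential_integrable[OF assms]])
  moreover have "integral {0..\<sigma>} (\<lambda>s. ((2 * s ^ k) *\<^sub>R avg K f x (s ^ 4)) \<bullet> b) =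
    integral {0..\<sigma>} (\<lambda>s. (2 * s ^ k) *\<^sub>R avg (\<lambda>z. K z \<bullet> b) f x (s ^ 4))"
    by (rule integral_cong) (simp add: avg_inner[OF assms(1-3,5)] power_mono)
  ultimately show ?thesis by (simp add: potential_def)
qed

lemma potential_has_derivative:
  assumes "cube_translates_in B W (\<sigma> ^ 4)" "continuous_on W f" "mollifier K" "0 < \<sigma>" "x \<in> B" "convex B" "k > 0"
  shows "((\<lambda>x. potential (k + 4) \<sigma> K f x) has_derivative (\<lambda>h. h \<bullet> potential k \<sigma> (gradient K) f x)) (at x)"
proof -
  have "((\<lambda>x. integral (cbox 0 \<sigma>) (\<lambda>s. (2 * s ^ (k + 4)) *\<^sub>R avg K f x (s ^ 4))) has_derivative
     (\<lambda>h. h \<bullet> integral (cbox 0 \<sigma>) (\<lambda>s. (2 * s ^ k) *\<^sub>R avg (gradient K) f x (s ^ 4)))) (at x)"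
  proof (rule leibniz_gradient[of B])
    show "open B" using assms(1) by (simp add: cube_translates_in_def)
    fix y s assume y: "y \<in> B" and s: "s \<in> cbox 0 \<sigma>"
    show "((\<lambda>x. (2 * s ^ (k + 4)) *\<^sub>R avg K f x (s ^ 4)) has_derivative
       (\<lambda>h. h \<bullet> (2 * s ^ k) *\<^sub>R avg (gradient K) f y (s ^ 4))) (at y)"
    proof (cases "s = 0")
      case True then show ?thesis using \<open>k > 0\<close> by (simp add: zero_power)
    next
      case False
      then have "0 < s ^ 4" "s ^ 4 \<le> \<sigma> ^ 4" using s by (auto intro!: power_mono)
      from has_derivative_scaleR_right[OF avg_has_derivative_mollifier[OF assms(1-3) y this], of "2 * s ^ (k + 4)"]
      show ?thesis using False by (simp add: power_add field_simps)
    qed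
  next
    show "(\<lambda>s. (2 * s ^ (k + 4)) *\<^sub>R avg K f y (s ^ 4)) integrable_on cbox 0 \<sigma>" if "y \<in> B" for y
      using potential_integrable[OF assms(1,2) mollifier_continuous[OF assms(3)] assms(4) that] by simp
    show "continuous_on (B \<times> cbox 0 \<sigma>) (\<lambda>(x, s). (2 * s ^ k) *\<^sub>R avg (gradient K) f x (s ^ 4))"
      using potential_integrand_continuous[OF assms(1,2) mollifier_continuous_gradient[OF assms(3)] assms(4)] by simp
  qed (use assms in auto)
  then show ?thesis by (simp add: potential_def)
qed

section \<open>Hoelder and C^1 estimates for potentials\<close>

lemma avg_norm_le:
  fixes K :: "'a::euclidean_space \<Rightarrow> 'b::euclidean_space"
  assumes "cube_translates_in B W e" "continuous_on W f" "continuous_on kcube K" "x \<in> B" "0 \<le> \<epsilon>" "\<epsilon> \<le> e"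
    "\<And>y. y \<in> W \<Longrightarrow> \<bar>f y\<bar> \<le> M"
  shows "norm (avg K f x \<epsilon>) \<le> M * integral kcube (\<lambda>z. norm (K z))"
proof -
  have "norm (avg K f x \<epsilon>) \<le> integral kcube (\<lambda>z. M * norm (K z))"
    unfolding avg_def
  proof (rule integral_norm_bound_integral)
    show "(\<lambda>z. f (x - \<epsilon> *\<^sub>R z) *\<^sub>R K z) integrable_on kcube"
      by (rule avg_integrable[OF assms(1-6)])
    show "(\<lambda>z. M * norm (K z)) integrable_on kcube"
      using assms(3) unfolding kcube_def by (intro integrable_continuous continuous_intros)
    show "norm (f (x - \<epsilon> *\<^sub>R z) *\<^sub>R K z) \<le> M * norm (K z)" if "z \<in> kcube" for z
      using assms(7)[OF cube_translates_inD[OF assms(1,4,5,6) that]] by (simp add: mult_right_mono)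
  qed
  then show ?thesis by simp
qed

text \<open>Interpolation: a quantity below two bounds is below their geometric mean.\<close>

lemma le_sqrt_mult:
  fixes a b d :: real
  assumes "0 \<le> d" "d \<le> a" "d \<le> b" shows "d \<le> sqrt (a * b)"
  using mult_mono[OF assms(2,3)] assms by (intro real_le_rsqrt) (simp add: power2_eq_square)

text \<open>For bounded f the mean at scale s^4 is bounded by a constant and Lipschitz with constant
  of order s^(-4). The geometric mean of the two resulting bounds for a difference is of order
  s^(-2) times the square root of the distance, and the weight 2 s^3 absorbs the
  singularity.\<close>

lemma potential_holder:
  fixes K :: "'a::euclidean_space \<Rightarrow> real"
  assumes "cube_translates_in B W (\<sigma> ^ 4)" "continuous_on W f" "mollifier K" "0 < \<sigma>" "convex B"
    "\<And>y. y \<in> W \<Longrightarrow> \<bar>f y\<bar> \<le> M"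
  shows "\<exists>C. \<forall>y\<in>B. \<forall>z\<in>B. \<bar>potential 3 \<sigma> K f y - potential 3 \<sigma> K f z\<bar> \<le> C * sqrt (norm (y - z))"
proof -
  note cK = mollifier_continuous[OF assms(3)] mollifier_continuous_gradient[OF assms(3)]
  define C0 where "C0 = M * integral kcube (\<lambda>z. norm (K z))"
  define C1 where "C1 = M * integral kcube (\<lambda>z. norm (gradient K z))"
  have "\<bar>potential 3 \<sigma> K f y - potential 3 \<sigma> K f z\<bar> \<le> (2 * \<sigma> * sqrt (2 * C0 * C1) * \<sigma>) * sqrt (norm (y - z))"
    if yz: "y \<in> B" "z \<in> B" for y z
  proof -
    have C0: "\<bar>avg K f w \<epsilon>\<bar> \<le> C0" if "w \<in> B" "0 \<le> \<epsilon>" "\<epsilon> \<le> \<sigma> ^ 4" for w \<epsilon>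
      using avg_norm_le[OF assms(1,2) cK(1) that assms(6)] by (simp add: C0_def)
    have C1: "norm (avg (gradient K) f w \<epsilon>) \<le> C1" if "w \<in> B" "0 \<le> \<epsilon>" "\<epsilon> \<le> \<sigma> ^ 4" for w \<epsilon>
      using avg_norm_le[OF assms(1,2) cK(2) that assms(6)] by (simp add: C1_def)
    have pos: "0 \<le> C0" "0 \<le> C1" using C0[OF yz(1), of 0] C1[OF yz(1), of 0] assms(4)
      by (auto intro: order_trans[OF abs_ge_zero] order_trans[OF norm_ge_zero])
    have diff: "\<bar>(2 * s ^ 3) *\<^sub>R avg K f y (s ^ 4) - (2 * s ^ 3) *\<^sub>R avg K f z (s ^ 4)\<bar> \<le>
        2 * \<sigma> * sqrt (2 * C0 * C1) * sqrt (norm (y - z))" if s: "s \<in> {0..\<sigma>}" for s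
    proof (cases "s = 0")
      case True then show ?thesis using pos assms(4) by simp
    next
      case False
      then have s4: "0 < s ^ 4" "s ^ 4 \<le> \<sigma> ^ 4" using s by (auto intro!: power_mono)
      have "norm (avg K f y (s ^ 4) - avg K f z (s ^ 4)) \<le> (C1 / s ^ 4) * norm (y - z)"
      proof (rule differentiable_bound[OF assms(5)])
        fix w assume w: "w \<in> B"
        show "((\<lambda>x. avg K f x (s ^ 4)) has_derivative (\<lambda>h. h \<bullet> ((1 / s ^ 4) *\<^sub>R avg (gradient K) f w (s ^ 4)))) (at w within B)"
          by (rule has_derivative_at_withinI[OF avg_has_derivative_mollifier[OF assms(1-3) w s4]])
        have "norm ((1 / s ^ 4) *\<^sub>R avg (gradient K) f w (s ^ 4)) \<le> C1 / s ^ 4"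
          using C1[OF w _ s4(2)] s4(1) by (simp add: divide_right_mono)
        then show "onorm (\<lambda>h. h \<bullet> ((1 / s ^ 4) *\<^sub>R avg (gradient K) f w (s ^ 4))) \<le> C1 / s ^ 4"
          by (rule onorm_inner_const_le)
      qed (use yz in auto)
      moreover have "\<bar>avg K f y (s ^ 4) - avg K f z (s ^ 4)\<bar> \<le> 2 * C0"
        using C0[OF yz(1) _ s4(2)] C0[OF yz(2) _ s4(2)] s4(1) by linarith
      ultimately have "\<bar>avg K f y (s ^ 4) - avg K f z (s ^ 4)\<bar> \<le> sqrt ((2 * C0) * ((C1 / s ^ 4) * norm (y - z)))"
        by (intro le_sqrt_mult) auto
      also have "\<dots> = sqrt (2 * C0 * C1) * sqrt (norm (y - z)) / s\<^sup>2"
      proof -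
        have "(2 * C0) * ((C1 / s ^ 4) * norm (y - z)) = (2 * C0 * C1) * norm (y - z) / (s\<^sup>2)\<^sup>2"
          by simp
        then show ?thesis by (simp only: real_sqrt_divide real_sqrt_mult real_sqrt_abs) simp
      qed
      finally have *: "\<bar>avg K f y (s ^ 4) - avg K f z (s ^ 4)\<bar> \<le> sqrt (2 * C0 * C1) * sqrt (norm (y - z)) / s\<^sup>2" .
      have "\<bar>(2 * s ^ 3) *\<^sub>R avg K f y (s ^ 4) - (2 * s ^ 3) *\<^sub>R avg K f z (s ^ 4)\<bar> =
          (2 * s ^ 3) * \<bar>avg K f y (s ^ 4) - avg K f z (s ^ 4)\<bar>"
        using s by (simp add: abs_mult flip: right_diff_distrib)
      also have "\<dots> \<le> (2 * s ^ 3) * (sqrt (2 * C0 * C1) * sqrt (norm (y - z)) / s\<^sup>2)"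
        using s * by (intro mult_left_mono) auto
      also have "\<dots> = 2 * s * (sqrt (2 * C0 * C1) * sqrt (norm (y - z)))"
        using False by (simp add: power2_eq_square power3_eq_cube)
      also have "\<dots> \<le> 2 * \<sigma> * (sqrt (2 * C0 * C1) * sqrt (norm (y - z)))"
        using s pos by (intro mult_right_mono) auto
      finally show ?thesis by (simp add: mult.assoc)
    qed
    have cont: "continuous_on {0..\<sigma>} (\<lambda>s. (2 * s ^ 3) *\<^sub>R avg K f w (s ^ 4))" if "w \<in> B" for w
      using continuous_on_section[OF potential_integrand_continuous[OF assms(1,2) cK(1) assms(4)] that] .
    have "norm (integral {0..\<sigma>} (\<lambda>s. (2 * s ^ 3) *\<^sub>R avg K f y (s ^ 4) - (2 * s ^ 3) *\<^sub>R avg K f z (s ^ 4)))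
        \<le> (2 * \<sigma> * sqrt (2 * C0 * C1) * sqrt (norm (y - z))) * (\<sigma> - 0)"
      using assms(4) diff by (intro integral_bound continuous_on_diff cont yz) simp_all
    moreover have "integral {0..\<sigma>} (\<lambda>s. (2 * s ^ 3) *\<^sub>R avg K f y (s ^ 4) - (2 * s ^ 3) *\<^sub>R avg K f z (s ^ 4))
       = potential 3 \<sigma> K f y - potential 3 \<sigma> K f z"
      unfolding potential_def
      by (intro integral_diff potential_integrable[OF assms(1,2) cK(1) assms(4)] yz)
    ultimately show ?thesis by (simp add: mult_ac)
  qed
  then show ?thesis by blast
qed

text \<open>Since \<open>gradient K\<close> has integral zero, f x may be subtracted from f in the
  mean; Hoelder continuity over a displacement of order \<epsilon> then gains the square root of
  \<epsilon>.\<close>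

lemma avg_gradient_holder_bound:
  fixes K :: "'a::euclidean_space \<Rightarrow> real"
  assumes "cube_translates_in B W e" "continuous_on W f" "mollifier K" "x \<in> B" "0 \<le> \<epsilon>" "\<epsilon> \<le> e"
    and h: "\<And>y z. y \<in> W \<Longrightarrow> z \<in> W \<Longrightarrow> \<bar>f y - f z\<bar> \<le> C * sqrt (norm (y - z))" "C \<ge> 0"
  shows "norm (avg (gradient K) f x \<epsilon>) \<le>
    C * sqrt (2 * DIM('a)) * integral kcube (\<lambda>z. norm (gradient K z)) * sqrt \<epsilon>"
proof -
  note cK = mollifier_continuous_gradient[OF assms(3)]
  have int: "(\<lambda>z. f (x - \<epsilon> *\<^sub>R z) *\<^sub>R gradient K z) integrable_on kcube"
    by (rule avg_integrable[OF assms(1,2) cK assms(4-6)])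
  have int2: "(\<lambda>z. f x *\<^sub>R gradient K z) integrable_on kcube"
    using cK unfolding kcube_def by (intro integrable_continuous continuous_intros)
  have "integral kcube (\<lambda>z. f x *\<^sub>R gradient K z) = 0"
    by (simp add: integral_gradient_mollifier[OF assms(3)])
  then have "avg (gradient K) f x \<epsilon> = integral kcube (\<lambda>z. (f (x - \<epsilon> *\<^sub>R z) - f x) *\<^sub>R gradient K z)"
    using integral_diff[OF int int2] by (simp add: avg_def scaleR_left_diff_distrib)
  also have "norm \<dots> \<le> integral kcube (\<lambda>z. (C * sqrt (2 * DIM('a)) * sqrt \<epsilon>) * norm (gradient K z))"
  proof (rule integral_norm_bound_integral)
    show "(\<lambda>z. (f (x - \<epsilon> *\<^sub>R z) - f x) *\<^sub>R gradient K z) integrable_on kcube"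
      using integrable_diff[OF int int2] by (simp add: scaleR_left_diff_distrib)
    show "(\<lambda>z. (C * sqrt (2 * DIM('a)) * sqrt \<epsilon>) * norm (gradient K z)) integrable_on kcube"
      using cK unfolding kcube_def by (intro integrable_continuous continuous_intros)
    fix z :: 'a assume z: "z \<in> kcube"
    have "x - \<epsilon> *\<^sub>R 0 \<in> W" using cube_translates_inD[OF assms(1,4,5,6)] norm_le_2_kcube[of 0] by fastforce
    then have "\<bar>f (x - \<epsilon> *\<^sub>R z) - f x\<bar> \<le> C * sqrt (norm ((x - \<epsilon> *\<^sub>R z) - x))"
      using cube_translates_inD[OF assms(1,4,5,6) z] by (intro h) auto
    also have "\<dots> = C * (sqrt \<epsilon> * sqrt (norm z))" using assms(5) by (simp add: real_sqrt_mult)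
    also have "\<dots> \<le> C * (sqrt \<epsilon> * sqrt (2 * DIM('a)))"
      using norm_kcube[OF z] h(2) assms(5) by (intro mult_left_mono) auto
    finally have "\<bar>f (x - \<epsilon> *\<^sub>R z) - f x\<bar> \<le> C * sqrt (2 * DIM('a)) * sqrt \<epsilon>" by (simp add: mult_ac)
    then show "norm ((f (x - \<epsilon> *\<^sub>R z) - f x) *\<^sub>R gradient K z) \<le> (C * sqrt (2 * DIM('a)) * sqrt \<epsilon>) * norm (gradient K z)"
      by (simp add: mult_right_mono)
  qed
  finally show ?thesis by (simp add: mult_ac)
qed

text \<open>Formally the derivative has weight 2 s^3 / s^4 = 2/s. The gain of s^2 from
  \<open>avg_gradient_holder_bound\<close> makes the integrand O(s), so it extends continuously to s
  = 0 and the Leibniz rule applies.\<close>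

lemma potential_C1_holder:
  fixes K :: "'a::euclidean_space \<Rightarrow> real"
  assumes "cube_translates_in B W (\<sigma> ^ 4)" "continuous_on W f" "mollifier K" "0 < \<sigma>" "convex B"
    and h: "\<And>y z. y \<in> W \<Longrightarrow> z \<in> W \<Longrightarrow> \<bar>f y - f z\<bar> \<le> C * sqrt (norm (y - z))" "C \<ge> 0"
  shows "Ck_on 1 B (potential 3 \<sigma> K f)"
proof -
  note cK = mollifier_continuous[OF assms(3)] mollifier_continuous_gradient[OF assms(3)]
  have op: "open B" using assms(1) by (simp add: cube_translates_in_def)
  \<comment> \<open>Integrand of the derivative. Division by zero gives it the value 0 at s = 0,
    which is also its limit by \<open>bound\<close>.\<close>
  define G where "G x s = (2 / s) *\<^sub>R avg (gradient K) f x (s ^ 4)" for x s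
  define D where "D = 2 * (C * sqrt (2 * DIM('a)) * integral kcube (\<lambda>z. norm (gradient K z)))"
  have bound: "norm (G x s) \<le> D * s" if "x \<in> B" "s \<in> {0..\<sigma>}" for x s
  proof (cases "s = 0")
    case False
    have "norm (avg (gradient K) f x (s ^ 4)) \<le> D / 2 * sqrt (s ^ 4)"
      unfolding D_def using that
      by (intro order_trans[OF avg_gradient_holder_bound[OF assms(1-3) _ _ _ h]]) (auto intro!: power_mono)
    also have "sqrt (s ^ 4) = s\<^sup>2" by (rule real_sqrt_unique) (simp_all)
    finally have "(2 / s) * norm (avg (gradient K) f x (s ^ 4)) \<le> (2 / s) * (D / 2 * s\<^sup>2)"
      using that by (intro mult_left_mono) auto
    also have "\<dots> = D * s" using False by (simp add: power2_eq_square)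
    finally show ?thesis using that by (simp add: G_def)
  qed (simp add: G_def)
  have contpos: "continuous_on (B \<times> {0<..\<sigma>}) (\<lambda>(x, s). G x s)"
    unfolding G_def case_prod_unfold
    by (intro continuous_intros continuous_on_subset[OF avg_pow4_continuous[OF assms(1,2) cK(2) assms(4),
          unfolded case_prod_unfold]]) auto
  have cont: "continuous_on (B \<times> {0..\<sigma>}) (\<lambda>(x, s). G x s)"
    unfolding continuous_on_def
  proof
    fix p assume p: "p \<in> B \<times> {0..\<sigma>}"
    show "((\<lambda>(x, s). G x s) \<longlongrightarrow> (case p of (x, s) \<Rightarrow> G x s)) (at p within B \<times> {0..\<sigma>})"
    proof (cases "snd p = 0")
      case True
      have "((\<lambda>q. D * snd q) \<longlongrightarrow> D * snd p) (at p within B \<times> {0..\<sigma>})" by (intro tendsto_intros)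
      moreover have "eventually (\<lambda>q. norm ((\<lambda>(x, s). G x s) q) \<le> D * snd q) (at p within B \<times> {0..\<sigma>})"
        unfolding eventually_at_filter using bound by (intro always_eventually) auto
      ultimately have "((\<lambda>(x, s). G x s) \<longlongrightarrow> 0) (at p within B \<times> {0..\<sigma>})"
        using True by (rule_tac Lim_null_comparison[where g="\<lambda>q. D * snd q"]) simp_all
      moreover have "(case p of (x, s) \<Rightarrow> G x s) = 0" using True by (simp add: case_prod_unfold G_def)
      ultimately show ?thesis by simp
    next
      case False
      \<comment> \<open>Near a point with positive s only positive s matter, so
        \<open>contpos\<close> applies.\<close>
      have "at p within B \<times> {0..\<sigma>} = at p within B \<times> {0<..\<sigma>}"
        using p False by (intro at_within_nhd[of _ "UNIV \<times> {0<..}"]) (auto intro!: open_Times)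
      then show ?thesis using contpos p False unfolding continuous_on_def by (force simp: mem_Times_iff)
    qed
  qed
  have der: "((\<lambda>x. integral (cbox 0 \<sigma>) (\<lambda>s. (2 * s ^ 3) *\<^sub>R avg K f x (s ^ 4))) has_derivative
     (\<lambda>h. h \<bullet> integral (cbox 0 \<sigma>) (G x))) (at x)" if "x \<in> B" for x
  proof (rule leibniz_gradient[of B])
    fix y s assume y: "y \<in> B" and s: "s \<in> cbox 0 \<sigma>"
    show "((\<lambda>x. (2 * s ^ 3) *\<^sub>R avg K f x (s ^ 4)) has_derivative (\<lambda>h. h \<bullet> G y s)) (at y)"
    proof (cases "s = 0")
      case True then show ?thesis by (simp add: G_def)
    next
      case False
      then have "0 < s ^ 4" "s ^ 4 \<le> \<sigma> ^ 4" using s by (auto intro!: power_mono)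
      from has_derivative_scaleR_right[OF avg_has_derivative_mollifier[OF assms(1-3) y this], of "2 * s ^ 3"]
      have 1: "((\<lambda>x. (2 * s ^ 3) *\<^sub>R avg K f x (s ^ 4)) has_derivative
         (\<lambda>h. (2 * s ^ 3) *\<^sub>R (h \<bullet> ((1 / s ^ 4) *\<^sub>R avg (gradient K) f y (s ^ 4))))) (at y)" .
      have "(2 * s ^ 3) * ((1 / s ^ 4) * t) = (2 / s) * t" for t
        using False by (simp add: power3_eq_cube power4_eq_xxxx)
      then have "(\<lambda>h. (2 * s ^ 3) *\<^sub>R (h \<bullet> ((1 / s ^ 4) *\<^sub>R avg (gradient K) f y (s ^ 4)))) = (\<lambda>h. h \<bullet> G y s)"
        unfolding G_def inner_scaleR_right real_scaleR_def by simp
      with 1 show ?thesis by simp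
    qed
  next
    show "(\<lambda>s. (2 * s ^ 3) *\<^sub>R avg K f y (s ^ 4)) integrable_on cbox 0 \<sigma>" if "y \<in> B" for y
      using potential_integrable[OF assms(1,2) cK(1) assms(4) that] by simp
    show "continuous_on (B \<times> cbox 0 \<sigma>) (\<lambda>(x, s). G x s)" using cont by simp
  qed (use assms(5) op that in auto)
  have contG: "continuous_on B (\<lambda>x. integral (cbox 0 \<sigma>) (G x))"
    by (rule integral_continuous_on_param) (use cont in simp)
  have "Ck_on (Suc 0) B (potential 3 \<sigma> K f)"
    using der contG
    by (intro Ck_on_SucI[OF op, of _ "\<lambda>x. integral (cbox 0 \<sigma>) (G x)"])
      (auto simp: potential_def[abs_def] intro!: continuous_intros)
  then show ?thesis by simp
qed

section \<open>The representation by a smooth mean and a potential\<close>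

text \<open>The norm on \<open>kcube\<close> is at most 2 DIM, so the hypothesis bounds every
  displacement by r, and a ball of radius r stays inside the one of radius 2 r.\<close>

lemma cube_translates_in_ball:
  fixes x0 :: "'a::euclidean_space" and r \<sigma> :: real
  assumes "\<sigma> ^ 4 * (2 * real DIM('a)) \<le> r"
  shows "cube_translates_in (ball x0 r) (ball x0 (2 * r)) (\<sigma> ^ 4)"
  unfolding cube_translates_in_def
proof (intro conjI ballI)
  fix x z :: 'a and \<epsilon> :: real assume x: "x \<in> ball x0 r" and e: "\<epsilon> \<in> {0..\<sigma> ^ 4}" and z: "z \<in> kcube"
  have "norm (\<epsilon> *\<^sub>R z) \<le> \<sigma> ^ 4 * (2 * DIM('a))"
    using e norm_kcube[OF z] by (auto intro!: mult_mono)
  then have "norm (\<epsilon> *\<^sub>R z) \<le> r" using assms by simp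
  moreover have "norm (x0 - x) < r" using x by (simp add: dist_norm)
  moreover have "norm (x0 - (x - \<epsilon> *\<^sub>R z)) \<le> norm (x0 - x) + norm (\<epsilon> *\<^sub>R z)"
    using norm_triangle_ineq[of "x0 - x" "\<epsilon> *\<^sub>R z"] by (simp add: algebra_simps)
  ultimately show "x - \<epsilon> *\<^sub>R z \<in> ball x0 (2 * r)" by (simp add: dist_norm)
qed simp_all

lemma cube_translates_in_ball_exists:
  fixes x0 :: "'a::euclidean_space"
  assumes "open \<Omega>" "x0 \<in> \<Omega>" "0 < d"
  obtains r \<sigma> :: real where "0 < r" "2 * r \<le> d" "0 < \<sigma>" "\<sigma> ^ 4 * (2 * real DIM('a)) \<le> r" "cball x0 (2 * r) \<subseteq> \<Omega>"
proof -
  obtain e where e: "e > 0" "cball x0 e \<subseteq> \<Omega>" using assms(1,2) open_contains_cball by blast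
  define r where "r = min d e / 2"
  define \<sigma> where "\<sigma> = min 1 (r / (2 * real DIM('a)))"
  have r: "0 < r" "2 * r \<le> d" "2 * r \<le> e" using e(1) assms(3) by (auto simp: r_def)
  have s: "0 < \<sigma>" "\<sigma> \<le> 1" "\<sigma> \<le> r / (2 * real DIM('a))" using r by (simp_all add: \<sigma>_def)
  have "\<sigma> ^ 4 \<le> \<sigma> ^ 1" using s by (intro power_decreasing) auto
  then have "\<sigma> ^ 4 * (2 * real DIM('a)) \<le> r / (2 * real DIM('a)) * (2 * real DIM('a))"
    using s by (intro mult_right_mono) auto
  also have "\<dots> = r" by simp
  finally have "\<sigma> ^ 4 * (2 * real DIM('a)) \<le> r" .
  moreover have "cball x0 (2 * r) \<subseteq> \<Omega>" using subset_cball[OF r(3)] e(2) by blast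
  ultimately show thesis using that r(1,2) s(1) by blast
qed

text \<open>If \<open>-\<Delta>u = f\<close> weakly, the mean \<open>avg bump' u x \<epsilon>\<close> has \<open>\<epsilon>\<close>-derivative \<open>-(\<epsilon>/2) avg bump f x \<epsilon>\<close>;
  the representation below is this identity integrated over \<open>\<epsilon> = s\<^sup>4\<close>. That substitution turns the singular
  integrals of the first and second derivatives into integrals of continuous functions of \<open>s\<close>.\<close>

definition rep_on :: "'a::euclidean_space set \<Rightarrow> ('a \<Rightarrow> real) \<Rightarrow> ('a \<Rightarrow> real) \<Rightarrow> bool" where
  "rep_on \<Omega> u f \<longleftrightarrow> (\<forall>x0. \<forall>r \<sigma> :: real. 0 < \<sigma> \<longrightarrow> \<sigma> ^ 4 * (2 * real DIM('a)) \<le> r \<longrightarrow> ball x0 (2 * r) \<subseteq> \<Omega> \<longrightarrow>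
     (\<forall>x\<in>ball x0 r. integral kcube (bump' :: 'a \<Rightarrow> real) * u x = avg bump' u x (\<sigma> ^ 4) + potential 7 \<sigma> bump f x))"

text \<open>The mean of u at the fixed scale \<sigma>^4 is smooth for any continuous u, and the
  potential is differentiated through its kernel. The regularity of the gradient is thus that of a
  potential with weight s^3.\<close>

lemma rep_on_gradient:
  fixes u :: "'a::euclidean_space \<Rightarrow> real"
  assumes "rep_on \<Omega> u f" "continuous_on \<Omega> u" "continuous_on \<Omega> f"
    "0 < \<sigma>" "\<sigma> ^ 4 * (2 * real DIM('a)) \<le> r" "ball x0 (2 * r) \<subseteq> \<Omega>" "y \<in> ball x0 r" "b \<in> Basis"
  shows "u differentiable (at y)"
    "gradient u y \<bullet> b = (1 / integral kcube (bump' :: 'a \<Rightarrow> real)) *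
       (gradient (\<lambda>x. avg bump' u x (\<sigma> ^ 4)) y \<bullet> b + potential 3 \<sigma> (\<lambda>z. gradient bump z \<bullet> b) f y)"
proof -
  define c where "c = integral kcube (bump' :: 'a \<Rightarrow> real)"
  have c: "c > 0" unfolding c_def by (rule integral_bump'_pos)
  note adm = cube_translates_in_ball[OF assms(5), of x0]
  have cu: "continuous_on (ball x0 (2 * r)) u" and cf: "continuous_on (ball x0 (2 * r)) f"
    using assms(2,3,6) continuous_on_subset by blast+
  define S where "S x = avg bump' u x (\<sigma> ^ 4)" for x
  have "Ck_on (Suc 0) (ball x0 r) S"
    unfolding S_def[abs_def] using assms(4) by (intro avg_Ck_on[OF adm cu _ _ mollifier_bump']) auto
  then have dS: "(S has_derivative (\<lambda>h. h \<bullet> gradient S y)) (at y)" by (rule Ck_on_SucD'[OF _ assms(7)])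
  have dP: "(potential 7 \<sigma> bump f has_derivative (\<lambda>h. h \<bullet> potential 3 \<sigma> (gradient bump) f y)) (at y)"
    using potential_has_derivative[OF adm cf mollifier_bump assms(4,7) convex_ball, of 3] by simp
  have "((\<lambda>x. (1 / c) * (S x + potential 7 \<sigma> bump f x)) has_derivative
     (\<lambda>h. h \<bullet> ((1 / c) *\<^sub>R (gradient S y + potential 3 \<sigma> (gradient bump) f y)))) (at y)"
    using has_derivative_mult_right[OF has_derivative_add[OF dS dP], of "1 / c"]
    by (simp add: inner_add_right)
  then have "(u has_derivative (\<lambda>h. h \<bullet> ((1 / c) *\<^sub>R (gradient S y + potential 3 \<sigma> (gradient bump) f y)))) (at y)"
  proof (rule has_derivative_gradient_within_open[of _ _ _ "ball x0 r"])
    fix w assume "w \<in> ball x0 r"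
    then have "c * u w = S w + potential 7 \<sigma> bump f w"
      using assms(1,4,5,6) unfolding rep_on_def S_def c_def by blast
    then show "(1 / c) * (S w + potential 7 \<sigma> bump f w) = u w" using c by (simp add: field_simps)
  qed (use assms(7) in auto)
  note D = has_derivative_gradientD[OF this]
  show "u differentiable (at y)" by (rule D(1))
  show "gradient u y \<bullet> b = (1 / integral kcube (bump' :: 'a \<Rightarrow> real)) *
       (gradient (\<lambda>x. avg bump' u x (\<sigma> ^ 4)) y \<bullet> b + potential 3 \<sigma> (\<lambda>z. gradient bump z \<bullet> b) f y)"
    unfolding D(2) c_def[symmetric] S_def[abs_def, symmetric]
    by (simp add: inner_add_left
        potential_inner[OF adm cf mollifier_continuous_gradient[OF mollifier_bump] assms(4,7)])
qed

text \<open>A continuous f is bounded on a small closed ball, which is all that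
  \<open>potential_holder\<close> asks for.\<close>

lemma rep_on_holder_gradient:
  fixes u :: "'a::euclidean_space \<Rightarrow> real"
  assumes "open \<Omega>" "rep_on \<Omega> u f" "continuous_on \<Omega> u" "continuous_on \<Omega> f"
  shows "\<And>x. x \<in> \<Omega> \<Longrightarrow> u differentiable (at x)"
    "\<And>b. b \<in> Basis \<Longrightarrow> locally_holder \<Omega> (\<lambda>x. gradient u x \<bullet> b)"
proof -
  have main: "u differentiable (at x0) \<and>
      (\<exists>U. x0 \<in> U \<and> locally_holder U (\<lambda>x. gradient u x \<bullet> b))" if x0: "x0 \<in> \<Omega>" and b: "b \<in> Basis" for x0 b
  proof -
    obtain r \<sigma> where r: "0 < r" and s: "0 < \<sigma>" "\<sigma> ^ 4 * (2 * real DIM('a)) \<le> r" and cb: "cball x0 (2 * r) \<subseteq> \<Omega>"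
      by (rule cube_translates_in_ball_exists[OF assms(1) x0 zero_less_one])
    have bl: "ball x0 (2 * r) \<subseteq> \<Omega>" using cb ball_subset_cball by blast
    note adm = cube_translates_in_ball[OF s(2), of x0]
    note G = rep_on_gradient[OF assms(2,3,4) s bl _ b]
    have cu: "continuous_on (ball x0 (2 * r)) u" and cf: "continuous_on (ball x0 (2 * r)) f"
      using assms(3,4) bl continuous_on_subset by blast+
    have "compact (f ` cball x0 (2 * r))"
      by (intro compact_continuous_image continuous_on_subset[OF assms(4) cb]) simp
    then obtain M where M: "\<And>y. y \<in> cball x0 (2 * r) \<Longrightarrow> \<bar>f y\<bar> \<le> M"
      using compact_imp_bounded bounded_iff[of "f ` cball x0 (2 * r)"] by fastforce
    have mo: "mollifier (\<lambda>z. gradient bump z \<bullet> b)" by (rule mollifier_partial[OF mollifier_bump b])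
    have "Ck_on (Suc 1) (ball x0 r) (\<lambda>x. avg bump' u x (\<sigma> ^ 4))"
      using s by (intro avg_Ck_on[OF adm cu _ _ mollifier_bump']) auto
    then have "locally_holder (ball x0 r) (\<lambda>y. gradient (\<lambda>x. avg bump' u x (\<sigma> ^ 4)) y \<bullet> b)"
      using b by (intro locally_holder_C1) auto
    moreover have "locally_holder (ball x0 r) (potential 3 \<sigma> (\<lambda>z. gradient bump z \<bullet> b) f)"
    proof (rule locally_holderI)
      fix w assume "w \<in> ball x0 r"
      then obtain d where d: "d > 0" "ball w d \<subseteq> ball x0 r" using open_ball openE by blast
      obtain C where "\<forall>y\<in>ball x0 r. \<forall>z\<in>ball x0 r. \<bar>potential 3 \<sigma> (\<lambda>z. gradient bump z \<bullet> b) f y -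
           potential 3 \<sigma> (\<lambda>z. gradient bump z \<bullet> b) f z\<bar> \<le> C * sqrt (norm (y - z))"
        using potential_holder[OF adm cf mo s(1) convex_ball, of M] M by auto
      then show "\<exists>d>0. \<exists>C. \<forall>y\<in>ball w d. \<forall>z\<in>ball w d. \<bar>potential 3 \<sigma> (\<lambda>z. gradient bump z \<bullet> b) f y -
           potential 3 \<sigma> (\<lambda>z. gradient bump z \<bullet> b) f z\<bar> \<le> C * sqrt (norm (y - z))"
        using d by (intro exI[of _ d] conjI exI[of _ C]) blast+
    qed
    ultimately have "locally_holder (ball x0 r) (\<lambda>y. (1 / integral kcube (bump' :: 'a \<Rightarrow> real)) *
       (gradient (\<lambda>x. avg bump' u x (\<sigma> ^ 4)) y \<bullet> b + potential 3 \<sigma> (\<lambda>z. gradient bump z \<bullet> b) f y))"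
      by (intro locally_holder_mult locally_holder_const locally_holder_add)
    then have "locally_holder (ball x0 r) (\<lambda>x. gradient u x \<bullet> b)"
      by (rule locally_holder_cong[OF open_ball, rotated]) (simp only: G(2))
    moreover have "x0 \<in> ball x0 r" using r by simp
    ultimately show ?thesis using G(1) by blast
  qed
  \<comment> \<open>\<open>main\<close> is stated per direction; any basis vector extracts
    differentiability from it.\<close>
  obtain b0 :: 'a where "b0 \<in> Basis" using nonempty_Basis by blast
  then show "u differentiable (at x)" if "x \<in> \<Omega>" for x using main[OF that] by blast
  show "locally_holder \<Omega> (\<lambda>x. gradient u x \<bullet> b)" if "b \<in> Basis" for b
    by (rule locally_holder_locally) (use main[OF _ that] in blast)
qed

lemma rep_on_C2:
  fixes u :: "'a::euclidean_space \<Rightarrow> real"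
  assumes "open \<Omega>" "rep_on \<Omega> u f" "continuous_on \<Omega> u" "locally_holder \<Omega> f"
  shows "Ck_on 2 \<Omega> u"
proof -
  have cf0: "continuous_on \<Omega> f"
    using locally_holder_isCont[OF assms(4)] by (simp add: continuous_at_imp_continuous_on)
  have "\<exists>U. open U \<and> x0 \<in> U \<and> Ck_on 1 U (\<lambda>x. gradient u x \<bullet> b)" if x0: "x0 \<in> \<Omega>" and b: "b \<in> Basis" for x0 b
  proof -
    obtain d C where d: "d > 0" "C \<ge> 0" "\<And>y z. y \<in> ball x0 d \<Longrightarrow> z \<in> ball x0 d \<Longrightarrow> \<bar>f y - f z\<bar> \<le> C * sqrt (norm (y - z))"
      using locally_holderE[OF assms(4) x0] by metis
    \<comment> \<open>The radius 2 r stays below d, so that the Hoelder estimate holds on the whole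
      ball over which means are taken.\<close>
    obtain r \<sigma> where r: "0 < r" "2 * r \<le> d" and s: "0 < \<sigma>" "\<sigma> ^ 4 * (2 * real DIM('a)) \<le> r" and cb: "cball x0 (2 * r) \<subseteq> \<Omega>"
      using cube_translates_in_ball_exists[OF assms(1) x0 d(1)] by auto
    have bl: "ball x0 (2 * r) \<subseteq> \<Omega>" using cb ball_subset_cball by blast
    note adm = cube_translates_in_ball[OF s(2), of x0]
    note G = rep_on_gradient[OF assms(2,3) cf0 s bl _ b]
    have cu: "continuous_on (ball x0 (2 * r)) u" and cf: "continuous_on (ball x0 (2 * r)) f"
      using assms(3) cf0 bl continuous_on_subset by blast+
    have mo: "mollifier (\<lambda>z. gradient bump z \<bullet> b)" by (rule mollifier_partial[OF mollifier_bump b])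
    have "Ck_on (Suc 1) (ball x0 r) (\<lambda>x. avg bump' u x (\<sigma> ^ 4))"
      using s by (intro avg_Ck_on[OF adm cu _ _ mollifier_bump']) auto
    then have "Ck_on 1 (ball x0 r) (\<lambda>y. gradient (\<lambda>x. avg bump' u x (\<sigma> ^ 4)) y \<bullet> b)"
      using b by simp
    moreover have "Ck_on 1 (ball x0 r) (potential 3 \<sigma> (\<lambda>z. gradient bump z \<bullet> b) f)"
    proof (rule potential_C1_holder[OF adm cf mo s(1) convex_ball _ d(2)])
      fix y z assume "y \<in> ball x0 (2 * r)" "z \<in> ball x0 (2 * r)"
      then show "\<bar>f y - f z\<bar> \<le> C * sqrt (norm (y - z))" using r(2) by (intro d(3)) auto
    qed
    ultimately have "Ck_on 1 (ball x0 r) (\<lambda>y. (1 / integral kcube (bump' :: 'a \<Rightarrow> real)) *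
       (gradient (\<lambda>x. avg bump' u x (\<sigma> ^ 4)) y \<bullet> b + potential 3 \<sigma> (\<lambda>z. gradient bump z \<bullet> b) f y))"
      by (intro Ck_on_cmult Ck_on_add open_ball)
    then have "Ck_on 1 (ball x0 r) (\<lambda>x. gradient u x \<bullet> b)"
      by (rule Ck_on_cong[OF open_ball, rotated]) (simp only: G(2))
    moreover have "x0 \<in> ball x0 r" using r by simp
    ultimately show ?thesis using open_ball by blast
  qed
  then have "Ck_on 1 \<Omega> (\<lambda>x. gradient u x \<bullet> b)" if "b \<in> Basis" for b
    using Ck_on_locally that by blast
  then have "Ck_on (Suc 1) \<Omega> u"
    using rep_on_holder_gradient(1)[OF assms(1-3) cf0] by simp
  then show ?thesis by (simp add: numeral_2_eq_2)
qed

lemma avg_C1_partial: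
  fixes g :: "'a::euclidean_space \<Rightarrow> real" and K :: "'a \<Rightarrow> real"
  assumes "cube_translates_in B W e" "Ck_on 1 W g" "continuous_on kcube K" "x \<in> B" "0 \<le> \<epsilon>" "\<epsilon> \<le> e"
  shows "integral kcube (\<lambda>z. K z *\<^sub>R gradient g (x - \<epsilon> *\<^sub>R z)) \<bullet> b = avg K (\<lambda>y. gradient g y \<bullet> b) x \<epsilon>"
proof -
  have cg: "continuous_on W (gradient g)" using Ck_on_continuous_gradient[of 0 W g] assms(2) by simp
  have "(\<lambda>z. K z *\<^sub>R gradient g (x - \<epsilon> *\<^sub>R z)) integrable_on kcube"
    using cube_translates_inD[OF assms(1,4,5,6)] assms(3) unfolding kcube_def
    by (intro integrable_continuous continuous_intros continuous_on_compose2[OF cg]) auto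
  from integral_component_eq[OF this, of b] show ?thesis
    by (simp add: avg_def mult.commute)
qed

text \<open>Both sides of the representation are differentiated with the derivative falling on u and
  f instead of the kernels. The formula then has the same shape for the pair of partial derivatives,
  and the regularity lemmas can be applied once more.\<close>

lemma rep_on_partial:
  fixes u :: "'a::euclidean_space \<Rightarrow> real"
  assumes "rep_on \<Omega> u f" "Ck_on 1 \<Omega> u" "Ck_on 1 \<Omega> f" "b \<in> Basis"
  shows "rep_on \<Omega> (\<lambda>x. gradient u x \<bullet> b) (\<lambda>x. gradient f x \<bullet> b)"
  unfolding rep_on_def
proof (intro allI impI ballI)
  fix x0 x :: 'a and r \<sigma> :: real
  assume s: "0 < \<sigma>" "\<sigma> ^ 4 * (2 * real DIM('a)) \<le> r" and bl: "ball x0 (2 * r) \<subseteq> \<Omega>" and x: "x \<in> ball x0 r"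
  define c where "c = integral kcube (bump' :: 'a \<Rightarrow> real)"
  have r0: "0 \<le> r" by (rule order_trans[OF _ s(2)]) simp
  note adm = cube_translates_in_ball[OF s(2), of x0]
  have Cu: "Ck_on 1 (ball x0 (2 * r)) u" and Cf: "Ck_on 1 (ball x0 (2 * r)) f"
    using assms(2,3) bl Ck_on_subset by blast+
  have cgf: "continuous_on (ball x0 (2 * r)) (gradient f)"
    using Ck_on_continuous_gradient[of 0 _ f] Cf by simp
  have s4: "0 \<le> \<sigma> ^ 4" by simp
  have dS: "((\<lambda>x. avg bump' u x (\<sigma> ^ 4)) has_derivative
     (\<lambda>h. h \<bullet> integral kcube (\<lambda>z. bump' z *\<^sub>R gradient u (x - \<sigma> ^ 4 *\<^sub>R z)))) (at x)"
    by (rule avg_has_derivative_C1[OF adm Cu mollifier_continuous[OF mollifier_bump'] x s4 order_refl])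
  define Gr where "Gr x s = integral kcube (\<lambda>z. bump z *\<^sub>R gradient f (x - s ^ 4 *\<^sub>R z))" for x s
  have pm: "s ^ 4 \<le> \<sigma> ^ 4" if "s \<in> {0..\<sigma>}" for s using that by (auto intro!: power_mono)
  have cGr: "continuous_on (ball x0 r \<times> {0..\<sigma>}) (\<lambda>(x, s). Gr x s)"
    unfolding Gr_def case_prod_unfold kcube_def
  proof (rule integral_continuous_on_param)
    show "continuous_on ((ball x0 r \<times> {0..\<sigma>}) \<times> cbox (- (2 *\<^sub>R One)) (2 *\<^sub>R One))
        (\<lambda>(p, z). bump z *\<^sub>R gradient f (fst p - snd p ^ 4 *\<^sub>R z))"
      unfolding case_prod_unfold
      using cube_translates_inD[OF adm] pm
      by (intro continuous_intros continuous_on_compose2[OF cgf]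
          continuous_on_compose2[OF mollifier_continuous[OF mollifier_bump, of UNIV]])
        (auto simp: kcube_def simp del: mem_ball)
  qed
  have dP: "((\<lambda>x. integral (cbox 0 \<sigma>) (\<lambda>s. (2 * s ^ 7) *\<^sub>R avg bump f x (s ^ 4))) has_derivative
     (\<lambda>h. h \<bullet> integral (cbox 0 \<sigma>) (\<lambda>s. (2 * s ^ 7) *\<^sub>R Gr x s))) (at x)"
  proof (rule leibniz_gradient[of "ball x0 r"])
    fix y t assume y: "y \<in> ball x0 r" and t: "t \<in> cbox 0 \<sigma>"
    then have t4: "0 \<le> t ^ 4" "t ^ 4 \<le> \<sigma> ^ 4" using pm[of t] by auto
    from has_derivative_scaleR_right[OF avg_has_derivative_C1[OF adm Cf mollifier_continuous[OF mollifier_bump] y t4], of "2 * t ^ 7"]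
    show "((\<lambda>x. (2 * t ^ 7) *\<^sub>R avg bump f x (t ^ 4)) has_derivative (\<lambda>h. h \<bullet> (2 * t ^ 7) *\<^sub>R Gr y t)) (at y)"
      by (simp add: Gr_def)
  next
    show "(\<lambda>s. (2 * s ^ 7) *\<^sub>R avg bump f y (s ^ 4)) integrable_on cbox 0 \<sigma>" if "y \<in> ball x0 r" for y
      using potential_integrable[OF adm Ck_on_continuous[OF Cf] mollifier_continuous[OF mollifier_bump] s(1) that] by simp
    show "continuous_on (ball x0 r \<times> cbox 0 \<sigma>) (\<lambda>(x, s). (2 * s ^ 7) *\<^sub>R Gr x s)"
      using cGr unfolding case_prod_unfold by (intro continuous_intros) simp
  qed (use x in auto)
  have "((\<lambda>x. avg bump' u x (\<sigma> ^ 4) + potential 7 \<sigma> bump f x) has_derivative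
     (\<lambda>h. h \<bullet> (integral kcube (\<lambda>z. bump' z *\<^sub>R gradient u (x - \<sigma> ^ 4 *\<^sub>R z)) +
       integral (cbox 0 \<sigma>) (\<lambda>s. (2 * s ^ 7) *\<^sub>R Gr x s)))) (at x)"
    using has_derivative_add[OF dS dP] by (simp add: potential_def inner_add_right)
  then have "((\<lambda>x. c * u x) has_derivative
     (\<lambda>h. h \<bullet> (integral kcube (\<lambda>z. bump' z *\<^sub>R gradient u (x - \<sigma> ^ 4 *\<^sub>R z)) +
       integral (cbox 0 \<sigma>) (\<lambda>s. (2 * s ^ 7) *\<^sub>R Gr x s)))) (at x)"
  proof (rule has_derivative_gradient_within_open[of _ _ _ "ball x0 r"])
    fix w assume "w \<in> ball x0 r"
    then have "c * u w = avg bump' u w (\<sigma> ^ 4) + potential 7 \<sigma> bump f w"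
      using assms(1) s bl unfolding rep_on_def c_def by blast
    then show "avg bump' u w (\<sigma> ^ 4) + potential 7 \<sigma> bump f w = c * u w" by simp
  qed (use x in simp_all)
  note 1 = has_derivative_gradientD(2)[OF this]
  have "(u has_derivative (\<lambda>h. h \<bullet> gradient u x)) (at x)"
    using Cu subsetD[OF subset_ball[of r "2 * r" x0] x] r0 by (intro Ck_on_SucD'[of 0 "ball x0 (2 * r)"]) simp_all
  from has_derivative_mult_right[OF this, of c]
  have "((\<lambda>x. c * u x) has_derivative (\<lambda>h. h \<bullet> (c *\<^sub>R gradient u x))) (at x)" by simp
  note 2 = has_derivative_gradientD(2)[OF this]
  have "c *\<^sub>R gradient u x = integral kcube (\<lambda>z. bump' z *\<^sub>R gradient u (x - \<sigma> ^ 4 *\<^sub>R z)) +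
       integral (cbox 0 \<sigma>) (\<lambda>s. (2 * s ^ 7) *\<^sub>R Gr x s)" using 1 2 by simp
  from arg_cong[OF this, of "\<lambda>v. v \<bullet> b"] have "c * (gradient u x \<bullet> b) = integral kcube (\<lambda>z. bump' z *\<^sub>R gradient u (x - \<sigma> ^ 4 *\<^sub>R z)) \<bullet> b +
       integral {0..\<sigma>} (\<lambda>s. (2 * s ^ 7) *\<^sub>R Gr x s) \<bullet> b"
    by (simp add: inner_add_left)
  also have "integral kcube (\<lambda>z. bump' z *\<^sub>R gradient u (x - \<sigma> ^ 4 *\<^sub>R z)) \<bullet> b = avg bump' (\<lambda>x. gradient u x \<bullet> b) x (\<sigma> ^ 4)"
    by (rule avg_C1_partial[OF adm Cu mollifier_continuous[OF mollifier_bump'] x s4 order_refl])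
  also have "integral {0..\<sigma>} (\<lambda>s. (2 * s ^ 7) *\<^sub>R Gr x s) \<bullet> b = integral {0..\<sigma>} (\<lambda>s. ((2 * s ^ 7) *\<^sub>R Gr x s) \<bullet> b)"
    by (intro integral_component_eq[symmetric] integrable_continuous_real continuous_intros
        continuous_on_section[OF cGr x])
  also have "\<dots> = potential 7 \<sigma> bump (\<lambda>x. gradient f x \<bullet> b) x"
    unfolding potential_def Gr_def
    by (rule integral_cong) (simp add: avg_C1_partial[OF adm Cf mollifier_continuous[OF mollifier_bump] x] pm)
  finally show "integral kcube (bump' :: 'a \<Rightarrow> real) * (gradient u x \<bullet> b) =
      avg bump' (\<lambda>x. gradient u x \<bullet> b) x (\<sigma> ^ 4) + potential 7 \<sigma> bump (\<lambda>x. gradient f x \<bullet> b) x"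
    by (simp add: c_def)
qed

section \<open>Weak solutions\<close>

text \<open>Restricting the supports to \<open>\<Omega>\<close> allows a real-valued
  \<open>f\<close> that describes the equation only there, away from the points where the singular
  power is infinite.\<close>

definition weak_solution :: "'a::euclidean_space set \<Rightarrow> ('a \<Rightarrow> real) \<Rightarrow> ('a \<Rightarrow> real) \<Rightarrow> bool" where
  "weak_solution \<Omega> u f \<longleftrightarrow> (\<forall>\<psi>. test_function \<psi> \<longrightarrow> closure (support_on UNIV \<psi>) \<subseteq> \<Omega> \<longrightarrow>
     (LINT x|lborel. gradient u x \<bullet> gradient \<psi> x) = (LINT x|lborel. f x * \<psi> x))"

lemma has_derivative_affine_arg:
  fixes K :: "'a::euclidean_space \<Rightarrow> real"
  assumes "(K has_derivative (\<lambda>h. h \<bullet> D)) (at (c *\<^sub>R (x - y)))"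
  shows "((\<lambda>y. K (c *\<^sub>R (x - y))) has_derivative (\<lambda>h. h \<bullet> ((- c) *\<^sub>R D))) (at y)"
proof -
  have "((\<lambda>y. c *\<^sub>R (x - y)) has_derivative (\<lambda>h. c *\<^sub>R (0 - h))) (at y)"
    by (intro derivative_intros)
  from has_derivative_compose[OF this assms] show ?thesis by simp
qed

lemma Ck_on_affine_arg: "Ck_on k UNIV K \<Longrightarrow> Ck_on k UNIV (\<lambda>y. K (c *\<^sub>R (x - y)))"
proof (induction k arbitrary: K)
  case 0
  then show ?case by (auto intro!: continuous_intros continuous_on_compose2[of UNIV K])
next
  case (Suc k)
  show ?case
  proof (rule Ck_on_SucI[OF open_UNIV, of _ "\<lambda>y. (- c) *\<^sub>R gradient K (c *\<^sub>R (x - y))"])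
    show "((\<lambda>y. K (c *\<^sub>R (x - y))) has_derivative (\<lambda>h. h \<bullet> (- c) *\<^sub>R gradient K (c *\<^sub>R (x - y)))) (at y)" for y
      by (rule has_derivative_affine_arg[OF Ck_on_SucD'[OF Suc.prems]]) simp
    fix b :: 'a assume "b \<in> Basis"
    then have "Ck_on k UNIV (\<lambda>y. (- c) * (gradient K (c *\<^sub>R (x - y)) \<bullet> b))"
      using Suc by (intro Ck_on_cmult open_UNIV Suc.IH[of "\<lambda>z. gradient K z \<bullet> b"]) simp
    then show "Ck_on k UNIV (\<lambda>y. (- c) *\<^sub>R gradient K (c *\<^sub>R (x - y)) \<bullet> b)" by simp
  qed
qed

lemma lborel_integral_scaled_kcube:
  fixes \<phi> :: "'a::euclidean_space \<Rightarrow> real"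
  assumes "0 < \<epsilon>" "continuous_on ((\<lambda>z. x - \<epsilon> *\<^sub>R z) ` kcube) \<phi>"
    "\<And>y. y \<notin> (\<lambda>z. x - \<epsilon> *\<^sub>R z) ` kcube \<Longrightarrow> \<phi> y = 0"
  shows "(LINT y|lborel. \<phi> y) = \<epsilon> ^ DIM('a) * integral kcube (\<lambda>z. \<phi> (x - \<epsilon> *\<^sub>R z))"
proof -
  have "compact ((\<lambda>z. x - \<epsilon> *\<^sub>R z) ` kcube)"
    by (intro compact_continuous_image continuous_intros compact_kcube)
  from lborel_integral_compact_support(2)[OF this assms(2,3)]
  have "(LINT y|lborel. \<phi> y) = \<epsilon> ^ DIM('a) * (LINT z|lborel. \<phi> (x - \<epsilon> *\<^sub>R z))"
    using lborel_integral_affine[of "- \<epsilon>" \<phi> x] assms(1) by simp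
  also have "(LINT z|lborel. \<phi> (x - \<epsilon> *\<^sub>R z)) = integral kcube (\<lambda>z. \<phi> (x - \<epsilon> *\<^sub>R z))"
  proof (rule lborel_integral_compact_support(1)[OF compact_kcube])
    show "continuous_on kcube (\<lambda>z. \<phi> (x - \<epsilon> *\<^sub>R z))"
      by (rule continuous_on_compose2[OF assms(2)]) (auto intro!: continuous_intros)
    fix z :: 'a assume z: "z \<notin> kcube"
    have "x - \<epsilon> *\<^sub>R z \<notin> (\<lambda>z. x - \<epsilon> *\<^sub>R z) ` kcube" using z assms(1) by auto
    then show "\<phi> (x - \<epsilon> *\<^sub>R z) = 0" by (rule assms(3))
  qed
  finally show ?thesis .
qed

text \<open>The test function is y \<mapsto> bump((x - y)/\<epsilon>). Its support lies in the image
  of \<open>kcube\<close> under z \<mapsto> x - \<epsilon> z, hence in \<open>\<Omega>\<close>; this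
  substitution produces equal Jacobians on both sides, and the gradient contributes the factor
  -1/\<epsilon>.\<close>

lemma weak_solution_bump:
  fixes u :: "'a::euclidean_space \<Rightarrow> real"
  assumes "weak_solution \<Omega> u f" "Ck_on 1 UNIV u" "continuous_on \<Omega> f"
    "0 < \<epsilon>" "\<And>z. z \<in> kcube \<Longrightarrow> x - \<epsilon> *\<^sub>R z \<in> \<Omega>"
  shows "integral kcube (\<lambda>z. gradient bump z \<bullet> gradient u (x - \<epsilon> *\<^sub>R z)) = - \<epsilon> * avg bump f x \<epsilon>"
proof -
  define T where "T = (\<lambda>z. x - \<epsilon> *\<^sub>R z) ` (kcube :: 'a set)"
  have T: "compact T" "T \<subseteq> \<Omega>"
    unfolding T_def using assms(5) by (auto intro!: compact_continuous_image continuous_intros compact_kcube)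
  define \<psi> where "\<psi> y = bump ((1 / \<epsilon>) *\<^sub>R (x - y))" for y
  have \<psi>grad: "gradient \<psi> y = (- (1 / \<epsilon>)) *\<^sub>R gradient bump ((1 / \<epsilon>) *\<^sub>R (x - y))" for y
    unfolding \<psi>_def[abs_def]
    by (rule has_derivative_gradientD(2)[OF has_derivative_affine_arg[OF mollifier_has_derivative[OF mollifier_bump]]])
  have inT: "y \<in> T" if "norm ((1 / \<epsilon>) *\<^sub>R (x - y)) \<le> 1" for y
  proof -
    have "(1 / \<epsilon>) *\<^sub>R (x - y) \<in> kcube" using that by (intro norm_le_2_kcube) simp
    moreover have "y = x - \<epsilon> *\<^sub>R ((1 / \<epsilon>) *\<^sub>R (x - y))" using assms(4) by simp
    ultimately show ?thesis unfolding T_def by blast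
  qed
  have \<psi>0: "\<psi> y = 0" "gradient \<psi> y = 0" if "y \<notin> T" for y
  proof -
    have "norm ((1 / \<epsilon>) *\<^sub>R (x - y)) > 1" using inT[of y] that by linarith
    then show "\<psi> y = 0" unfolding \<psi>_def by (rule mollifier_outside[OF mollifier_bump])
    have "gradient bump ((1 / \<epsilon>) *\<^sub>R (x - y)) \<bullet> b = 0" if "b \<in> Basis" for b
      by (rule mollifier_outside[OF mollifier_partial[OF mollifier_bump that]]) fact
    then have "gradient bump ((1 / \<epsilon>) *\<^sub>R (x - y)) = 0" by (rule_tac euclidean_eqI) simp
    then show "gradient \<psi> y = 0" unfolding \<psi>grad by simp
  qed
  have "support_on UNIV \<psi> \<subseteq> T" using \<psi>0(1) by (auto simp: support_on_def)
  then have cl: "closure (support_on UNIV \<psi>) \<subseteq> T"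
    using T(1) compact_imp_closed closure_minimal by blast
  then have "compact (closure (support_on UNIV \<psi>))"
    using bounded_subset[OF compact_imp_bounded[OF T(1)] \<open>support_on UNIV \<psi> \<subseteq> T\<close>] by (simp add: compact_closure)
  moreover have "C_class k \<psi>" for k
    unfolding C_class_iff_Ck_on \<psi>_def[abs_def] by (intro Ck_on_affine_arg mollifier_Ck mollifier_bump)
  ultimately have "test_function \<psi>" by (simp add: test_function_def)
  then have eq: "(LINT x|lborel. gradient u x \<bullet> gradient \<psi> x) = (LINT x|lborel. f x * \<psi> x)"
    using assms(1) cl T(2) unfolding weak_solution_def by blast
  have c\<psi>: "continuous_on T \<psi>"
    unfolding \<psi>_def[abs_def]
    by (intro continuous_intros continuous_on_compose2[OF mollifier_continuous[OF mollifier_bump, of UNIV]]) simp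
  have "gradient \<psi> = (\<lambda>y. (- (1 / \<epsilon>)) *\<^sub>R gradient bump ((1 / \<epsilon>) *\<^sub>R (x - y)))"
    using \<psi>grad by blast
  then have cg\<psi>: "continuous_on T (gradient \<psi>)"
    by (simp only:) (intro continuous_intros
        continuous_on_compose2[OF mollifier_continuous_gradient[OF mollifier_bump, of UNIV]], simp)
  have cgu: "continuous_on T (gradient u)"
    using Ck_on_continuous_gradient[of 0 UNIV u] assms(2) continuous_on_subset by auto
  have e: "(1 / \<epsilon>) *\<^sub>R (x - (x - \<epsilon> *\<^sub>R z)) = z" for z using assms(4) by simp
  have "(LINT x|lborel. gradient u x \<bullet> gradient \<psi> x) =
     \<epsilon> ^ DIM('a) * integral kcube (\<lambda>z. gradient u (x - \<epsilon> *\<^sub>R z) \<bullet> gradient \<psi> (x - \<epsilon> *\<^sub>R z))"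
    using assms(4) cgu cg\<psi> \<psi>0(2) unfolding T_def
    by (intro lborel_integral_scaled_kcube) (auto intro!: continuous_intros)
  also have "(\<lambda>z. gradient u (x - \<epsilon> *\<^sub>R z) \<bullet> gradient \<psi> (x - \<epsilon> *\<^sub>R z)) =
     (\<lambda>z. (- (1 / \<epsilon>)) * (gradient bump z \<bullet> gradient u (x - \<epsilon> *\<^sub>R z)))"
    unfolding \<psi>grad e by (simp add: inner_commute)
  finally have 1: "(LINT x|lborel. gradient u x \<bullet> gradient \<psi> x) =
     \<epsilon> ^ DIM('a) * (- (1 / \<epsilon>) * integral kcube (\<lambda>z. gradient bump z \<bullet> gradient u (x - \<epsilon> *\<^sub>R z)))"
    by simp
  have "(LINT x|lborel. f x * \<psi> x) = \<epsilon> ^ DIM('a) * integral kcube (\<lambda>z. f (x - \<epsilon> *\<^sub>R z) * \<psi> (x - \<epsilon> *\<^sub>R z))"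
    using assms(4) continuous_on_subset[OF assms(3) T(2)] c\<psi> \<psi>0(1) unfolding T_def
    by (intro lborel_integral_scaled_kcube) (auto intro!: continuous_intros)
  also have "integral kcube (\<lambda>z. f (x - \<epsilon> *\<^sub>R z) * \<psi> (x - \<epsilon> *\<^sub>R z)) = avg bump f x \<epsilon>"
    unfolding avg_def \<psi>_def e by simp
  finally have "\<epsilon> ^ DIM('a) * (- (1 / \<epsilon>) * integral kcube (\<lambda>z. gradient bump z \<bullet> gradient u (x - \<epsilon> *\<^sub>R z))) =
     \<epsilon> ^ DIM('a) * avg bump f x \<epsilon>" using 1 eq by simp
  then have "- (1 / \<epsilon>) * integral kcube (\<lambda>z. gradient bump z \<bullet> gradient u (x - \<epsilon> *\<^sub>R z)) = avg bump f x \<epsilon>"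
    using assms(4) by (subst (asm) mult_left_cancel) simp_all
  then show ?thesis using assms(4) by (simp add: field_simps)
qed

text \<open>The scale derivative of the mean has integrand -\<open>bump' z\<close> (z \<bullet>
  \<nabla>u), which by \<open>gradient_bump\<close> is half of \<open>gradient bump z\<close>
  \<bullet> \<nabla>u; \<open>weak_solution_bump\<close> evaluates its integral. Integrating from
  scale 0, where the mean is a multiple of u x, gives the formula.\<close>

lemma weak_solution_rep_on:
  fixes u :: "'a::euclidean_space \<Rightarrow> real"
  assumes "weak_solution \<Omega> u f" "Ck_on 1 UNIV u" "continuous_on \<Omega> f"
  shows "rep_on \<Omega> u f"
  unfolding rep_on_def
proof (intro allI impI ballI)
  fix x0 x :: 'a and r \<sigma> :: real
  assume s: "0 < \<sigma>" "\<sigma> ^ 4 * (2 * real DIM('a)) \<le> r" and bl: "ball x0 (2 * r) \<subseteq> \<Omega>" and x: "x \<in> ball x0 r"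
  note adm = cube_translates_in_ball[OF s(2), of x0]
  have cgu: "continuous_on UNIV (gradient u)" and cu: "continuous_on UNIV u"
    using Ck_on_continuous_gradient[of 0 UNIV u] assms(2) Ck_on_continuous[OF assms(2)] by simp_all
  define U where "U \<epsilon> = avg bump' u x \<epsilon>" for \<epsilon>
  have dU: "(U has_derivative (\<lambda>h. h \<bullet> integral kcube (\<lambda>z. bump' z * - (z \<bullet> gradient u (x - \<epsilon> *\<^sub>R z))))) (at \<epsilon>)" for \<epsilon>
    unfolding U_def avg_def kcube_def
  proof (rule leibniz_gradient[of UNIV])
    fix \<epsilon> :: real and z :: 'a
    have "((\<lambda>\<epsilon>. x - \<epsilon> *\<^sub>R z) has_derivative (\<lambda>h. 0 - h *\<^sub>R z)) (at \<epsilon>)"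
      by (intro derivative_intros)
    moreover have "(u has_derivative (\<lambda>h. h \<bullet> gradient u (x - \<epsilon> *\<^sub>R z))) (at (x - \<epsilon> *\<^sub>R z))"
      using assms(2) by (intro Ck_on_SucD'[of 0 UNIV]) auto
    ultimately have "((\<lambda>\<epsilon>. u (x - \<epsilon> *\<^sub>R z)) has_derivative (\<lambda>h. (0 - h *\<^sub>R z) \<bullet> gradient u (x - \<epsilon> *\<^sub>R z))) (at \<epsilon>)"
      by (rule has_derivative_compose)
    from has_derivative_mult_right[OF this, of "bump' z"]
    show "((\<lambda>\<epsilon>. u (x - \<epsilon> *\<^sub>R z) *\<^sub>R bump' z) has_derivative
        (\<lambda>h. h \<bullet> (bump' z * - (z \<bullet> gradient u (x - \<epsilon> *\<^sub>R z))))) (at \<epsilon>)"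
      by (simp add: mult_ac)
  next
    show "(\<lambda>z. u (x - \<epsilon> *\<^sub>R z) *\<^sub>R bump' z) integrable_on cbox (- (2 *\<^sub>R One)) (2 *\<^sub>R One)" for \<epsilon>
      by (intro integrable_continuous continuous_intros continuous_on_compose2[OF cu] mollifier_continuous[OF mollifier_bump']) auto
    show "continuous_on (UNIV \<times> cbox (- (2 *\<^sub>R One)) (2 *\<^sub>R One))
       (\<lambda>(\<epsilon>, z). bump' z * - (z \<bullet> gradient u (x - \<epsilon> *\<^sub>R z)))"
      unfolding case_prod_unfold
      by (intro continuous_intros continuous_on_compose2[OF cgu]
          continuous_on_compose2[OF mollifier_continuous[OF mollifier_bump', of UNIV]]) auto
  qed simp_all
  have dU': "(U has_real_derivative - (\<epsilon> / 2) * avg bump f x \<epsilon>) (at \<epsilon>)" if e: "0 < \<epsilon>" "\<epsilon> \<le> \<sigma> ^ 4" for \<epsilon>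
  proof -
    have "(\<lambda>z. bump' z * - (z \<bullet> gradient u (x - \<epsilon> *\<^sub>R z))) = (\<lambda>z. (1 / 2) * (gradient bump z \<bullet> gradient u (x - \<epsilon> *\<^sub>R z)))"
      by (simp add: gradient_bump)
    then have "integral kcube (\<lambda>z. bump' z * - (z \<bullet> gradient u (x - \<epsilon> *\<^sub>R z))) =
       (1 / 2) * integral kcube (\<lambda>z. gradient bump z \<bullet> gradient u (x - \<epsilon> *\<^sub>R z))"
      by (simp only: integral_mult_right)
    also have "\<dots> = - (\<epsilon> / 2) * avg bump f x \<epsilon>"
      using cube_translates_inD[OF adm x] e bl by (subst weak_solution_bump[OF assms e(1)]) auto
    finally have eq: "integral kcube (\<lambda>z. bump' z * - (z \<bullet> gradient u (x - \<epsilon> *\<^sub>R z))) = - (\<epsilon> / 2) * avg bump f x \<epsilon>" .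
    have "(\<lambda>h::real. h \<bullet> t) = (*) t" for t by (simp add: fun_eq_iff mult.commute)
    then show ?thesis using dU[of \<epsilon>] unfolding has_field_derivative_def eq by (simp only:)
  qed
  have "((\<lambda>s. - ((2 * s ^ 7) *\<^sub>R avg bump f x (s ^ 4))) has_integral (U (\<sigma> ^ 4) - U (0 ^ 4))) {0..\<sigma>}"
  \<comment> \<open>\<open>dU'\<close> holds only for positive \<epsilon>; at the end point 0
    continuity of \<open>U\<close> is enough.\<close>
  proof (rule fundamental_theorem_of_calculus_interior)
    have "continuous_on UNIV U"
      using dU has_derivative_continuous continuous_at_imp_continuous_on by blast
    then show "continuous_on {0..\<sigma>} (\<lambda>s. U (s ^ 4))"
      by (rule continuous_on_compose2) (auto intro!: continuous_intros)
    fix s assume "s \<in> {0<..<\<sigma>}"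
    then have s': "0 < s" "0 < s ^ 4" "s ^ 4 \<le> \<sigma> ^ 4" by (auto intro!: power_mono)
    have "((\<lambda>s. s ^ 4) has_real_derivative 4 * s ^ 3) (at s)"
      by (auto intro!: derivative_eq_intros)
    from DERIV_chain2[OF dU'[OF s'(2,3)] this]
    have "((\<lambda>s. U (s ^ 4)) has_real_derivative - (s ^ 4 / 2) * avg bump f x (s ^ 4) * (4 * s ^ 3)) (at s)" .
    then have "((\<lambda>s. U (s ^ 4)) has_real_derivative - ((2 * s ^ 7) *\<^sub>R avg bump f x (s ^ 4))) (at s)"
      by (rule DERIV_cong) (simp add: power_add[of s 4 3, simplified] mult_ac)
    then show "((\<lambda>s. U (s ^ 4)) has_vector_derivative - ((2 * s ^ 7) *\<^sub>R avg bump f x (s ^ 4))) (at s)"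
      by (simp add: has_real_derivative_iff_has_vector_derivative)
  qed (use s in simp)
  from has_integral_neg[OF this]
  have "((\<lambda>s. (2 * s ^ 7) *\<^sub>R avg bump f x (s ^ 4)) has_integral (U 0 - U (\<sigma> ^ 4))) {0..\<sigma>}" by simp
  then have "potential 7 \<sigma> bump f x = U 0 - U (\<sigma> ^ 4)"
    unfolding potential_def by (rule integral_unique)
  moreover have "U 0 = integral kcube (bump' :: 'a \<Rightarrow> real) * u x"
    by (simp add: U_def avg_def)
  ultimately show "integral kcube (bump' :: 'a \<Rightarrow> real) * u x = avg bump' u x (\<sigma> ^ 4) + potential 7 \<sigma> bump f x"
    by (simp add: U_def)
qed

text \<open>For every small positive \<epsilon> the bump mean of \<Delta>u + f vanishes, by
  integration by parts and the weak equation. Letting \<epsilon> tend to 0 turns the mean into the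
  value at x times the positive integral of \<open>bump\<close>.\<close>

lemma weak_solution_laplacian:
  fixes u :: "'a::euclidean_space \<Rightarrow> real"
  assumes "open \<Omega>" "weak_solution \<Omega> u f" "Ck_on 1 UNIV u" "continuous_on \<Omega> f" "Ck_on 2 \<Omega> u" "x \<in> \<Omega>"
  shows "(\<Sum>b\<in>Basis. gradient (\<lambda>y. gradient u y \<bullet> b) x \<bullet> b) = - f x"
proof -
  obtain r \<sigma> where r: "0 < r" and s: "0 < \<sigma>" "\<sigma> ^ 4 * (2 * real DIM('a)) \<le> r" and cb: "cball x (2 * r) \<subseteq> \<Omega>"
    by (rule cube_translates_in_ball_exists[OF assms(1,6) zero_less_one])
  define B where "B = ball x r" define W where "W = ball x (2 * r)" define e where "e = \<sigma> ^ 4"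
  have adm: "cube_translates_in B W e" unfolding B_def W_def e_def by (rule cube_translates_in_ball[OF s(2)])
  have xB: "x \<in> B" and W\<Omega>: "W \<subseteq> \<Omega>" and e: "0 < e" using r cb s by (auto simp: B_def W_def e_def)
  have cf: "continuous_on W f" using assms(4) W\<Omega> continuous_on_subset by blast
  define ub where "ub b y = gradient u y \<bullet> b" for b y
  have Cub: "Ck_on 1 W (ub b)" if "b \<in> Basis" for b
    using Ck_on_subset[OF assms(5) W\<Omega>] that by (simp add: ub_def[abs_def] numeral_2_eq_2)
  define ubb where "ubb b y = gradient (ub b) y \<bullet> b" for b y
  have cubb: "continuous_on W (ubb b)" if "b \<in> Basis" for b
    using Cub[OF that] that by (simp add: ubb_def[abs_def])
  define D where "D \<epsilon> = (\<Sum>b\<in>Basis. avg bump (ubb b) x \<epsilon>) + avg bump f x \<epsilon>" for \<epsilon>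
  note cb = mollifier_continuous[OF mollifier_bump]
  have "D \<epsilon> = 0" if \<epsilon>: "0 < \<epsilon>" "\<epsilon> \<le> e" for \<epsilon>
  proof -
    have eps: "0 \<le> \<epsilon>" using \<epsilon> by simp
    \<comment> \<open>Integration by parts without boundary terms: the gradient of
      \<open>avg bump (ub b)\<close> is computed once with the derivative on the kernel and once
      with the derivative on \<open>ub b\<close>.\<close>
    have "avg (\<lambda>z. gradient bump z \<bullet> b) (ub b) x \<epsilon> = \<epsilon> * avg bump (ubb b) x \<epsilon>" if b: "b \<in> Basis" for b
    proof -
      have "gradient (\<lambda>x. avg bump (ub b) x \<epsilon>) x = (1 / \<epsilon>) *\<^sub>R avg (gradient bump) (ub b) x \<epsilon>"
        by (intro has_derivative_gradientD(2) avg_has_derivative_mollifier[OF adm _ mollifier_bump xB \<epsilon>]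
            Ck_on_continuous[OF Cub[OF b]])
      moreover have "gradient (\<lambda>x. avg bump (ub b) x \<epsilon>) x = integral kcube (\<lambda>z. bump z *\<^sub>R gradient (ub b) (x - \<epsilon> *\<^sub>R z))"
        by (intro has_derivative_gradientD(2) avg_has_derivative_C1[OF adm Cub[OF b] cb xB eps \<epsilon>(2)])
      ultimately have "(1 / \<epsilon>) * (avg (gradient bump) (ub b) x \<epsilon> \<bullet> b) = avg bump (ubb b) x \<epsilon>"
        using avg_C1_partial[OF adm Cub[OF b] cb xB eps \<epsilon>(2), of b] unfolding ubb_def[abs_def]
        by (metis inner_scaleR_left)
      then show ?thesis
        using avg_inner[OF adm Ck_on_continuous[OF Cub[OF b]] mollifier_continuous_gradient[OF mollifier_bump] xB eps \<epsilon>(2), of b] \<epsilon>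
        by (simp add: field_simps)
    qed
    then have "\<epsilon> * (\<Sum>b\<in>Basis. avg bump (ubb b) x \<epsilon>) = (\<Sum>b\<in>Basis. avg (\<lambda>z. gradient bump z \<bullet> b) (ub b) x \<epsilon>)"
      by (simp add: sum_distrib_left)
    also have "\<dots> = integral kcube (\<lambda>z. \<Sum>b\<in>Basis. ub b (x - \<epsilon> *\<^sub>R z) *\<^sub>R (gradient bump z \<bullet> b))"
      unfolding avg_def
    proof (rule integral_sum[symmetric])
      fix b :: 'a assume b: "b \<in> Basis"
      show "(\<lambda>z. ub b (x - \<epsilon> *\<^sub>R z) *\<^sub>R (gradient bump z \<bullet> b)) integrable_on kcube"
        by (rule avg_integrable[OF adm Ck_on_continuous[OF Cub[OF b]]
              mollifier_continuous[OF mollifier_partial[OF mollifier_bump b]] xB eps \<epsilon>(2)])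
    qed simp
    also have "(\<lambda>z. \<Sum>b\<in>Basis. ub b (x - \<epsilon> *\<^sub>R z) *\<^sub>R (gradient bump z \<bullet> b)) =
        (\<lambda>z. gradient bump z \<bullet> gradient u (x - \<epsilon> *\<^sub>R z))"
    proof
      fix z
      have "gradient bump z \<bullet> gradient u (x - \<epsilon> *\<^sub>R z) =
          (\<Sum>b\<in>Basis. (gradient bump z \<bullet> b) * (gradient u (x - \<epsilon> *\<^sub>R z) \<bullet> b))"
        by (rule euclidean_inner)
      then show "(\<Sum>b\<in>Basis. ub b (x - \<epsilon> *\<^sub>R z) *\<^sub>R (gradient bump z \<bullet> b)) =
          gradient bump z \<bullet> gradient u (x - \<epsilon> *\<^sub>R z)"
        by (simp add: ub_def mult.commute)
    qed
    also have "integral kcube \<dots> = - \<epsilon> * avg bump f x \<epsilon>"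
      using cube_translates_inD[OF adm xB eps \<epsilon>(2)] W\<Omega> by (intro weak_solution_bump[OF assms(2-4) \<epsilon>(1)]) auto
    finally have "\<epsilon> * D \<epsilon> = 0" by (simp add: D_def distrib_left)
    then show ?thesis using \<epsilon> by simp
  qed
  moreover have "continuous_on {0..e} D"
    unfolding D_def
    by (intro continuous_intros continuous_on_section[OF avg_continuous[OF adm _ cb] xB] cubb cf)
  then have "(D \<longlongrightarrow> D 0) (at_right 0)"
    using e by (simp add: continuous_on_Icc_at_rightD)
  ultimately have "D 0 = 0"
    using e by (intro tendsto_unique[of "at_right 0" D])
      (auto intro!: tendsto_eventually eventually_at_rightI[of 0 e])
  moreover have "D 0 = ((\<Sum>b\<in>Basis. ubb b x) + f x) * integral kcube (bump :: 'a \<Rightarrow> real)"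
    by (simp add: D_def avg_def sum_distrib_right distrib_right)
  ultimately have "(\<Sum>b\<in>Basis. ubb b x) + f x = 0"
    using integral_bump_pos[where 'a='a] by (metis mult_eq_0_iff less_irrefl)
  then show ?thesis by (simp add: ubb_def ub_def[abs_def])
qed

section \<open>Regularity away from critical points\<close>

lemma partial_line_derivative:
  fixes f :: "'a::euclidean_space \<Rightarrow> real"
  assumes "f differentiable (at x)"
  shows "((\<lambda>t. f (x + t *\<^sub>R b)) has_real_derivative gradient f x \<bullet> b) (at 0)"
  using has_derivative_line[of f "gradient f x" x 0 b] has_derivative_gradient[OF assms]
  by (simp add: inner_commute)

text \<open>Once differentiability is known, partial derivatives can be computed by one-variable
  rules along x + t b; the explicit formulas for derivatives of f, v and \<zeta>^2 h below rest on
  this.\<close>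

lemma partial_eqI:
  fixes f :: "'a::euclidean_space \<Rightarrow> real"
  assumes "f differentiable (at x)" "((\<lambda>t. f (x + t *\<^sub>R b)) has_real_derivative d) (at 0)"
  shows "gradient f x \<bullet> b = d"
  using DERIV_unique[OF partial_line_derivative[OF assms(1)] assms(2)] .

lemma Ck_on_differentiable: "Ck_on (Suc k) S f \<Longrightarrow> x \<in> S \<Longrightarrow> f differentiable (at x)"
  by simp

lemma Ck_on_partial: "Ck_on (Suc k) S f \<Longrightarrow> b \<in> Basis \<Longrightarrow> Ck_on k S (\<lambda>x. gradient f x \<bullet> b)"
  by simp

text \<open>u^p |\<nabla>u|^q with the norm expanded into a sum of squares of partial derivatives,
  so that the closure rules for sums, products and real powers yield its regularity.\<close>

definition product_rhs :: "real \<Rightarrow> real \<Rightarrow> ('a::euclidean_space \<Rightarrow> real) \<Rightarrow> 'a \<Rightarrow> real" where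
  "product_rhs p q u x = u x powr p * (\<Sum>c\<in>Basis. (gradient u x \<bullet> c) * (gradient u x \<bullet> c)) powr (q / 2)"

lemma sum_partials_pos:
  fixes D :: "'a::euclidean_space"
  assumes "D \<noteq> 0" shows "(\<Sum>c\<in>Basis. (D \<bullet> c) * (D \<bullet> c)) > 0"
  using assms by (simp flip: euclidean_inner)

lemma product_rhs_C1:
  fixes u :: "'a::euclidean_space \<Rightarrow> real"
  assumes "open \<Omega>" "Ck_on 2 \<Omega> u" "\<And>x. x \<in> \<Omega> \<Longrightarrow> u x > 0" "\<And>x. x \<in> \<Omega> \<Longrightarrow> gradient u x \<noteq> 0"
  shows "Ck_on 1 \<Omega> (product_rhs p q u)"
proof -
  have C2: "Ck_on (Suc 1) \<Omega> u" using assms(2) by (simp add: numeral_2_eq_2)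
  show ?thesis
    unfolding product_rhs_def[abs_def]
    by (intro Ck_on_mult Ck_on_powr Ck_on_sum Ck_on_SucD[OF C2] Ck_on_partial[OF C2] assms(1,3)
        sum_partials_pos assms(4))
qed

text \<open>The formula is made explicit because Hoelder continuity of the partial derivatives of
  the right-hand side is read off it: only derivatives of u up to order two occur.\<close>

lemma product_rhs_partial:
  fixes u :: "'a::euclidean_space \<Rightarrow> real"
  assumes "open \<Omega>" "Ck_on 2 \<Omega> u" "\<And>x. x \<in> \<Omega> \<Longrightarrow> u x > 0" "\<And>x. x \<in> \<Omega> \<Longrightarrow> gradient u x \<noteq> 0"
    "x \<in> \<Omega>" "b \<in> Basis"
  shows "gradient (product_rhs p q u) x \<bullet> b =
    p * u x powr (p - 1) * (gradient u x \<bullet> b) * (\<Sum>c\<in>Basis. (gradient u x \<bullet> c) * (gradient u x \<bullet> c)) powr (q / 2) +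
    u x powr p * ((q / 2) * (\<Sum>c\<in>Basis. (gradient u x \<bullet> c) * (gradient u x \<bullet> c)) powr (q / 2 - 1) *
      (\<Sum>c\<in>Basis. 2 * (gradient u x \<bullet> c) * (gradient (\<lambda>y. gradient u y \<bullet> c) x \<bullet> b)))"
  (is "_ = ?d")
proof -
  have C2: "Ck_on (Suc (Suc 0)) \<Omega> u" using assms(2) by (simp add: numeral_2_eq_2)
  have N: "(\<Sum>c\<in>Basis. (gradient u x \<bullet> c) * (gradient u x \<bullet> c)) > 0" if "x \<in> \<Omega>" for x
    using sum_partials_pos assms(4)[OF that] by blast
  have C1: "Ck_on (Suc 0) \<Omega> (product_rhs p q u)"
    using product_rhs_C1[OF assms(1-4)] by simp
  have du: "((\<lambda>t. u (x + t *\<^sub>R b)) has_real_derivative gradient u x \<bullet> b) (at 0)"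
    by (rule partial_line_derivative[OF Ck_on_differentiable[OF C2 assms(5)]])
  have duc: "((\<lambda>t. gradient u (x + t *\<^sub>R b) \<bullet> c) has_real_derivative gradient (\<lambda>y. gradient u y \<bullet> c) x \<bullet> b) (at 0)"
    if "c \<in> Basis" for c
    by (rule partial_line_derivative[OF Ck_on_differentiable[OF Ck_on_partial[OF C2 that] assms(5)]])
  have dN: "((\<lambda>t. \<Sum>c\<in>Basis. (gradient u (x + t *\<^sub>R b) \<bullet> c) * (gradient u (x + t *\<^sub>R b) \<bullet> c)) has_real_derivative
      (\<Sum>c\<in>Basis. 2 * (gradient u x \<bullet> c) * (gradient (\<lambda>y. gradient u y \<bullet> c) x \<bullet> b))) (at 0)"
  proof (rule DERIV_sum)
    fix c :: 'a assume c: "c \<in> Basis"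
    show "((\<lambda>t. (gradient u (x + t *\<^sub>R b) \<bullet> c) * (gradient u (x + t *\<^sub>R b) \<bullet> c)) has_real_derivative
      2 * (gradient u x \<bullet> c) * (gradient (\<lambda>y. gradient u y \<bullet> c) x \<bullet> b)) (at 0)"
      by (rule DERIV_cong[OF DERIV_mult[OF duc[OF c] duc[OF c]]]) simp
  qed
  have pw: "((\<lambda>t. g t powr a) has_real_derivative a * g 0 powr (a - 1) * d) (at 0)"
    if "(g has_real_derivative d) (at 0)" "g 0 > 0" for g :: "real \<Rightarrow> real" and a d
    using DERIV_chain2[OF has_real_derivative_powr[OF that(2)] that(1)] .
  show "gradient (product_rhs p q u) x \<bullet> b = ?d"
  proof (rule partial_eqI[OF Ck_on_differentiable[OF C1 assms(5)]])
    show "((\<lambda>t. product_rhs p q u (x + t *\<^sub>R b)) has_real_derivative ?d) (at 0)"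
      unfolding product_rhs_def
      by (rule DERIV_cong[OF DERIV_mult[OF pw[OF du] pw[OF dN]]])
        (use assms(3)[OF assms(5)] N[OF assms(5)] in \<open>simp_all add: mult_ac\<close>)
  qed
qed

text \<open>Where the test function is nonzero the gradient of u is nonzero, so
  \<open>reaction\<close> is finite there and the special values in \<open>sing_powr\<close> agree
  with the ordinary power, also for q = 0.\<close>

lemma positive_solution_weak:
  fixes u :: "'a::euclidean_space \<Rightarrow> real"
  assumes "positive_solution p q u" "\<Omega> = {x. gradient u x \<noteq> 0}"
  shows "weak_solution \<Omega> u (product_rhs p q u)"
  unfolding weak_solution_def
proof (intro allI impI)
  fix \<psi> :: "'a \<Rightarrow> real"
  assume t: "test_function \<psi>" and s: "closure (support_on UNIV \<psi>) \<subseteq> \<Omega>"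
  have "enn2real (reaction p q u x) * \<psi> x = product_rhs p q u x * \<psi> x" for x
  proof (cases "\<psi> x = 0")
    case False
    then have "x \<in> \<Omega>" using s closure_subset[of "support_on UNIV \<psi>"] by (auto simp: support_on_def)
    then have g: "norm (gradient u x) > 0" using assms(2) by simp
    have "sing_powr (norm (gradient u x)) q = ennreal (norm (gradient u x) powr q)"
      using g by (auto simp: sing_powr_def)
    moreover have "norm (gradient u x) powr q = (\<Sum>c\<in>Basis. (gradient u x \<bullet> c) * (gradient u x \<bullet> c)) powr (q / 2)"
      using g unfolding euclidean_inner[symmetric] norm_eq_sqrt_inner
      by (simp add: powr_half_sqrt[symmetric] powr_powr)
    ultimately have "reaction p q u x = ennreal (product_rhs p q u x)"
      by (simp add: reaction_def product_rhs_def ennreal_mult')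
    then show ?thesis by (simp add: product_rhs_def)
  qed simp
  then show "(LINT x|lborel. gradient u x \<bullet> gradient \<psi> x) = (LINT x|lborel. product_rhs p q u x * \<psi> x)"
    using assms(1) t unfolding positive_solution_def by (simp only:)
qed

lemma positive_solution_regular:
  fixes u :: "'a::euclidean_space \<Rightarrow> real"
  assumes "positive_solution p q u" "\<Omega> = {x. gradient u x \<noteq> 0}"
  shows "open \<Omega>" "Ck_on 3 \<Omega> u"
    "\<And>x. x \<in> \<Omega> \<Longrightarrow> (\<Sum>b\<in>Basis. gradient (\<lambda>y. gradient u y \<bullet> b) x \<bullet> b) = - product_rhs p q u x"
proof -
  define f where "f = product_rhs p q u"
  have C1: "Ck_on 1 UNIV u" and pos: "\<And>x. u x > 0"
    using assms(1) by (auto simp: positive_solution_def C_class_iff_Ck_on)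
  have C1': "Ck_on (Suc 0) UNIV u" using C1 by simp
  have cg: "continuous_on UNIV (gradient u)" by (rule Ck_on_continuous_gradient[OF C1'])
  show op: "open \<Omega>"
    unfolding assms(2) by (intro open_Collect_neq cg continuous_on_const)
  have nz: "\<And>x. x \<in> \<Omega> \<Longrightarrow> gradient u x \<noteq> 0" by (simp add: assms(2))
  have N: "(\<Sum>c\<in>Basis. (gradient u x \<bullet> c) * (gradient u x \<bullet> c)) > 0" if "x \<in> \<Omega>" for x
    using sum_partials_pos nz[OF that] by blast
  have cu: "continuous_on \<Omega> u" using Ck_on_continuous[OF C1] continuous_on_subset by blast
  have C1\<Omega>: "Ck_on 1 \<Omega> u" using C1 Ck_on_subset by blast
  have cf: "continuous_on \<Omega> f"
  proof -
    have "Ck_on 0 \<Omega> f" unfolding f_def product_rhs_def[abs_def]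
      using Ck_on_partial[of 0 \<Omega> u] C1\<Omega>
      by (intro Ck_on_mult Ck_on_powr Ck_on_sum Ck_on_mono[OF C1\<Omega>] op pos N) simp_all
    then show ?thesis by simp
  qed
  note weak = positive_solution_weak[OF assms, folded f_def]
  have rep: "rep_on \<Omega> u f" by (rule weak_solution_rep_on[OF weak C1 cf])
  have hu: "locally_holder \<Omega> u" by (rule locally_holder_C1[OF op C1\<Omega>])
  have hub: "locally_holder \<Omega> (\<lambda>x. gradient u x \<bullet> b)" if "b \<in> Basis" for b
    by (rule rep_on_holder_gradient(2)[OF op rep cu cf]) (rule that)
  have "locally_holder \<Omega> f" unfolding f_def product_rhs_def[abs_def]
    by (intro locally_holder_mult locally_holder_powr locally_holder_sum hu hub pos N)
  then have C2: "Ck_on 2 \<Omega> u" by (rule rep_on_C2[OF op rep cu])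
  then have C2': "Ck_on (Suc 1) \<Omega> u" by (simp add: numeral_2_eq_2)
  show "(\<Sum>b\<in>Basis. gradient (\<lambda>y. gradient u y \<bullet> b) x \<bullet> b) = - product_rhs p q u x" if "x \<in> \<Omega>" for x
    using weak_solution_laplacian[OF op weak C1 cf C2 that] by (simp add: f_def)
  have C1f: "Ck_on 1 \<Omega> f" unfolding f_def by (rule product_rhs_C1[OF op C2 pos nz])
  have "Ck_on 2 \<Omega> (\<lambda>x. gradient u x \<bullet> b)" if b: "b \<in> Basis" for b
  proof -
    have rb: "rep_on \<Omega> (\<lambda>x. gradient u x \<bullet> b) (\<lambda>x. gradient f x \<bullet> b)"
      by (rule rep_on_partial[OF rep C1\<Omega> C1f b])
    have cub: "continuous_on \<Omega> (\<lambda>x. gradient u x \<bullet> b)" and cfb: "continuous_on \<Omega> (\<lambda>x. gradient f x \<bullet> b)"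
      using C1\<Omega> C1f b by simp_all
    \<comment> \<open>Needed for all directions c: the partial derivative of f in direction b
      contains every second derivative of u in directions c and b.\<close>
    have hubc: "locally_holder \<Omega> (\<lambda>x. gradient (\<lambda>y. gradient u y \<bullet> c) x \<bullet> b)" if c: "c \<in> Basis" for c
    proof (rule rep_on_holder_gradient(2)[OF op _ _ _ b])
      show "rep_on \<Omega> (\<lambda>x. gradient u x \<bullet> c) (\<lambda>x. gradient f x \<bullet> c)"
        by (rule rep_on_partial[OF rep C1\<Omega> C1f c])
      show "continuous_on \<Omega> (\<lambda>x. gradient u x \<bullet> c)" "continuous_on \<Omega> (\<lambda>x. gradient f x \<bullet> c)"
        using C1\<Omega> C1f c by simp_all
    qed
    have "locally_holder \<Omega> (\<lambda>x. gradient f x \<bullet> b)"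
    proof (rule locally_holder_cong[OF op])
      show "locally_holder \<Omega> (\<lambda>x. p * u x powr (p - 1) * (gradient u x \<bullet> b) *
          (\<Sum>c\<in>Basis. (gradient u x \<bullet> c) * (gradient u x \<bullet> c)) powr (q / 2) +
        u x powr p * ((q / 2) * (\<Sum>c\<in>Basis. (gradient u x \<bullet> c) * (gradient u x \<bullet> c)) powr (q / 2 - 1) *
        (\<Sum>c\<in>Basis. 2 * (gradient u x \<bullet> c) * (gradient (\<lambda>y. gradient u y \<bullet> c) x \<bullet> b))))"
        by (intro locally_holder_add locally_holder_mult locally_holder_powr locally_holder_sum
            locally_holder_const hu hub hubc pos N b)
    qed (simp add: f_def product_rhs_partial[OF op C2 pos nz _ b])
    then show ?thesis by (rule rep_on_C2[OF op rb cub])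
  qed
  then have "Ck_on (Suc 2) \<Omega> u" unfolding Ck_on.simps(2)[of 2] using Ck_on_differentiable[OF C2'] by blast
  then show "Ck_on 3 \<Omega> u" by (simp only: numeral_3_eq_3 numeral_2_eq_2)
qed

section \<open>Bernstein estimate\<close>

text \<open>Cauchy--Schwarz for \<open>H\<close> against the projection \<open>I - w \<otimes> w / h\<close>, whose squared norm is \<open>card I - 1\<close>;
  using the projection instead of \<open>I\<close> is what makes the exponent \<open>(N + 3) / (N - 1)\<close> appear.\<close>

lemma trace_defect_bound:
  fixes H :: "'i \<Rightarrow> 'i \<Rightarrow> real" and w :: "'i \<Rightarrow> real"
  assumes "finite I" "h = (\<Sum>b\<in>I. (w b)\<^sup>2)" "h > 0"
  shows "((\<Sum>b\<in>I. H b b) - (\<Sum>b\<in>I. \<Sum>c\<in>I. H b c * w b * w c) / h)\<^sup>2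
      \<le> (real (card I) - 1) * (\<Sum>b\<in>I. \<Sum>c\<in>I. (H b c)\<^sup>2)"
proof -
  define e where "e b c = (if b = c then 1 else 0) - w b * w c / h" for b c
  have s: "(\<Sum>c\<in>I. if b = c then g c else 0) = g b" if "b \<in> I" for b and g :: "'i \<Rightarrow> real"
    using assms(1) that by simp
  have 1: "(\<Sum>b\<in>I. \<Sum>c\<in>I. H b c * e b c) = (\<Sum>b\<in>I. H b b) - (\<Sum>b\<in>I. \<Sum>c\<in>I. H b c * w b * w c) / h"
  proof -
    have "(\<Sum>b\<in>I. \<Sum>c\<in>I. H b c * e b c) = (\<Sum>b\<in>I. \<Sum>c\<in>I. (if b = c then H b c else 0) - H b c * w b * w c / h)"
      by (intro sum.cong refl) (simp add: e_def algebra_simps)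
    also have "\<dots> = (\<Sum>b\<in>I. H b b) - (\<Sum>b\<in>I. \<Sum>c\<in>I. H b c * w b * w c / h)"
      by (simp add: sum_subtractf s)
    finally show ?thesis by (simp add: sum_divide_distrib)
  qed
  have 2: "(\<Sum>b\<in>I. \<Sum>c\<in>I. (e b c)\<^sup>2) = real (card I) - 1"
  proof -
    have "(\<Sum>b\<in>I. \<Sum>c\<in>I. (e b c)\<^sup>2) = (\<Sum>b\<in>I. \<Sum>c\<in>I. (if b = c then 1 - 2 * (w b * w c) / h else 0) + (w b)\<^sup>2 * (w c)\<^sup>2 / h\<^sup>2)"
      by (intro sum.cong refl) (simp add: e_def power2_eq_square algebra_simps)
    also have "\<dots> = (\<Sum>b\<in>I. 1 - 2 * (w b * w b) / h) + (\<Sum>b\<in>I. \<Sum>c\<in>I. (w b)\<^sup>2 * (w c)\<^sup>2 / h\<^sup>2)"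
      by (simp add: sum.distrib s)
    also have "(\<Sum>b\<in>I. 1 - 2 * (w b * w b) / h) = real (card I) - 2 * (h / h)"
    proof -
      have "(\<Sum>b\<in>I. w b * w b) = h" by (simp add: assms(2) power2_eq_square)
      then show ?thesis by (simp add: sum_subtractf flip: sum_distrib_left sum_divide_distrib)
    qed
    also have "(\<Sum>b\<in>I. \<Sum>c\<in>I. (w b)\<^sup>2 * (w c)\<^sup>2 / h\<^sup>2) = (h * h) / h\<^sup>2"
      by (simp add: assms(2) sum_product sum_divide_distrib)
    finally show ?thesis using assms(3) by (simp add: power2_eq_square)
  qed
  have "(\<Sum>(b, c)\<in>I \<times> I. H b c * e b c)\<^sup>2 \<le> (\<Sum>(b, c)\<in>I \<times> I. (H b c)\<^sup>2) * (\<Sum>(b, c)\<in>I \<times> I. (e b c)\<^sup>2)"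
    using Cauchy_Schwarz_ineq_sum[of "\<lambda>(b, c). H b c" "\<lambda>(b, c). e b c" "I \<times> I"]
    by (simp add: case_prod_unfold)
  then show ?thesis
    unfolding sum.cartesian_product[symmetric] 1 2 by (simp add: mult.commute)
qed

text \<open>In the application \<open>a = \<langle>\<nabla>v, \<nabla>\<zeta>\<rangle>\<close>, \<open>g = |\<nabla>\<zeta>|\<^sup>2\<close>, \<open>HS = |D\<^sup>2v|\<^sup>2\<close>, and \<open>-a/\<zeta>\<close> is \<open>D\<^sup>2v(\<nabla>v, \<nabla>v)/h\<close>
  at a maximum point of \<open>\<zeta>\<^sup>2 h\<close>; \<open>mx\<close> is the second-order condition there after Bochner's formula.\<close>

lemma cheng_yau_algebra:
  fixes n q s F h \<zeta> \<kappa> a g HS :: real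
  assumes n: "n \<ge> 2" and th: "0 < \<theta>" "\<theta> \<le> 1" "(n - 1) * s \<le> 4 * (1 - \<theta>)"
    and pos: "F \<ge> 0" "h > 0" "0 < \<zeta>" "\<zeta> \<le> 1" "\<kappa> > 0"
    and a: "\<bar>a\<bar> \<le> 2 * \<kappa> * sqrt h" and g: "g \<le> 4 * \<kappa>\<^sup>2"
    and CS: "(- (F + h) - (- a / \<zeta>))\<^sup>2 \<le> (n - 1) * HS"
    and mx: "\<zeta>\<^sup>2 * (2 * HS + 2 * (- (s * F * h) + q * F * a / \<zeta> + 2 * h * a / \<zeta>)) \<le> h * (6 * g + 4 * n * \<zeta> * \<kappa>\<^sup>2)"
  shows "\<zeta> * sqrt h \<le> max 1 ((2 * (2 + (n - 1) * (\<bar>q\<bar> + 2)) + (n - 1) * (12 + 2 * n)) / \<theta>) * \<kappa>"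
proof -
  \<comment> \<open>Multiplying by powers of \<zeta> removes all divisions: the first hypothesis is
    used times \<zeta>^4, the second-order condition times \<zeta>^2. In these quantities Z = m^2
    and A is at most of order \<kappa> m.\<close>
  define Y where "Y = \<zeta>\<^sup>2 * F" define Z where "Z = \<zeta>\<^sup>2 * h" define A where "A = \<zeta> * a"
  define m where "m = \<zeta> * sqrt h"
  define T where "T = Y + Z"
  have m: "m > 0" "m\<^sup>2 = Z" using pos by (auto simp: m_def Z_def power_mult_distrib)
  have YZ: "Y \<ge> 0" "Z > 0" using pos by (simp_all add: Y_def Z_def)
  then have "Y \<le> T" "Z \<le> T" "T > 0" unfolding T_def by linarith+
  note YZ = YZ this
  have A: "\<bar>A\<bar> \<le> 2 * \<kappa> * m"
    using mult_left_mono[OF a, of \<zeta>] pos by (simp add: A_def m_def abs_mult mult_ac)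
  have CS4: "(T - A)\<^sup>2 \<le> (n - 1) * (\<zeta> ^ 4 * HS)"
  proof -
    have "(T - A)\<^sup>2 = \<zeta> ^ 4 * (- (F + h) - (- a / \<zeta>))\<^sup>2"
      using pos by (simp add: T_def Y_def Z_def A_def field_simps power2_eq_square power4_eq_xxxx)
    also have "\<dots> \<le> \<zeta> ^ 4 * ((n - 1) * HS)" using CS pos by (intro mult_left_mono) auto
    finally show ?thesis by (simp add: mult_ac)
  qed
  have "\<zeta>\<^sup>2 * (\<zeta>\<^sup>2 * (2 * HS + 2 * (- (s * F * h) + q * F * a / \<zeta> + 2 * h * a / \<zeta>))) \<le> \<zeta>\<^sup>2 * (h * (6 * g + 4 * n * \<zeta> * \<kappa>\<^sup>2))"
    using mx pos by (intro mult_left_mono) auto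
  also have "\<zeta>\<^sup>2 * (\<zeta>\<^sup>2 * (2 * HS + 2 * (- (s * F * h) + q * F * a / \<zeta> + 2 * h * a / \<zeta>))) =
      2 * (\<zeta> ^ 4 * HS) + 2 * (- (s * Y * Z) + q * Y * A + 2 * Z * A)"
    using pos by (simp add: Y_def Z_def A_def field_simps power2_eq_square power4_eq_xxxx)
  also have "\<zeta>\<^sup>2 * (h * (6 * g + 4 * n * \<zeta> * \<kappa>\<^sup>2)) = Z * (6 * g + 4 * n * \<zeta> * \<kappa>\<^sup>2)" by (simp add: Z_def)
  \<comment> \<open>After division by 2 the coefficient 24 + 4 n becomes the 12 + 2 n of the final
    constant.\<close>
  also have "\<dots> \<le> Z * (6 * (4 * \<kappa>\<^sup>2) + 4 * n * 1 * \<kappa>\<^sup>2)"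
    using g pos n YZ by (intro mult_left_mono add_mono mult_right_mono) auto
  finally have HS: "\<zeta> ^ 4 * HS \<le> s * Y * Z - (q * Y + 2 * Z) * A + Z * (12 + 2 * n) * \<kappa>\<^sup>2"
    by (simp add: algebra_simps)
  have qA: "- ((q * Y + 2 * Z) * A) \<le> (\<bar>q\<bar> + 2) * T * (2 * \<kappa> * m)"
  proof -
    have "\<bar>q * Y + 2 * Z\<bar> \<le> \<bar>q\<bar> * Y + 2 * Z"
      using YZ abs_triangle_ineq[of "q * Y" "2 * Z"] by (simp add: abs_mult)
    also have "\<dots> \<le> \<bar>q\<bar> * T + 2 * T" using YZ by (intro add_mono mult_left_mono) simp_all
    finally have B: "\<bar>q * Y + 2 * Z\<bar> \<le> (\<bar>q\<bar> + 2) * T" by (simp add: distrib_right)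
    have "- ((q * Y + 2 * Z) * A) \<le> \<bar>q * Y + 2 * Z\<bar> * \<bar>A\<bar>" by (metis abs_ge_minus_self abs_mult)
    also have "\<dots> \<le> ((\<bar>q\<bar> + 2) * T) * (2 * \<kappa> * m)"
      using YZ by (intro mult_mono A B) simp_all
    finally show ?thesis .
  qed
  have Zk: "Z * (12 + 2 * n) * \<kappa>\<^sup>2 \<le> T * (12 + 2 * n) * \<kappa>\<^sup>2"
    using YZ n by (intro mult_right_mono) auto
  have "(T - A)\<^sup>2 \<le> (n - 1) * (s * Y * Z + (\<bar>q\<bar> + 2) * T * (2 * \<kappa> * m) + T * (12 + 2 * n) * \<kappa>\<^sup>2)"
  proof (rule order_trans[OF CS4], rule mult_left_mono)
    show "\<zeta> ^ 4 * HS \<le> s * Y * Z + (\<bar>q\<bar> + 2) * T * (2 * \<kappa> * m) + T * (12 + 2 * n) * \<kappa>\<^sup>2"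
      using HS qA Zk by linarith
  qed (use n in simp)
  also have "\<dots> = (n - 1) * s * (Y * Z) + T * ((n - 1) * (\<bar>q\<bar> + 2) * (2 * \<kappa> * m) + (n - 1) * (12 + 2 * n) * \<kappa>\<^sup>2)"
    by (simp add: algebra_simps)
  \<comment> \<open>The only use of the bound on s: combined with 4 Y Z \<le> (Y + Z)^2 it leaves a
    fraction \<theta> of T^2 to absorb the remaining terms.\<close>
  also have "(n - 1) * s * (Y * Z) \<le> (1 - \<theta>) * T\<^sup>2"
  proof -
    have "(n - 1) * s * (Y * Z) \<le> 4 * (1 - \<theta>) * (Y * Z)" using th(3) YZ by (intro mult_right_mono) auto
    also have "\<dots> = (1 - \<theta>) * (4 * (Y * Z))" by simp
    also have "\<dots> \<le> (1 - \<theta>) * T\<^sup>2"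
    proof (rule mult_left_mono)
      have "0 \<le> (Y - Z)\<^sup>2" by simp
      then show "4 * (Y * Z) \<le> T\<^sup>2" by (simp add: T_def power2_eq_square algebra_simps)
    qed (use th in simp)
    finally show ?thesis .
  qed
  finally have 1: "(T - A)\<^sup>2 \<le> (1 - \<theta>) * T\<^sup>2 + T * ((n - 1) * (\<bar>q\<bar> + 2) * (2 * \<kappa> * m) + (n - 1) * (12 + 2 * n) * \<kappa>\<^sup>2)"
    by simp
  have "T\<^sup>2 - 2 * (T * (2 * \<kappa> * m)) \<le> (T - A)\<^sup>2"
  proof -
    have "T * A \<le> T * (2 * \<kappa> * m)" using A YZ by (intro mult_left_mono) auto
    moreover have "(T - A)\<^sup>2 = T\<^sup>2 - 2 * (T * A) + A\<^sup>2" by (simp add: power2_eq_square algebra_simps)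
    moreover have "0 \<le> A\<^sup>2" by simp
    ultimately show ?thesis by linarith
  qed
  with 1 have "T * (\<theta> * T) \<le> T * ((2 * (2 + (n - 1) * (\<bar>q\<bar> + 2))) * \<kappa> * m + (n - 1) * (12 + 2 * n) * \<kappa>\<^sup>2)"
    by (simp add: power2_eq_square algebra_simps)
  then have "\<theta> * T \<le> (2 * (2 + (n - 1) * (\<bar>q\<bar> + 2))) * \<kappa> * m + (n - 1) * (12 + 2 * n) * \<kappa>\<^sup>2"
    using YZ by simp
  moreover have "\<theta> * m\<^sup>2 \<le> \<theta> * T" using m YZ th by simp
  ultimately have fin: "\<theta> * m\<^sup>2 \<le> (2 * (2 + (n - 1) * (\<bar>q\<bar> + 2))) * \<kappa> * m + (n - 1) * (12 + 2 * n) * \<kappa>\<^sup>2" by linarith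
  define C where "C = 2 * (2 + (n - 1) * (\<bar>q\<bar> + 2)) + (n - 1) * (12 + 2 * n)"
  have "m \<le> max 1 (C / \<theta>) * \<kappa>"
  \<comment> \<open>\<open>fin\<close> is quadratic in m. Beyond \<kappa> the term \<kappa>^2 is at
    most \<kappa> m and a factor m cancels; the other case accounts for the 1 in the
    maximum.\<close>
  proof (cases "m \<le> \<kappa>")
    case True
    also have "\<kappa> \<le> max 1 (C / \<theta>) * \<kappa>" using pos by simp
    finally show ?thesis .
  next
    case False
    have "(n - 1) * (12 + 2 * n) * \<kappa>\<^sup>2 \<le> (n - 1) * (12 + 2 * n) * (\<kappa> * m)"
      unfolding power2_eq_square using False pos n by (intro mult_left_mono) auto
    with fin have "\<theta> * m\<^sup>2 \<le> C * (\<kappa> * m)" by (simp add: C_def algebra_simps)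
    then have "m * (\<theta> * m) \<le> m * (C * \<kappa>)" by (simp add: power2_eq_square mult_ac)
    then have "\<theta> * m \<le> C * \<kappa>" using m by simp
    then have "m \<le> (C / \<theta>) * \<kappa>" using th by (simp add: field_simps)
    also have "\<dots> \<le> max 1 (C / \<theta>) * \<kappa>" using pos by (intro mult_right_mono) auto
    finally show ?thesis .
  qed
  then show ?thesis by (simp add: m_def C_def)
qed

section \<open>Bochner's formula at a maximum point\<close>

text \<open>The first-order condition for \<zeta>^2 h expresses \<nabla>h by \<nabla>\<zeta>, the
  second-order condition summed over directions bounds \<Delta>h, and Bochner's formula evaluates
  \<Delta>h. What remains is \<open>cheng_yau_algebra\<close> with \<kappa> = 1/R.\<close>

lemma bernstein_at_max:
  fixes v :: "'a::euclidean_space \<Rightarrow> real"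
  defines "h \<equiv> \<lambda>x. \<Sum>c\<in>Basis. (gradient v x \<bullet> c)\<^sup>2"
    and "n \<equiv> real DIM('a)"
  assumes n: "n \<ge> 2" and th: "0 < \<theta>" "\<theta> \<le> 1" "(n - 1) * s \<le> 4 * (1 - \<theta>)"
    and U: "open U" "Ck_on 3 U v" "x \<in> U" "\<And>y. y \<in> U \<Longrightarrow> h y > 0"
    and lap: "\<And>y. y \<in> U \<Longrightarrow> (\<Sum>b\<in>Basis. gradient (\<lambda>y. gradient v y \<bullet> b) y \<bullet> b) =
      - (exp (s * v y) * h y powr (q / 2) + h y)"
    and R: "R > 0"
  defines "\<zeta> \<equiv> \<lambda>x. 1 - (x \<bullet> x) / R\<^sup>2"
  assumes max: "\<And>y. y \<in> U \<Longrightarrow> (\<zeta> y)\<^sup>2 * h y \<le> (\<zeta> x)\<^sup>2 * h x" and zpos: "\<zeta> x > 0"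
  shows "\<zeta> x * sqrt (h x) \<le> max 1 ((2 * (2 + (n - 1) * (\<bar>q\<bar> + 2)) + (n - 1) * (12 + 2 * n)) / \<theta>) * (1 / R)"
proof -
  \<comment> \<open>Later indices are later derivatives: \<open>vbb b c\<close> is the derivative of
    \<open>vb b\<close> in direction c.\<close>
  define vb where "vb b y = gradient v y \<bullet> b" for b y
  define vbb where "vbb b c y = gradient (vb b) y \<bullet> c" for b c y
  define vbbb where "vbbb b c d y = gradient (vbb b c) y \<bullet> d" for b c d y
  define F where "F y = exp (s * v y) * h y powr (q / 2)" for y
  have C3: "Ck_on (Suc 2) U v" using U(2) by (simp add: numeral_3_eq_3 numeral_2_eq_2)
  have C2b: "Ck_on 2 U (vb b)" if "b \<in> Basis" for b
    unfolding vb_def[abs_def] by (rule Ck_on_partial[OF C3 that])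
  have C2b': "Ck_on (Suc 1) U (vb b)" if "b \<in> Basis" for b
    using C2b[OF that] by (simp add: numeral_2_eq_2)
  have C1bb: "Ck_on 1 U (vbb b c)" if "b \<in> Basis" "c \<in> Basis" for b c
    unfolding vbb_def[abs_def] by (rule Ck_on_partial[OF C2b'[OF that(1)] that(2)])
  have C1bb': "Ck_on (Suc 0) U (vbb b c)" if "b \<in> Basis" "c \<in> Basis" for b c
    using C1bb[OF that] by simp
  have h_eq: "h y = (\<Sum>c\<in>Basis. vb c y * vb c y)" for y
    by (simp add: h_def vb_def power2_eq_square)
  have C2h: "Ck_on (Suc 1) U h"
    unfolding h_eq[abs_def] using U(1) by (intro Ck_on_sum Ck_on_mult C2b') 
  have dv: "((\<lambda>t. v (y + t *\<^sub>R b)) has_real_derivative vb b y) (at 0)" if "y \<in> U" for y b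
    unfolding vb_def by (rule partial_line_derivative[OF Ck_on_differentiable[OF C3 that]])
  have dvb: "((\<lambda>t. vb c (y + t *\<^sub>R b)) has_real_derivative vbb c b y) (at 0)" if "y \<in> U" "c \<in> Basis" for y b c
    unfolding vbb_def by (rule partial_line_derivative[OF Ck_on_differentiable[OF C2b'[OF that(2)] that(1)]])
  have dvbb: "((\<lambda>t. vbb c d (y + t *\<^sub>R b)) has_real_derivative vbbb c d b y) (at 0)"
    if "y \<in> U" "c \<in> Basis" "d \<in> Basis" for y b c d
    unfolding vbbb_def by (rule partial_line_derivative[OF Ck_on_differentiable[OF C1bb'[OF that(2,3)] that(1)]])
  define hb where "hb b y = (\<Sum>c\<in>Basis. 2 * (vb c y * vbb c b y))" for b y
  have dh: "((\<lambda>t. h (y + t *\<^sub>R b)) has_real_derivative hb b y) (at 0)" if "y \<in> U" for y b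
    unfolding h_eq hb_def
  proof (rule DERIV_sum)
    fix c :: 'a assume c: "c \<in> Basis"
    show "((\<lambda>t. vb c (y + t *\<^sub>R b) * vb c (y + t *\<^sub>R b)) has_real_derivative 2 * (vb c y * vbb c b y)) (at 0)"
      by (rule DERIV_cong[OF DERIV_mult[OF dvb[OF that c] dvb[OF that c]]]) simp
  qed
  define hbb where "hbb b = (\<Sum>c\<in>Basis. 2 * ((vbb c b x)\<^sup>2 + vb c x * vbbb c b b x))" for b
  have dhb: "((\<lambda>t. hb b (x + t *\<^sub>R b)) has_real_derivative hbb b) (at 0)" if "b \<in> Basis" for b
    unfolding hb_def hbb_def
  proof (rule DERIV_sum)
    fix c :: 'a assume c: "c \<in> Basis"
    show "((\<lambda>t. 2 * (vb c (x + t *\<^sub>R b) * vbb c b (x + t *\<^sub>R b))) has_real_derivative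
        2 * ((vbb c b x)\<^sup>2 + vb c x * vbbb c b b x)) (at 0)"
      by (rule DERIV_cong[OF DERIV_cmult[OF DERIV_mult[OF dvb[OF U(3) c] dvbb[OF U(3) c that]]]])
        (simp add: power2_eq_square)
  qed
  define zb where "zb b y = - 2 * (y \<bullet> b) / R\<^sup>2" for b y :: 'a
  have dz: "((\<lambda>t. \<zeta> (y + t *\<^sub>R b)) has_real_derivative zb b y) (at 0)" if "b \<in> Basis" for y b
  proof -
    have eq: "(\<lambda>t. \<zeta> (y + t *\<^sub>R b)) = (\<lambda>t. 1 - (1 / R\<^sup>2) * (y \<bullet> y + t * (2 * (y \<bullet> b)) + t * t * (b \<bullet> b)))"
      by (simp add: fun_eq_iff \<zeta>_def inner_add_left inner_add_right inner_commute add_divide_distrib algebra_simps)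
    show ?thesis
      unfolding eq zb_def using R
      by (auto intro!: derivative_eq_intros simp: power2_eq_square power4_eq_xxxx)
  qed
  have dzb: "((\<lambda>t. zb b (y + t *\<^sub>R b)) has_real_derivative - 2 / R\<^sup>2) (at 0)" if "b \<in> Basis" for y b
    unfolding zb_def using that R
    by (auto intro!: derivative_eq_intros simp: inner_add_left power2_eq_square power4_eq_xxxx)
  have "Ck_on 2 U (\<lambda>y. y \<bullet> y)"
  proof -
    have "(\<lambda>y. y \<bullet> y) = (\<lambda>y::'a. \<Sum>b\<in>Basis. (y \<bullet> b) * (y \<bullet> b))" by (rule ext) (rule euclidean_inner)
    moreover have "Ck_on 2 U (\<lambda>y. \<Sum>b\<in>Basis. (y \<bullet> b) * (y \<bullet> b))"
      using U(1) by (intro Ck_on_sum Ck_on_mult Ck_on_inner_const)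
    ultimately show ?thesis by simp
  qed
  then have C2z: "Ck_on 2 U \<zeta>"
    unfolding \<zeta>_def using Ck_on_add[OF U(1) Ck_on_const[OF U(1), of 2 1] Ck_on_cmult[OF U(1), of 2 "\<lambda>y. y \<bullet> y" "- (1 / R\<^sup>2)"]]
    by simp
  define G where "G y = (\<zeta> y)\<^sup>2 * h y" for y
  have C2G: "Ck_on 2 U G"
    unfolding G_def[abs_def] power2_eq_square
    using C2h U(1) C2z by (intro Ck_on_mult) (simp_all add: numeral_2_eq_2)
  have C2G': "Ck_on (Suc 1) U G" using C2G by (simp add: numeral_2_eq_2)
  define gb where "gb b y = 2 * (\<zeta> y * zb b y) * h y + (\<zeta> y)\<^sup>2 * hb b y" for b y
  have gG: "gradient G y \<bullet> b = gb b y" if "y \<in> U" "b \<in> Basis" for y b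
  proof (rule partial_eqI[OF Ck_on_differentiable[OF C2G' that(1)]])
    show "((\<lambda>t. G (y + t *\<^sub>R b)) has_real_derivative gb b y) (at 0)"
      unfolding G_def gb_def power2_eq_square
      by (rule DERIV_cong[OF DERIV_mult[OF DERIV_mult[OF dz[OF that(2)] dz[OF that(2)]] dh[OF that(1)]]])
        (simp add: algebra_simps)
  qed
  have max': "\<And>y. y \<in> U \<Longrightarrow> G y \<le> G x" using max by (simp add: G_def)
  define gbb where "gbb b = 2 * ((zb b x)\<^sup>2 + \<zeta> x * (- 2 / R\<^sup>2)) * h x + 4 * (\<zeta> x * zb b x) * hb b x + (\<zeta> x)\<^sup>2 * hbb b" for b
  have gbb: "gbb b \<le> 0" if b: "b \<in> Basis" for b
  proof -
    have "gradient (\<lambda>y. gradient G y \<bullet> b) x \<bullet> b = gbb b"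
    proof (rule partial_eqI)
      show "(\<lambda>y. gradient G y \<bullet> b) differentiable (at x)"
        using Ck_on_partial[OF C2G' b] U(3) by simp
      have "((\<lambda>t. gb b (x + t *\<^sub>R b)) has_real_derivative gbb b) (at 0)"
        unfolding gb_def gbb_def power2_eq_square
        by (rule DERIV_cong[OF DERIV_add[OF
                DERIV_mult[OF DERIV_cmult[OF DERIV_mult[OF dz[OF b] dzb[OF b]]] dh[OF U(3)]]
                DERIV_mult[OF DERIV_mult[OF dz[OF b] dz[OF b]] dhb[OF b]]]])
          (simp add: algebra_simps power2_eq_square)
      then show "((\<lambda>t. gradient G (x + t *\<^sub>R b) \<bullet> b) has_real_derivative gbb b) (at 0)"
      \<comment> \<open>\<open>gG\<close> holds only in \<open>U\<close>, so the two functions of t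
        are known to agree only near 0.\<close>
      proof (rule DERIV_cong_ev[THEN iffD1, rotated -1])
        have "eventually (\<lambda>t. x + t *\<^sub>R b \<in> U) (nhds 0)"
        proof -
          have "((\<lambda>t. x + t *\<^sub>R b) \<longlongrightarrow> x + 0 *\<^sub>R b) (nhds 0)" by (intro tendsto_intros filterlim_ident)
          then show ?thesis using U(1,3) by (simp add: topological_tendstoD)
        qed
        then show "eventually (\<lambda>t. gb b (x + t *\<^sub>R b) = gradient G (x + t *\<^sub>R b) \<bullet> b) (nhds 0)"
          by eventually_elim (simp add: gG b)
      qed simp_all
    qed
    then show ?thesis using second_derivative_nonpos_at_max(2)[OF U(1) C2G U(3) max' b] by simp
  qed
  \<comment> \<open>First-order condition: \<zeta> \<nabla>h = -2 h \<nabla>\<zeta> at x. It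
    eliminates the derivatives of h from all estimates below.\<close>
  have g0: "\<zeta> x * hb b x = - 2 * zb b x * h x" if b: "b \<in> Basis" for b
  proof -
    have "gb b x = 0"
      using second_derivative_nonpos_at_max(1)[OF U(1) C2G U(3) max' b] gG[OF U(3) b] by simp
    then have "\<zeta> x * (\<zeta> x * hb b x + 2 * zb b x * h x) = 0"
      by (simp add: gb_def power2_eq_square algebra_simps)
    then show ?thesis using zpos by simp
  qed
  define g where "g = (\<Sum>b\<in>Basis. (zb b x)\<^sup>2)"
  define HS where "HS = (\<Sum>b\<in>Basis. \<Sum>c\<in>Basis. (vbb b c x)\<^sup>2)"
  define a where "a = (\<Sum>b\<in>Basis. vb b x * zb b x)"
  have hx: "h x > 0" by (rule U(4)[OF U(3)])
  have sym: "vbb b c y = vbb c b y" if "y \<in> U" "b \<in> Basis" "c \<in> Basis" for y b c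
    using second_derivatives_symmetric[OF U(1) Ck_on_mono[OF U(2), of 2] that]
    by (simp add: vbb_def vb_def[abs_def])
  have vh: "\<zeta> x * (\<Sum>b\<in>Basis. vb b x * hb b x) = - 2 * a * h x"
  proof -
    have "\<zeta> x * (\<Sum>b\<in>Basis. vb b x * hb b x) = (\<Sum>b\<in>Basis. vb b x * (\<zeta> x * hb b x))"
      by (simp add: sum_distrib_left mult_ac)
    also have "\<dots> = (\<Sum>b\<in>Basis. vb b x * (- 2 * zb b x * h x))" using g0 by simp
    also have "\<dots> = - 2 * a * h x" by (simp add: a_def sum_distrib_left sum_distrib_right sum_negf mult_ac)
    finally show ?thesis .
  qed
  have vh': "(\<Sum>b\<in>Basis. vb b x * hb b x) = - 2 * a * h x / \<zeta> x"
    using vh zpos by (simp add: field_simps)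
  have CS: "(- (F x + h x) - (- a / \<zeta> x))\<^sup>2 \<le> (n - 1) * HS"
  proof -
    \<comment> \<open>D^2 v applied twice to \<nabla>v is half the inner product of \<nabla>v and
      \<nabla>h, which \<open>vh'\<close> expresses by a.\<close>
    have "(\<Sum>b\<in>Basis. \<Sum>c\<in>Basis. vbb b c x * vb b x * vb c x) = (\<Sum>c\<in>Basis. vb c x * hb c x) / 2"
    proof -
      have "(\<Sum>c\<in>Basis. vb c x * hb c x) = (\<Sum>c\<in>Basis. \<Sum>b\<in>Basis. 2 * (vbb b c x * vb b x * vb c x))"
        by (simp add: hb_def sum_distrib_left mult_ac)
      also have "\<dots> = 2 * (\<Sum>b\<in>Basis. \<Sum>c\<in>Basis. vbb b c x * vb b x * vb c x)"
        by (subst sum.swap) (simp add: sum_distrib_left)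
      finally show ?thesis by simp
    qed
    also have "\<dots> = (- a / \<zeta> x) * h x" using vh' by simp
    finally have "(\<Sum>b\<in>Basis. \<Sum>c\<in>Basis. vbb b c x * vb b x * vb c x) / h x = - a / \<zeta> x"
      using hx by simp
    moreover have "(\<Sum>b\<in>Basis. vbb b b x) = - (F x + h x)"
      using lap[OF U(3)] by (simp add: vbb_def vb_def[abs_def] F_def)
    ultimately show ?thesis
      using trace_defect_bound[OF finite_Basis, of "h x" "\<lambda>b. vb b x" "\<lambda>b c. vbb b c x"] hx
      by (simp add: h_def vb_def n_def HS_def)
  qed
  \<comment> \<open>The equation for \<Delta>v differentiated in direction c. Two exchanges bring c
    to the last place, one for v on all of \<open>U\<close> and one for the first derivative
    \<open>vb b\<close> at x; this is where v must be C^3.\<close>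
  have third: "(\<Sum>b\<in>Basis. vbbb c b b x) = - (F x * (s * vb c x + (q / 2) * hb c x / h x) + hb c x)"
    if c: "c \<in> Basis" for c
  proof -
    have swap: "vbbb c b b x = vbbb b b c x" if b: "b \<in> Basis" for b
    proof -
      have "vbbb c b b x = gradient (vbb b c) x \<bullet> b"
        unfolding vbbb_def using gradient_cong_open[OF U(1,3), of "vbb c b" "vbb b c"] sym[OF _ c b] by simp
      also have "\<dots> = gradient (vbb b b) x \<bullet> c"
        using second_derivatives_symmetric[OF U(1) C2b[OF b] U(3) c b] by (simp add: vbb_def[abs_def])
      finally show ?thesis by (simp add: vbbb_def)
    qed
    have "((\<lambda>t. \<Sum>b\<in>Basis. vbb b b (x + t *\<^sub>R c)) has_real_derivative (\<Sum>b\<in>Basis. vbbb b b c x)) (at 0)"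
      by (intro DERIV_sum dvbb U(3))
    moreover have "((\<lambda>t. \<Sum>b\<in>Basis. vbb b b (x + t *\<^sub>R c)) has_real_derivative
        - (F x * (s * vb c x + (q / 2) * hb c x / h x) + hb c x)) (at 0)"
    proof (rule DERIV_cong_ev[THEN iffD1, rotated -1])
      have e: "h x powr (q / 2 - 1) = h x powr (q / 2) / h x" using hx by (simp add: powr_diff)
      have pw: "((\<lambda>t. h (x + t *\<^sub>R c) powr (q / 2)) has_real_derivative (q / 2) * h (x + 0 *\<^sub>R c) powr (q / 2 - 1) * hb c x) (at 0)"
        by (rule DERIV_chain2[OF has_real_derivative_powr dh[OF U(3)]]) (use hx in simp)
      have ex: "((\<lambda>t. exp (s * v (x + t *\<^sub>R c))) has_real_derivative exp (s * v (x + 0 *\<^sub>R c)) * (s * vb c x)) (at 0)"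
        by (intro DERIV_fun_exp DERIV_cmult dv U(3))
      show "((\<lambda>t. - (F (x + t *\<^sub>R c) + h (x + t *\<^sub>R c))) has_real_derivative
          - (F x * (s * vb c x + (q / 2) * hb c x / h x) + hb c x)) (at 0)"
        unfolding F_def
        by (rule DERIV_cong[OF DERIV_minus[OF DERIV_add[OF DERIV_mult[OF ex pw] dh[OF U(3)]]]])
          (simp add: e algebra_simps)
      have "eventually (\<lambda>t. x + t *\<^sub>R c \<in> U) (nhds 0)"
      proof -
        have "((\<lambda>t. x + t *\<^sub>R c) \<longlongrightarrow> x + 0 *\<^sub>R c) (nhds 0)" by (intro tendsto_intros filterlim_ident)
        then show ?thesis using U(1,3) by (simp add: topological_tendstoD)
      qed
      then show "eventually (\<lambda>t. - (F (x + t *\<^sub>R c) + h (x + t *\<^sub>R c)) = (\<Sum>b\<in>Basis. vbb b b (x + t *\<^sub>R c))) (nhds 0)"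
      proof eventually_elim
        case (elim t)
        show ?case using lap[OF elim] by (simp add: F_def vbb_def vb_def[abs_def])
      qed
    qed simp_all
    ultimately have "(\<Sum>b\<in>Basis. vbbb b b c x) = - (F x * (s * vb c x + (q / 2) * hb c x / h x) + hb c x)"
      by (rule DERIV_unique)
    then show ?thesis using swap by simp
  qed
  \<comment> \<open>Bochner's formula: half of \<Delta>h is |D^2 v|^2 plus the inner product of
    \<nabla>v and \<nabla>\<Delta>v. The latter comes from \<open>third\<close>, with \<nabla>h
    removed by \<open>vh'\<close>.\<close>
  have Dh: "(\<Sum>b\<in>Basis. hbb b) = 2 * HS + 2 * (- (s * F x * h x) + q * F x * a / \<zeta> x + 2 * h x * a / \<zeta> x)"
  proof -
    have "(\<Sum>b\<in>Basis. hbb b) = 2 * (\<Sum>b\<in>Basis. \<Sum>c\<in>Basis. (vbb c b x)\<^sup>2) + 2 * (\<Sum>b\<in>Basis. \<Sum>c\<in>Basis. vb c x * vbbb c b b x)"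
      by (simp add: hbb_def sum_distrib_left sum.distrib distrib_left)
    also have "(\<Sum>b\<in>Basis. \<Sum>c\<in>Basis. (vbb c b x)\<^sup>2) = HS"
      unfolding HS_def by (rule sum.swap)
    also have "(\<Sum>b\<in>Basis. \<Sum>c\<in>Basis. vb c x * vbbb c b b x) = (\<Sum>c\<in>Basis. vb c x * (\<Sum>b\<in>Basis. vbbb c b b x))"
      by (subst sum.swap) (simp add: sum_distrib_left)
    also have "\<dots> = (\<Sum>c\<in>Basis. vb c x * - (F x * (s * vb c x + (q / 2) * hb c x / h x) + hb c x))"
      using third by simp
    also have "\<dots> = (\<Sum>c\<in>Basis. - (s * F x) * (vb c x * vb c x) - (F x * (q / 2) / h x + 1) * (vb c x * hb c x))"
      by (intro sum.cong refl) (simp add: algebra_simps)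
    also have "\<dots> = - (s * F x) * h x - (F x * (q / 2) / h x + 1) * (\<Sum>c\<in>Basis. vb c x * hb c x)"
      by (simp add: h_eq sum_subtractf sum_distrib_left sum_negf)
    also have "\<dots> = - (s * F x * h x) + q * F x * a / \<zeta> x + 2 * h x * a / \<zeta> x"
      unfolding vh' using hx zpos by (simp add: field_simps)
    finally show ?thesis .
  qed
  have gval: "g = 4 * (x \<bullet> x) / R ^ 4"
  proof -
    have "g = (\<Sum>b\<in>Basis. (4 / R ^ 4) * ((x \<bullet> b) * (x \<bullet> b)))"
      unfolding g_def zb_def by (intro sum.cong refl) (simp add: power2_eq_square power4_eq_xxxx)
    also have "\<dots> = (4 / R ^ 4) * (x \<bullet> x)"
      by (subst (3) euclidean_inner) (simp add: sum_distrib_left)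
    finally show ?thesis by simp
  qed
  have xR: "x \<bullet> x \<le> R\<^sup>2" using zpos R by (simp add: \<zeta>_def field_simps)
  have gle: "g \<le> 4 * (1 / R)\<^sup>2"
    using xR R unfolding gval by (simp add: field_simps power2_eq_square power4_eq_xxxx)
  have z1: "\<zeta> x \<le> 1" by (simp add: \<zeta>_def)
  \<comment> \<open>By \<open>g0\<close> the mixed term 4 \<zeta> \<open>zb\<close>
    \<open>hb\<close> equals -8 \<open>zb\<close>^2 h, which with the 2 \<open>zb\<close>^2 h gives
    the 6; the term with n is the Laplacian of \<zeta>.\<close>
  have mx: "(\<zeta> x)\<^sup>2 * (\<Sum>b\<in>Basis. hbb b) \<le> h x * (6 * g + 4 * n * \<zeta> x * (1 / R)\<^sup>2)"
  proof -
    have "(\<Sum>b\<in>Basis. gbb b) \<le> 0" using gbb by (rule sum_nonpos)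
    moreover have "gbb b = - 6 * h x * (zb b x)\<^sup>2 - 4 * \<zeta> x * h x / R\<^sup>2 + (\<zeta> x)\<^sup>2 * hbb b" if "b \<in> Basis" for b
    proof -
      have "gbb b = 2 * (zb b x)\<^sup>2 * h x - 4 * \<zeta> x * h x / R\<^sup>2 + 4 * zb b x * (\<zeta> x * hb b x) + (\<zeta> x)\<^sup>2 * hbb b"
        by (simp add: gbb_def algebra_simps)
      then show ?thesis unfolding g0[OF that] by (simp add: power2_eq_square algebra_simps)
    qed
    ultimately have "(\<Sum>b\<in>(Basis::'a set). - 6 * h x * (zb b x)\<^sup>2 - 4 * \<zeta> x * h x / R\<^sup>2 + (\<zeta> x)\<^sup>2 * hbb b) \<le> 0"
      by simp
    then have "- 6 * h x * g - n * (4 * \<zeta> x * h x / R\<^sup>2) + (\<zeta> x)\<^sup>2 * (\<Sum>b\<in>Basis. hbb b) \<le> 0"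
      by (simp add: sum.distrib sum_subtractf sum_distrib_left g_def n_def sum_negf)
    then show ?thesis by (simp add: algebra_simps divide_inverse power_inverse)
  qed
  have ale: "\<bar>a\<bar> \<le> 2 * (1 / R) * sqrt (h x)"
  proof -
    have "a\<^sup>2 \<le> h x * g"
      using Cauchy_Schwarz_ineq_sum[of "\<lambda>b. vb b x" "\<lambda>b. zb b x" Basis] by (simp add: a_def h_eq g_def power2_eq_square)
    also have "\<dots> \<le> h x * (4 * (1 / R)\<^sup>2)" using gle hx by (intro mult_left_mono) auto
    also have "\<dots> = (2 * (1 / R) * sqrt (h x))\<^sup>2"
      using hx by (simp add: power_mult_distrib power_divide)
    finally show ?thesis using R hx by (simp add: abs_le_square_iff[symmetric])
  qed
  have F0: "F x \<ge> 0" by (simp add: F_def)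
  have R': "1 / R > 0" using R by simp
  show ?thesis
    by (rule cheng_yau_algebra[OF n th F0 hx zpos z1 R' ale gle CS mx[unfolded Dh]])
qed

section \<open>The gradient estimate on balls and its limit\<close>

text \<open>The estimate at a maximum point of \<zeta>^2 h bounds this function on the whole ball.
  The constant is chosen before R and depends only on the dimension, q and the margin
  \<theta>.\<close>

lemma positive_solution_log_gradient:
  fixes u :: "'a::euclidean_space \<Rightarrow> real"
  assumes sol: "positive_solution p q u" and n: "DIM('a) \<ge> 2"
    and pq: "p + q < (real DIM('a) + 3) / (real DIM('a) - 1)"
  obtains C where "C > 0"
    "\<And>R x. R > 0 \<Longrightarrow> norm x < R \<Longrightarrow>
       (1 - (x \<bullet> x) / R\<^sup>2) * sqrt (\<Sum>c\<in>Basis. (gradient (\<lambda>y. ln (u y)) x \<bullet> c)\<^sup>2) \<le> C * (1 / R)"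
proof -
  define \<Omega> where "\<Omega> = {x. gradient u x \<noteq> 0}"
  note reg = positive_solution_regular[OF sol \<Omega>_def]
  have C1: "Ck_on (Suc 0) UNIV u" and pos: "\<And>x. u x > 0"
    using sol by (auto simp: positive_solution_def C_class_iff_Ck_on)
  define v where "v x = ln (u x)" for x
  define h where "h x = (\<Sum>c\<in>Basis. (gradient v x \<bullet> c)\<^sup>2)" for x
  define N where "N = real DIM('a)"
  define s where "s = p + q - 1"
  have N: "N \<ge> 2" using n by (simp add: N_def)
  have dv: "(v has_derivative (\<lambda>k. k \<bullet> ((1 / u x) *\<^sub>R gradient u x))) (at x)" for x
    unfolding v_def[abs_def]
    by (rule has_derivative_compose_gradient[OF Ck_on_SucD'[OF C1 UNIV_I]])
      (rule DERIV_cong[OF DERIV_ln], use pos[of x] in \<open>simp_all add: divide_inverse\<close>)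
  have gv: "gradient v x = (1 / u x) *\<^sub>R gradient u x" for x
    by (rule has_derivative_gradientD(2)[OF dv])
  have C3: "Ck_on (Suc 2) \<Omega> u" using reg(2) by (simp only: numeral_3_eq_3 numeral_2_eq_2)
  have C2: "Ck_on 2 \<Omega> u" by (rule Ck_on_SucD[OF C3])
  have "Ck_on (Suc 2) \<Omega> v"
  proof (rule Ck_on_SucI[OF reg(1) dv])
    fix b :: 'a assume b: "b \<in> Basis"
    have "Ck_on 2 \<Omega> (\<lambda>x. u x powr - 1 * (gradient u x \<bullet> b))"
      by (intro Ck_on_mult Ck_on_powr reg(1) pos Ck_on_partial[OF C3 b] C2)
    then show "Ck_on 2 \<Omega> (\<lambda>x. (1 / u x) *\<^sub>R gradient u x \<bullet> b)"
      by (rule Ck_on_cong[OF reg(1), rotated]) (simp add: powr_minus_divide pos less_imp_le)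
  qed
  then have C3v: "Ck_on 3 \<Omega> v" by (simp only: numeral_3_eq_3 numeral_2_eq_2)
  have hN: "(\<Sum>c\<in>Basis. (gradient u x \<bullet> c) * (gradient u x \<bullet> c)) = (u x)\<^sup>2 * h x" for x
    using pos[of x] by (simp add: h_def gv sum_distrib_left power2_eq_square)
  have hpos: "h x > 0" if "x \<in> \<Omega>" for x
    using sum_partials_pos[of "gradient u x"] that pos[of x] unfolding hN \<Omega>_def
    by (simp add: zero_less_mult_iff)
  have hzero: "h x = 0" if "x \<notin> \<Omega>" for x
    using that by (simp add: h_def gv \<Omega>_def)
  \<comment> \<open>Continuity is needed across critical points as well, since the maximum is taken
    before it is known to lie in \<open>\<Omega>\<close>.\<close>
  have conth: "continuous_on UNIV h"
  proof -
    have "continuous_on UNIV u" "continuous_on UNIV (gradient u)"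
      using Ck_on_continuous[OF C1] Ck_on_continuous_gradient[OF C1] by simp_all
    then show ?thesis
      unfolding h_def[abs_def] gv using pos by (intro continuous_intros) (auto simp: less_imp_neq[symmetric])
  qed
  have lap: "(\<Sum>b\<in>Basis. gradient (\<lambda>y. gradient v y \<bullet> b) x \<bullet> b) = - (exp (s * v x) * h x powr (q / 2) + h x)"
    if x: "x \<in> \<Omega>" for x
  proof -
    have bb: "gradient (\<lambda>y. gradient v y \<bullet> b) x \<bullet> b =
       gradient (\<lambda>y. gradient u y \<bullet> b) x \<bullet> b / u x - (gradient v x \<bullet> b)\<^sup>2" if b: "b \<in> Basis" for b
    proof (rule partial_eqI)
      have "Ck_on (Suc 1) \<Omega> (\<lambda>y. gradient v y \<bullet> b)"
        using Ck_on_partial[OF \<open>Ck_on (Suc 2) \<Omega> v\<close> b] by (simp only: numeral_2_eq_2 One_nat_def)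
      then show "(\<lambda>y. gradient v y \<bullet> b) differentiable (at x)"
        using x by (rule Ck_on_differentiable)
      have "Ck_on (Suc 1) \<Omega> (\<lambda>y. gradient u y \<bullet> b)"
        using Ck_on_partial[OF C3 b] by (simp only: numeral_2_eq_2 One_nat_def)
      then have d1: "((\<lambda>t. gradient u (x + t *\<^sub>R b) \<bullet> b) has_real_derivative gradient (\<lambda>y. gradient u y \<bullet> b) x \<bullet> b) (at 0)"
        using x by (intro partial_line_derivative Ck_on_differentiable)
      have d2: "((\<lambda>t. u (x + t *\<^sub>R b)) has_real_derivative gradient u x \<bullet> b) (at 0)"
        by (rule partial_line_derivative[OF Ck_on_differentiable[OF C1 UNIV_I]])
      show "((\<lambda>t. gradient v (x + t *\<^sub>R b) \<bullet> b) has_real_derivative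
         gradient (\<lambda>y. gradient u y \<bullet> b) x \<bullet> b / u x - (gradient v x \<bullet> b)\<^sup>2) (at 0)"
        unfolding gv inner_scaleR_left
        using DERIV_divide[OF d1 d2] pos[of x]
        by (simp add: field_simps power2_eq_square)
    qed
    \<comment> \<open>Homogeneity: |\<nabla>u|^2 = u^2 h, so dividing by u leaves u^(p+q-1)
      h^(q/2).\<close>
    have "product_rhs p q u x / u x = exp (s * v x) * h x powr (q / 2)"
    proof -
      have "((u x)\<^sup>2 * h x) powr (q / 2) = u x powr q * h x powr (q / 2)"
        using pos[of x] hpos[OF x] by (simp add: powr_mult powr_powr flip: powr_numeral)
      moreover have "u x powr p * u x powr q / u x = exp (s * v x)"
        using pos[of x] by (simp add: powr_def v_def s_def exp_diff exp_add algebra_simps)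
      ultimately show ?thesis unfolding product_rhs_def hN by (metis (no_types, lifting) mult.assoc times_divide_eq_left)
    qed
    then show ?thesis
      using reg(3)[OF x] by (simp add: bb sum_subtractf h_def flip: sum_divide_distrib)
  qed
  \<comment> \<open>The relative margin in (N - 1) s < 4; the cap at 1 serves negative s.\<close>
  define \<theta> where "\<theta> = min 1 (1 - (N - 1) * s / 4)"
  have "s < 4 / (N - 1)" using pq N by (simp add: s_def N_def[symmetric] field_simps)
  then have "(N - 1) * s < 4" using N by (simp add: field_simps)
  then have th: "0 < \<theta>" "\<theta> \<le> 1" "(N - 1) * s \<le> 4 * (1 - \<theta>)" by (auto simp: \<theta>_def min_def)
  define C where "C = max 1 ((2 * (2 + (N - 1) * (\<bar>q\<bar> + 2)) + (N - 1) * (12 + 2 * N)) / \<theta>)"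
  have C: "C > 0" by (simp add: C_def less_max_iff_disj)
  have "(1 - (x \<bullet> x) / R\<^sup>2) * sqrt (h x) \<le> C * (1 / R)" if R: "R > 0" and x: "norm x < R" for R and x :: 'a
  proof (cases "x \<in> \<Omega>")
    case False
    then show ?thesis using hzero[OF False] C R by simp
  next
    case True
    define \<zeta> where "\<zeta> y = 1 - (y \<bullet> y) / R\<^sup>2" for y :: 'a
    have \<zeta>: "\<zeta> y = 1 - (norm y / R)\<^sup>2" for y
      by (simp add: \<zeta>_def power2_norm_eq_inner power_divide)
    have z: "\<zeta> y > 0 \<longleftrightarrow> norm y < R" "\<zeta> y \<ge> 0 \<longleftrightarrow> norm y \<le> R" for y
      using R power_less_one_iff[of "norm y / R" 2] power_le_one_iff[of "norm y / R" 2] by (simp_all add: \<zeta>)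
    \<comment> \<open>\<zeta> vanishes on the boundary sphere and h at critical points, so a maximum
      with positive value lies in the open ball and in \<open>\<Omega>\<close>.\<close>
    obtain x0 where x0: "x0 \<in> cball 0 R" and mx: "\<And>y. y \<in> cball 0 R \<Longrightarrow> (\<zeta> y)\<^sup>2 * h y \<le> (\<zeta> x0)\<^sup>2 * h x0"
    proof -
      have "continuous_on (cball 0 R) (\<lambda>y. (\<zeta> y)\<^sup>2 * h y)"
        unfolding \<zeta>_def using R
        by (intro continuous_intros continuous_on_subset[OF conth]) auto
      moreover have "cball (0::'a) R \<noteq> {}" using R by simp
      ultimately show thesis
        using continuous_attains_sup[OF compact_cball] that by blast
    qed
    have "0 < (\<zeta> x)\<^sup>2 * h x" using hpos[OF True] z(1)[of x] x by simp
    also have "\<dots> \<le> (\<zeta> x0)\<^sup>2 * h x0" using x by (intro mx) simp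
    finally have p0: "0 < (\<zeta> x0)\<^sup>2 * h x0" .
    then have x0\<Omega>: "x0 \<in> \<Omega>" using hzero[of x0] by fastforce
    have "\<zeta> x0 \<noteq> 0" using p0 by auto
    then have z0: "\<zeta> x0 > 0" using z(2)[of x0] x0 by simp
    have x0b: "x0 \<in> ball 0 R" using z0 z(1)[of x0] by simp
    have "\<zeta> x0 * sqrt (\<Sum>c\<in>Basis. (gradient v x0 \<bullet> c)\<^sup>2) \<le> C * (1 / R)"
      unfolding C_def N_def \<zeta>_def
    proof (rule bernstein_at_max[where U="\<Omega> \<inter> ball 0 R" and s=s])
      show "open (\<Omega> \<inter> ball 0 R)" using reg(1) by (intro open_Int open_ball)
      show "Ck_on 3 (\<Omega> \<inter> ball 0 R) v" by (rule Ck_on_subset[OF C3v]) simp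
    qed (use N th x0\<Omega> x0b hpos lap mx z0 R in \<open>auto simp: N_def h_def \<zeta>_def\<close>)
    then have b0: "\<zeta> x0 * sqrt (h x0) \<le> C * (1 / R)" by (simp add: h_def)
    have "\<zeta> x * sqrt (h x) = sqrt ((\<zeta> x)\<^sup>2 * h x)"
      using z(1)[of x] x by (simp add: real_sqrt_mult)
    also have "\<dots> \<le> sqrt ((\<zeta> x0)\<^sup>2 * h x0)" using x by (intro real_sqrt_le_mono mx) simp
    also have "\<dots> = \<zeta> x0 * sqrt (h x0)" using z0 by (simp add: real_sqrt_mult)
    finally show ?thesis using b0 by (simp add: \<zeta>_def)
  qed
  then show thesis using that[OF C] unfolding h_def v_def[abs_def] by blast
qed

lemma positive_solution_gradient_zero:
  fixes u :: "'a::euclidean_space \<Rightarrow> real"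
  assumes sol: "positive_solution p q u" and n: "DIM('a) \<ge> 2"
    and pq: "p + q < (real DIM('a) + 3) / (real DIM('a) - 1)"
  shows "gradient u x = 0"
proof (rule ccontr)
  assume nz: "gradient u x \<noteq> 0"
  obtain C where C: "C > 0"
    "\<And>R x. R > 0 \<Longrightarrow> norm x < R \<Longrightarrow>
       (1 - (x \<bullet> x) / R\<^sup>2) * sqrt (\<Sum>c\<in>Basis. (gradient (\<lambda>y. ln (u y)) x \<bullet> c)\<^sup>2) \<le> C * (1 / R)"
    using positive_solution_log_gradient[OF assms] by blast
  have C1: "Ck_on (Suc 0) UNIV u" and pos: "u x > 0"
    using sol by (auto simp: positive_solution_def C_class_iff_Ck_on)
  have "gradient (\<lambda>y. ln (u y)) x = (1 / u x) *\<^sub>R gradient u x"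
    by (rule has_derivative_gradientD(2),
        rule has_derivative_compose_gradient[OF Ck_on_SucD'[OF C1 UNIV_I]],
        rule DERIV_cong[OF DERIV_ln], use pos in \<open>simp_all add: divide_inverse\<close>)
  then have "gradient (\<lambda>y. ln (u y)) x \<noteq> 0" using nz pos by simp
  define L where "L = sqrt (\<Sum>c\<in>Basis. (gradient (\<lambda>y. ln (u y)) x \<bullet> c)\<^sup>2)"
  have L: "L > 0"
    using sum_partials_pos[OF \<open>gradient (\<lambda>y. ln (u y)) x \<noteq> 0\<close>] by (simp add: L_def power2_eq_square)
  \<comment> \<open>R at least 2 |x| keeps the weight at x above 1/2, and R above 2 C / L
    contradicts L/2 \<le> C/R.\<close>
  define R where "R = 2 * norm x + 1 + 2 * C / L"
  have q0: "2 * C / L > 0" using C(1) L by simp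
  have R: "R > 0" "norm x < R" "2 * norm x \<le> R" "2 * C / L < R"
    using norm_ge_zero[of x] q0 unfolding R_def by linarith+
  have "(x \<bullet> x) / R\<^sup>2 \<le> 1 / 4"
  proof -
    have "(2 * norm x)\<^sup>2 \<le> R\<^sup>2" using R by (intro power_mono) auto
    then show ?thesis using R(1) by (simp add: power2_norm_eq_inner power_mult_distrib field_simps)
  qed
  then have "1 / 2 \<le> 1 - (x \<bullet> x) / R\<^sup>2" by linarith
  then have "(1 / 2) * L \<le> (1 - (x \<bullet> x) / R\<^sup>2) * L" using L by (intro mult_right_mono) simp_all
  also have "\<dots> \<le> C * (1 / R)" using C(2)[OF R(1,2)] by (simp add: L_def)
  finally have "R * L \<le> 2 * C" using R(1) by (simp add: field_simps)
  moreover have "2 * C < R * L" using R(4) L by (simp add: field_simps)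
  ultimately show False by simp
qed

theorem corollary1p2:
  fixes p q :: real
  assumes "CARD('n::finite) \<ge> 2"
    and "p + q < (real CARD('n) + 3) / (real CARD('n) - 1)"
  shows "\<not> (\<exists>u :: real ^ 'n \<Rightarrow> real. positive_solution p q u \<and> \<not> u constant_on UNIV)"
proof
  assume "\<exists>u :: real ^ 'n \<Rightarrow> real. positive_solution p q u \<and> \<not> u constant_on UNIV"
  then obtain u :: "real ^ 'n \<Rightarrow> real" where sol: "positive_solution p q u" and nc: "\<not> u constant_on UNIV"
    by blast
  have "gradient u x = 0" for x
    by (rule positive_solution_gradient_zero[OF sol]) (use assms in simp_all)
  moreover have "(u has_derivative (\<lambda>h. h \<bullet> gradient u x)) (at x)" for x
    using sol by (intro has_derivative_gradient) (simp add: positive_solution_def)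
  ultimately have "(u has_derivative (\<lambda>h. 0)) (at x)" for x by simp
  then have "\<exists>c. \<forall>x\<in>UNIV. u x = c" by (intro has_derivative_zero_constant) auto
  then show False using nc by (simp add: constant_on_def)
qed

end
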